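(* Let $\mathcal{X}_{+},\mathcal{X}_{-}$ be real normed spaces and $\theta_{\pm}:\mathcal{M}(S)\to\mathcal{X}_{\pm}$ two linear $\sigma$-normal maps. Let $g_{-}:\mathcal{X}_{-}\to\mathbb{R}$ be lower semicontinuous and convex, such that there is $R_{0}\in\mathbb{R}^{+}$ for which $\{x\in\mathcal{X}_{-}^{\ast}:\Vert x\Vert_{\mathrm{op}}\le R,\ g_{-}^{\ast}(x)<\infty\}$ is nonempty and weak$^{\ast}$-closed for all $R\in[R_{0},\infty)$, and such that $g_{-}^{\ast}$ has minimal linear growth $\Vert\theta_{-}\Vert_{\mathrm{op}}$. Let $g_{+}:\mathcal{X}_{+}\to\mathbb{R}$ be lower semicontinuous, convex and bounded on bounded sets, such that $g_{+}^{\ast}(\mathcal{X}_{+}^{\ast})\subseteq\mathbb{R}$ and $g_{+}^{\ast}$ has minimal linear growth $\Vert\theta_{+}\Vert_{\mathrm{op}}$. Let $\tau_{\pm}(\mu):=\theta_{\pm}(\mu_{S})$ for $\mu\in\mathcal{P}(T)$, and $P(\mu)=h(\mu)-g_{-}(\tau_{-}(\mu))+g_{+}(\tau_{+}(\mu))$. Then: (i) $\displaystyle\sup P(\mathcal{P}(T))=\mathrm{P}^{\flat}=\sup_{y_{+}\in\mathcal{X}_{+}^{\ast}}\inf_{y_{-}\in\mathcal{X}_{-}^{\ast}}\{P_{\mathrm{L}}(y_{+},y_{-})+g_{-}^{\ast}(y_{-})-g_{+}^{\ast}(y_{+})\}$. (ii) For any $x_{+}\in\mathrm{M}^{\flat}$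 and $x_{-}\in M^{\flat}(x_{+})$, the set $$E_{\mathrm{L}}^{\mathrm{sc}}(x_{+},x_{-}):=\{\mu\in E_{\mathrm{L}}(x_{+},x_{-}):x_{-}\in\partial g_{-}(\tau_{-}(\mu))\}$$ is nonempty, convex and weak$^{\ast}$-compact, and does not depend on the choice of $x_{-}\in M^{\flat}(x_{+})$; denote it by $E_{\mathrm{L}}^{\mathrm{sc}}(x_{+})$. Furthermore, for all $x_{+}\in\mathrm{M}^{\flat}$, $$E_{\mathrm{L}}^{\mathrm{sc}}(x_{+})\subseteq\{\mu\in\mathcal{P}(T):x_{+}\in\partial g_{+}(\tau_{+}(\mu))\}.$$ (iii) $E_{P}=M_{P}$, this set is weak$^{\ast}$-compact, and $E_{P}=M_{P}=\bigcup_{x_{+}\in\mathrm{M}^{\flat}}E_{\mathrm{L}}^{\mathrm{sc}}(x_{+})$. If $g_{+}$ is additionally Gateaux-differentiable, then this union is disjoint.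
   Context: Symbolic setting: $(\Omega,d)$ is a compact metric space with $\max d(\Omega\times\Omega)=1$; $\mathrm{m}$ is a fixed Borel probability measure on $\Omega$ with support $\Omega$; $\Sigma=\Omega^{\mathbb{N}}$ with the product topology; $C(\Sigma)$ is the Banach space of real continuous functions with the sup norm; $T:\Sigma\to\Sigma$ is the shift $T(\omega_{1},\omega_{2},\dots)=(\omega_{2},\omega_{3},\dots)$. $\mathcal{P}\subseteq C(\Sigma)^{\ast}$ is the set of Borel probability measures on $\Sigma$ and $\mathcal{P}(T)$ the convex weak$^{\ast}$-compact set of $T$-invariant ones; $\mu(\varphi)=\int\varphi\,\mathrm{d}\mu$. $S=\{\varphi\in C(\Sigma):\Vert\varphi\Vert_{\infty}\le1\}$ with the sup-norm metric; $\mathcal{M}(S)$ is the Banach space of bounded real Borel-measurable functions on $S$ with the sup norm; for $\mu\in C(\Sigma)^{\ast}$, $\mu_{S}\in\mathcal{M}(S)$ is $\mu_{S}(\varphi)=\mu(\varphi)$. A map $\theta$ from $\mathcal{M}(S)$ into a normed space is $\sigma$-normal if $\theta(f_{n})\to\theta(f)$ in norm for every bounded sequence $(f_{n})\subseteq\mathcal{M}(S)$ converging point-wise to $f\in\mathcal{M}(S)$. Entropy: for $\varphi\in C(\Sigma)$, $\mathcal{L}_{0}^{\mathrm{m}}\varphi(\sigma)=\int_{\Omega}\varphi(\omega_{0}\sigma)\,\mathrm{m}(\mathrm{d}\omega_{0})$, where $\omega_{0}\sigma=(\omega_{0},\omega_{1},\dots)$ for $\sigma=(\omega_{1},\omega_{2},\dots)$;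 for $\mu\in\mathcal{P}(T)$, $h(\mu)=\inf_{\varphi}\int_{\Sigma}\ln(\mathcal{L}_{0}^{\mathrm{m}}\varphi(\sigma)/\varphi(\sigma))\,\mu(\mathrm{d}\sigma)\in[-\infty,0]$, infimum over strictly positive $\varphi\in C(\Sigma)$. Convex analysis: $\mathbb{R}^{+}=(0,\infty)$. Duals $\mathcal{X}^{\ast}$ carry the weak$^{\ast}$ topology; $\Vert\cdot\Vert_{\mathrm{op}}$ is the operator norm; $B(0,R)=\{y\in\mathcal{X}^{\ast}:\Vert y\Vert_{\mathrm{op}}\le R\}$. $g^{\ast}(x)=\sup_{y\in\mathcal{X}}\{x(y)-g(y)\}$ for $x\in\mathcal{X}^{\ast}$; $g^{\ast}$ has minimal linear growth $\lambda$ if $\lim_{R\to\infty}\sup_{y\in\mathcal{X}^{\ast}\setminus B(0,R)}\{\lambda\Vert y\Vert_{\mathrm{op}}-g^{\ast}(y)\}=-\infty$; $\partial g(z)=\{x\in\mathcal{X}^{\ast}:x(y-z)\le g(y)-g(z)\ \forall y\in\mathcal{X}\}$. Variational objects, for $y_{\pm}\in\mathcal{X}_{\pm}^{\ast}$ and $\mu\in\mathcal{P}(T)$: $\mathrm{P}(y_{+},y_{-},\mu)=h(\mu)-y_{-}(\theta_{-}(\mu_{S}))+y_{+}(\theta_{+}(\mu_{S}))$; $P_{\mathrm{L}}(y_{+},y_{-})=\sup_{\mu\in\mathcal{P}(T)}\mathrm{P}(y_{+},y_{-},\mu)$; $E_{\mathrm{L}}(y_{+},y_{-})=\{\nu\in\mathcal{P}(T):\mathrm{P}(y_{+},y_{-},\nu)=P_{\mathrm{L}}(y_{+},y_{-})\}$;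 $P_{\mathrm{NL}}(y_{+},y_{-})=P_{\mathrm{L}}(y_{+},y_{-})+g_{-}^{\ast}(y_{-})-g_{+}^{\ast}(y_{+})$; $P^{\flat}(y_{+})=\inf P_{\mathrm{NL}}(y_{+},\mathcal{X}_{-}^{\ast})$; $\mathrm{P}^{\flat}=\sup P^{\flat}(\mathcal{X}_{+}^{\ast})$; $M^{\flat}(y_{+})=\{x_{-}\in\mathcal{X}_{-}^{\ast}:P_{\mathrm{NL}}(y_{+},x_{-})=P^{\flat}(y_{+})\}$; $\mathrm{M}^{\flat}=\{x_{+}\in\mathcal{X}_{+}^{\ast}:P^{\flat}(x_{+})=\mathrm{P}^{\flat}\}$. $M_{P}=\{\mu\in\mathcal{P}(T):P(\mu)=\sup P(\mathcal{P}(T))\}$; $E_{P}=\{\mu\in\mathcal{P}(T):\exists(\mu_{n})_{n\in\mathbb{N}}\subseteq\mathcal{P}(T)$ with $\mu_{n}\to\mu$ weak$^{\ast}$ and $P(\mu_{n})\to\sup P(\mathcal{P}(T))\}$. *)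

theory Defs
  imports "HOL-Probability.Probability_Measure"
begin

section \<open>The symbolic space, its shift and its continuous functions\<close>

text \<open>
  The alphabet \<open>\<Omega>\<close> is a type \<open>'a\<close> (compactness of its universe is a hypothesis of the theorem).
  \<open>\<Sigma>\<close> is the type \<open>nat \<Rightarrow> 'a\<close>, whose topology is the product topology; the letter
  \<open>\<omega>\<^sub>1\<close> of a sequence has index \<open>0\<close>. As \<open>\<Sigma>\<close> is compact, \<open>C(\<Sigma>)\<close> is the type of bounded continuous
  functions with its sup norm.
\<close>

type_synonym 'a cfun = "(nat \<Rightarrow> 'a) \<Rightarrow>\<^sub>C real"

type_synonym 'a cdual = "'a cfun \<Rightarrow>\<^sub>L real"

definition shift_map :: "(nat \<Rightarrow> 'a) \<Rightarrow> (nat \<Rightarrow> 'a)" where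
  "shift_map \<sigma> = (\<lambda>n. \<sigma> (Suc n))"

definition measure_support :: "'b::topological_space measure \<Rightarrow> 'b set" where
  "measure_support M = {x. \<forall>U. open U \<longrightarrow> x \<in> U \<longrightarrow> emeasure M U > 0}"

text \<open>The topology of pointwise convergence on a dual space.\<close>

abbreviation weak_star :: "('x::real_normed_vector \<Rightarrow>\<^sub>L real) topology" where
  "weak_star \<equiv> strong_operator_topology"


section \<open>Probability measures as elements of the dual of \<open>C(\<Sigma>)\<close>\<close>

definition represents :: "(nat \<Rightarrow> 'a::metric_space) measure \<Rightarrow> 'a cdual \<Rightarrow> bool" where
  "represents M \<mu> \<longleftrightarrow>
     prob_space M \<and> sets M = sets borel \<and> (\<forall>\<phi>. blinfun_apply \<mu> \<phi> = (\<integral>\<sigma>. apply_bcontfun \<phi> \<sigma> \<partial>M))"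

definition prob_functionals :: "'a::metric_space cdual set" where
  "prob_functionals = {\<mu>. \<exists>M. represents M \<mu>}"

definition inv_functionals :: "'a::metric_space cdual set" where
  "inv_functionals = {\<mu> \<in> prob_functionals. \<exists>M. represents M \<mu> \<and> distr M borel shift_map = M}"

text \<open>A Borel probability measure on the metrizable space \<open>\<Sigma>\<close> is determined by its functional, so
  the choice below is one of a unique object.\<close>

definition rep_measure :: "'a::metric_space cdual \<Rightarrow> (nat \<Rightarrow> 'a) measure" where
  "rep_measure \<mu> = (SOME M. represents M \<mu>)"

definition transfer_op :: "'a::metric_space measure \<Rightarrow> 'a cfun \<Rightarrow> (nat \<Rightarrow> 'a) \<Rightarrow> real" where
  "transfer_op m \<phi> \<sigma> = (\<integral>\<omega>. apply_bcontfun \<phi> (case_nat \<omega> \<sigma>) \<partial>m)"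

definition entropy_h :: "'a::metric_space measure \<Rightarrow> 'a cdual \<Rightarrow> ereal" where
  "entropy_h m \<mu> =
     (INF \<phi> \<in> {\<phi>. \<forall>\<sigma>. apply_bcontfun \<phi> \<sigma> > 0}.
        ereal (\<integral>\<sigma>. ln (transfer_op m \<phi> \<sigma> / apply_bcontfun \<phi> \<sigma>) \<partial>(rep_measure \<mu>)))"


section \<open>Bounded Borel functions on the unit ball of \<open>C(\<Sigma>)\<close>\<close>

definition unit_ball :: "'a::metric_space cfun set" where
  "unit_ball = {\<phi>. norm \<phi> \<le> 1}"

lemma zero_in_unit_ball: "0 \<in> unit_ball"
  by (simp add: unit_ball_def)

text \<open>\<open>\<M>(S)\<close> for \<open>S = unit_ball\<close>. HOL functions being total, a function on \<open>S\<close> is encoded by its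
  extension by \<open>0\<close>; \<open>restrict_space borel S\<close> is the Borel \<open>\<sigma>\<close>-algebra of the metric space \<open>S\<close>.\<close>

typedef (overloaded) 'a bmfun =
  "{f :: 'a::metric_space cfun \<Rightarrow> real.
      f \<in> borel_measurable (restrict_space borel unit_ball) \<and>
      bounded (f ` unit_ball) \<and> (\<forall>\<phi>. \<phi> \<notin> unit_ball \<longrightarrow> f \<phi> = 0)}"
  morphisms apply_bmfun Bmfun
  by (rule exI[of _ "\<lambda>_. 0"]) (auto simp: bounded_iff)

setup_lifting type_definition_bmfun

lemma bounded_apply_bmfun: "bounded (apply_bmfun f ` unit_ball)"
  using apply_bmfun[of f] by simp

lemma apply_bmfun_outside: "\<phi> \<notin> unit_ball \<Longrightarrow> apply_bmfun f \<phi> = 0"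
  using apply_bmfun[of f] by simp

lemma bmfun_eqI: "(\<And>\<phi>. \<phi> \<in> unit_ball \<Longrightarrow> apply_bmfun f \<phi> = apply_bmfun g \<phi>) \<Longrightarrow> f = g"
  by (metis apply_bmfun_inject apply_bmfun_outside ext)

instantiation bmfun :: (metric_space) real_vector
begin

lift_definition zero_bmfun :: "'a bmfun" is "\<lambda>_. 0"
  by (auto simp: bounded_iff)

lift_definition plus_bmfun :: "'a bmfun \<Rightarrow> 'a bmfun \<Rightarrow> 'a bmfun" is "\<lambda>f g \<phi>. f \<phi> + g \<phi>"
  by (auto intro: bounded_plus_comp)

lift_definition uminus_bmfun :: "'a bmfun \<Rightarrow> 'a bmfun" is "\<lambda>f \<phi>. - f \<phi>"
  by auto

lift_definition minus_bmfun :: "'a bmfun \<Rightarrow> 'a bmfun \<Rightarrow> 'a bmfun" is "\<lambda>f g \<phi>. f \<phi> - g \<phi>"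
  by (auto intro: bounded_minus_comp)

lift_definition scaleR_bmfun :: "real \<Rightarrow> 'a bmfun \<Rightarrow> 'a bmfun" is "\<lambda>r f \<phi>. r * f \<phi>"
  by (auto intro: bounded_scaleR_comp[where 'b = real, simplified])

instance
  by standard (transfer; simp add: fun_eq_iff algebra_simps)+

end

instantiation bmfun :: (metric_space) real_normed_vector
begin

definition norm_bmfun :: "'a bmfun \<Rightarrow> real" where
  "norm_bmfun f = (SUP \<phi> \<in> unit_ball. \<bar>apply_bmfun f \<phi>\<bar>)"

definition dist_bmfun :: "'a bmfun \<Rightarrow> 'a bmfun \<Rightarrow> real" where
  "dist_bmfun f g = norm (f - g)"

definition sgn_bmfun :: "'a bmfun \<Rightarrow> 'a bmfun" where
  "sgn_bmfun f = f /\<^sub>R norm f"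

definition uniformity_bmfun :: "('a bmfun \<times> 'a bmfun) filter" where
  "uniformity_bmfun = (INF e\<in>{0 <..}. principal {(x, y). dist x y < e})"

definition open_bmfun :: "'a bmfun set \<Rightarrow> bool" where
  "open_bmfun U = (\<forall>x\<in>U. \<forall>\<^sub>F (x', y) in uniformity. x' = x \<longrightarrow> y \<in> U)"

lemma abs_apply_bmfun_le_norm:
  assumes "\<phi> \<in> unit_ball"
  shows "\<bar>apply_bmfun f \<phi>\<bar> \<le> norm (f :: 'a bmfun)"
proof -
  obtain B where "\<And>\<psi>. \<psi> \<in> unit_ball \<Longrightarrow> \<bar>apply_bmfun f \<psi>\<bar> \<le> B"
    using bounded_apply_bmfun[of f] by (auto simp: bounded_iff)
  then show ?thesis
    unfolding norm_bmfun_def using assms by (intro cSUP_upper bdd_aboveI2) auto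
qed

lemma norm_bmfun_le:
  assumes "\<And>\<phi>. \<phi> \<in> unit_ball \<Longrightarrow> \<bar>apply_bmfun f \<phi>\<bar> \<le> B"
  shows "norm (f :: 'a bmfun) \<le> B"
  unfolding norm_bmfun_def using zero_in_unit_ball assms by (intro cSUP_least) auto

instance
proof
  fix f g :: "'a bmfun" and r :: real
  show "norm f = 0 \<longleftrightarrow> f = 0"
  proof
    assume "norm f = 0"
    then show "f = 0"
      using abs_apply_bmfun_le_norm[of _ f] by (intro bmfun_eqI) (simp add: zero_bmfun.rep_eq)
  next
    assume "f = 0"
    then have "norm f \<le> 0"
      by (intro norm_bmfun_le) (simp add: zero_bmfun.rep_eq)
    moreover have "0 \<le> norm f"
      using abs_apply_bmfun_le_norm[OF zero_in_unit_ball, of f] by linarith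
    ultimately show "norm f = 0" by simp
  qed
  show "norm (f + g) \<le> norm f + norm g"
  proof (rule norm_bmfun_le)
    fix \<phi> :: "'a cfun" assume "\<phi> \<in> unit_ball"
    then show "\<bar>apply_bmfun (f + g) \<phi>\<bar> \<le> norm f + norm g"
      using abs_apply_bmfun_le_norm[of \<phi> f] abs_apply_bmfun_le_norm[of \<phi> g]
      by (simp add: plus_bmfun.rep_eq)
  qed
  have le: "norm (r *\<^sub>R f) \<le> \<bar>r\<bar> * norm f" for r and f :: "'a bmfun"
    by (rule norm_bmfun_le)
      (simp add: scaleR_bmfun.rep_eq abs_mult abs_apply_bmfun_le_norm mult_left_mono)
  show "norm (r *\<^sub>R f) = \<bar>r\<bar> * norm f"
  proof (cases "r = 0")
    case True
    have "norm (0 :: 'a bmfun) \<le> 0"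
      by (intro norm_bmfun_le) (simp add: zero_bmfun.rep_eq)
    moreover have "0 \<le> norm (0 :: 'a bmfun)"
      using abs_apply_bmfun_le_norm[OF zero_in_unit_ball, of 0] by linarith
    ultimately show ?thesis using True by simp
  next
    case False
    have "norm f \<le> \<bar>inverse r\<bar> * norm (r *\<^sub>R f)"
      using le[of "inverse r" "r *\<^sub>R f"] False by simp
    then have "\<bar>r\<bar> * norm f \<le> norm (r *\<^sub>R f)"
      using False by (simp add: field_simps)
    with le[of r f] show ?thesis by simp
  qed
qed (simp_all add: dist_bmfun_def sgn_bmfun_def uniformity_bmfun_def open_bmfun_def)

end

text \<open>The restriction \<open>\<mu>\<^sub>S\<close> of a functional to \<open>S\<close>.\<close>

lift_definition restr_S :: "'a::metric_space cdual \<Rightarrow> 'a bmfun" is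
  "\<lambda>\<mu> \<phi>. if \<phi> \<in> unit_ball then blinfun_apply \<mu> \<phi> else 0"
proof (intro CollectI conjI)
  fix \<mu> :: "'a cdual"
  let ?f = "\<lambda>\<phi>. if \<phi> \<in> unit_ball then blinfun_apply \<mu> \<phi> else 0"
  have "blinfun_apply \<mu> \<in> borel_measurable (restrict_space borel unit_ball)"
    by (intro measurable_restrict_space1 borel_measurable_continuous_onI)
      (intro continuous_intros)
  also have "?this \<longleftrightarrow> ?f \<in> borel_measurable (restrict_space borel unit_ball)"
    by (rule measurable_cong) (simp add: space_restrict_space)
  finally show "?f \<in> borel_measurable (restrict_space borel unit_ball)" .
  have "\<bar>blinfun_apply \<mu> \<phi>\<bar> \<le> norm \<mu>" if "\<phi> \<in> unit_ball" for \<phi>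
  proof -
    have "norm (blinfun_apply \<mu> \<phi>) \<le> norm \<mu> * norm \<phi>"
      by (rule norm_blinfun)
    also have "\<dots> \<le> norm \<mu> * 1"
      using that by (intro mult_left_mono) (auto simp: unit_ball_def)
    finally show ?thesis by simp
  qed
  then show "bounded (?f ` unit_ball)"
    unfolding bounded_iff by (intro exI[of _ "norm \<mu>"]) auto
qed auto

definition sigma_normal :: "('a::metric_space bmfun \<Rightarrow> 'x::real_normed_vector) \<Rightarrow> bool" where
  "sigma_normal \<theta> \<longleftrightarrow>
     (\<forall>F f. bounded (range F) \<longrightarrow>
        (\<forall>\<phi>\<in>unit_ball. (\<lambda>n::nat. apply_bmfun (F n) \<phi>) \<longlonglongrightarrow> apply_bmfun f \<phi>) \<longrightarrow>
        (\<lambda>n. \<theta> (F n)) \<longlonglongrightarrow> \<theta> f)"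


section \<open>Convex analysis\<close>

definition lower_semicont :: "('x::topological_space \<Rightarrow> real) \<Rightarrow> bool" where
  "lower_semicont g \<longleftrightarrow> (\<forall>x. \<forall>a < g x. \<forall>\<^sub>F y in nhds x. a < g y)"

definition bounded_on_bounded_sets :: "('x::metric_space \<Rightarrow> real) \<Rightarrow> bool" where
  "bounded_on_bounded_sets g \<longleftrightarrow> (\<forall>B. bounded B \<longrightarrow> bounded (g ` B))"

definition conjugate :: "('x::real_normed_vector \<Rightarrow> real) \<Rightarrow> ('x \<Rightarrow>\<^sub>L real) \<Rightarrow> ereal" where
  "conjugate g x = (SUP y. ereal (blinfun_apply x y - g y))"

definition minimal_linear_growth ::
    "(('x::real_normed_vector \<Rightarrow>\<^sub>L real) \<Rightarrow> ereal) \<Rightarrow> real \<Rightarrow> bool" where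
  "minimal_linear_growth G l \<longleftrightarrow>
     ((\<lambda>R::real. SUP y \<in> {y. \<not> norm y \<le> R}. ereal (l * norm y) - G y) \<longlongrightarrow> -\<infinity>) at_top"

definition subdiff :: "('x::real_normed_vector \<Rightarrow> real) \<Rightarrow> 'x \<Rightarrow> ('x \<Rightarrow>\<^sub>L real) set" where
  "subdiff g z = {x. \<forall>y. blinfun_apply x (y - z) \<le> g y - g z}"

definition gateaux_differentiable :: "('x::real_normed_vector \<Rightarrow> real) \<Rightarrow> bool" where
  "gateaux_differentiable g \<longleftrightarrow>
     (\<forall>x. \<exists>D :: 'x \<Rightarrow>\<^sub>L real. \<forall>v.
        ((\<lambda>t. (g (x + t *\<^sub>R v) - g x) / t) \<longlongrightarrow> blinfun_apply D v) (at 0))"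


section \<open>Variational objects\<close>

text \<open>
  Suffixes \<open>p\<close> and \<open>m\<close> stand for the subscripts \<open>+\<close> and \<open>-\<close>; the reference measure on the
  alphabet is the argument \<open>m\<close>. All extended-real expressions below avoid \<open>\<infinity> - \<infinity>\<close> under the
  hypotheses of the theorem.
\<close>

definition lin_func ::
    "'a::metric_space measure \<Rightarrow> ('a bmfun \<Rightarrow> 'x::real_normed_vector) \<Rightarrow> ('a bmfun \<Rightarrow> 'y::real_normed_vector)
     \<Rightarrow> ('x \<Rightarrow>\<^sub>L real) \<Rightarrow> ('y \<Rightarrow>\<^sub>L real) \<Rightarrow> 'a cdual \<Rightarrow> ereal" where
  "lin_func m \<theta>p \<theta>m yp ym \<mu> =
     entropy_h m \<mu> - ereal (blinfun_apply ym (\<theta>m (restr_S \<mu>)))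
       + ereal (blinfun_apply yp (\<theta>p (restr_S \<mu>)))"

definition P_L where
  "P_L m \<theta>p \<theta>m yp ym = (SUP \<mu> \<in> inv_functionals. lin_func m \<theta>p \<theta>m yp ym \<mu>)"

definition E_L where
  "E_L m \<theta>p \<theta>m yp ym = {\<nu> \<in> inv_functionals. lin_func m \<theta>p \<theta>m yp ym \<nu> = P_L m \<theta>p \<theta>m yp ym}"

definition P_NL where
  "P_NL m \<theta>p \<theta>m gp gm yp ym = P_L m \<theta>p \<theta>m yp ym + conjugate gm ym - conjugate gp yp"

definition P_flat where
  "P_flat m \<theta>p \<theta>m gp gm yp = (INF ym. P_NL m \<theta>p \<theta>m gp gm yp ym)"

definition P_flat_sup where
  "P_flat_sup m \<theta>p \<theta>m gp gm = (SUP yp. P_flat m \<theta>p \<theta>m gp gm yp)"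

definition M_flat where
  "M_flat m \<theta>p \<theta>m gp gm yp = {xm. P_NL m \<theta>p \<theta>m gp gm yp xm = P_flat m \<theta>p \<theta>m gp gm yp}"

definition M_flat_sup where
  "M_flat_sup m \<theta>p \<theta>m gp gm = {xp. P_flat m \<theta>p \<theta>m gp gm xp = P_flat_sup m \<theta>p \<theta>m gp gm}"

definition E_sc2 where
  "E_sc2 m \<theta>p \<theta>m gm xp xm = {\<mu> \<in> E_L m \<theta>p \<theta>m xp xm. xm \<in> subdiff gm (\<theta>m (restr_S \<mu>))}"

text \<open>The common value of \<open>E_sc2\<close> over all \<open>xm \<in> M_flat xp\<close>. It is specified only when this value is
  independent of \<open>xm\<close> and \<open>M_flat xp\<close> is nonempty.\<close>

definition E_sc where
  "E_sc m \<theta>p \<theta>m gp gm xp =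
     (THE E. \<forall>xm \<in> M_flat m \<theta>p \<theta>m gp gm xp. E_sc2 m \<theta>p \<theta>m gm xp xm = E)"

definition P_fun ::
    "'a::metric_space measure \<Rightarrow> ('a bmfun \<Rightarrow> 'x::real_normed_vector) \<Rightarrow> ('a bmfun \<Rightarrow> 'y::real_normed_vector)
     \<Rightarrow> ('x \<Rightarrow> real) \<Rightarrow> ('y \<Rightarrow> real) \<Rightarrow> 'a cdual \<Rightarrow> ereal" where
  "P_fun m \<theta>p \<theta>m gp gm \<mu> =
     entropy_h m \<mu> - ereal (gm (\<theta>m (restr_S \<mu>))) + ereal (gp (\<theta>p (restr_S \<mu>)))"

definition M_set :: "('a::metric_space cdual \<Rightarrow> ereal) \<Rightarrow> 'a cdual set" where
  "M_set P = {\<mu> \<in> inv_functionals. P \<mu> = (SUP \<nu> \<in> inv_functionals. P \<nu>)}"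

definition E_set :: "('a::metric_space cdual \<Rightarrow> ereal) \<Rightarrow> 'a cdual set" where
  "E_set P = {\<mu> \<in> inv_functionals.
     \<exists>F :: nat \<Rightarrow> 'a cdual. range F \<subseteq> inv_functionals \<and> limitin weak_star F \<mu> sequentially \<and>
       (\<lambda>n. P (F n)) \<longlonglongrightarrow> (SUP \<nu> \<in> inv_functionals. P \<nu>)}"

end

theory Submission
  imports Defs
begin

text \<open>
  On the invariant probabilities the entropy is concave and upper semicontinuous for the weak-star
  topology, which is sequentially compact and metrizable there because \<open>C(\<Sigma>)\<close> is separable; hence
  sequential \<open>\<sigma>\<close>-normality of \<open>\<theta>\<^sub>\<plusminus>\<close> suffices. For fixed \<open>y\<^sub>+\<close>, perturb the problem of maximising
  \<open>h(\<mu>) + y\<^sub>+(\<tau>\<^sub>+(\<mu>)) - g\<^sub>-(\<tau>\<^sub>-(\<mu>))\<close> by replacing \<open>\<tau>\<^sub>-(\<mu>)\<close> with \<open>\<tau>\<^sub>-(\<mu>) + z\<close>. The value function is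
  convex in \<open>z\<close> and lower semicontinuous at \<open>0\<close>, so its lower bounds at \<open>0\<close> extend to affine minorants;
  the minimal growth of \<open>g\<^sub>-\<^sup>*\<close> bounds their slopes, and in the limit one obtains a subgradient at \<open>0\<close>.
  It attains the infimum over \<open>\<X>\<^sub>-\<^sup>*\<close>, and there is no duality gap. All minimisers \<open>x\<^sub>-\<close> then give the same
  set, namely the maximisers of the unperturbed problem. Finally \<open>g\<^sub>+\<close> is everywhere
  subdifferentiable, being convex and bounded on bounded sets, and a subgradient at \<open>\<tau>\<^sub>+(\<mu>)\<close>
  linearises \<open>g\<^sub>+\<close> at a maximiser \<open>\<mu>\<close> of \<open>P\<close>.
\<close>


section \<open>Hahn--Banach and affine minorants\<close>

text \<open>A subgradient at \<open>0\<close> is not automatic. The perturbed value function is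
  shown to be lower semicontinuous at \<open>0\<close> only, and the slopes of its affine minorants
  lie in the dual of an arbitrary normed space, where a bounded sequence need not have a weak-star
  convergent subsequence. The limit is therefore taken on cones and not on slopes: a common bound
  \<open>R\<close> for the slopes yields the minorant \<open>a - R * norm z\<close> for every
  \<open>a\<close> slightly below the value at \<open>0\<close>; letting \<open>a\<close> tend to
  that value leaves a cone with the exact height, and Hahn--Banach replaces the cone by a linear
  minorant.

  Invariant functionals are defined through measures, whereas compactness produces pointwise limits
  of functionals. The Riesz theorem closes this gap by turning membership into linear conditions.

  The entropy may be \<open>-\<infinity>\<close>. Real arithmetic is confined to the invariant
  functionals of finite entropy, and the product measure shows that there are some.\<close>

definition sublinear :: "('v::real_vector \<Rightarrow> real) \<Rightarrow> bool" where
  "sublinear p \<longleftrightarrow> (\<forall>x y. p (x + y) \<le> p x + p y) \<and> (\<forall>t\<ge>0. \<forall>x. p (t *\<^sub>R x) \<le> t * p x)"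

lemma sublinearI:
  assumes "\<And>x y. p (x + y) \<le> p x + p y" "p 0 \<le> 0" "\<And>t x. t > 0 \<Longrightarrow> p (t *\<^sub>R x) \<le> t * p x"
  shows "sublinear p"
  unfolding sublinear_def using assms by (metis mult_zero_left order_le_less scaleR_zero_left)

lemma sublinear_add: "sublinear p \<Longrightarrow> p (x + y) \<le> p x + p y"
  and sublinear_scale: "sublinear p \<Longrightarrow> 0 \<le> t \<Longrightarrow> p (t *\<^sub>R x) \<le> t * p x"
  by (auto simp: sublinear_def)

lemma sublinear_zero:
  assumes "sublinear p"
  shows "p 0 = 0"
  using sublinear_scale[OF assms, of 0 0] sublinear_add[OF assms, of 0 0] by simp

lemma sublinear_ge_minus:
  assumes "sublinear p"
  shows "- p (- x) \<le> p x"
  using sublinear_add[OF assms, of x "- x"] sublinear_zero[OF assms] by simp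

text \<open>Members of the chain lie above \<open>- p (- x)\<close>, so the pointwise infima are
  genuine. Subadditivity needs one functional that is small at both arguments; in a chain the
  smaller of two given members serves.\<close>

lemma sublinear_chain_INF:
  assumes ne: "C \<noteq> {}" and subl: "\<And>q. q \<in> C \<Longrightarrow> sublinear q"
    and chain: "\<And>q r. q \<in> C \<Longrightarrow> r \<in> C \<Longrightarrow> q \<le> r \<or> r \<le> q"
    and le: "\<And>q. q \<in> C \<Longrightarrow> q \<le> p"
  shows "sublinear (\<lambda>x. INF q\<in>C. q x)" "\<And>q x. q \<in> C \<Longrightarrow> (INF q\<in>C. q x) \<le> q x"
proof -
  have bdd: "bdd_below ((\<lambda>q. q x) ` C)" for x
  proof (rule bdd_belowI2)
    fix q assume "q \<in> C"
    then show "- p (- x) \<le> q x"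
      using sublinear_ge_minus[OF subl, of q x] le[of q, THEN le_funD, of "- x"] by linarith
  qed
  show lower: "(INF q\<in>C. q x) \<le> q x" if "q \<in> C" for q x
    using bdd that by (rule cINF_lower)
  show "sublinear (\<lambda>x. INF q\<in>C. q x)"
  proof (rule sublinearI)
    fix x y
    have "(INF q\<in>C. q (x + y)) - r y \<le> q x" if qr: "q \<in> C" "r \<in> C" for q r
    proof -
      obtain s where s: "s \<in> C" "s \<le> q" "s \<le> r"
        using chain[OF qr] qr by blast
      show ?thesis
        using lower[OF s(1), of "x + y"] sublinear_add[OF subl[OF s(1)], of x y]
          le_funD[OF s(2), of x] le_funD[OF s(3), of y] by linarith
    qed
    then have "(INF q\<in>C. q (x + y)) - r y \<le> (INF q\<in>C. q x)" if "r \<in> C" for r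
      using that ne by (intro cINF_greatest) auto
    then have "(INF q\<in>C. q (x + y)) - (INF q\<in>C. q x) \<le> (INF q\<in>C. q y)"
      using ne by (intro cINF_greatest) (auto simp: algebra_simps)
    then show "(INF q\<in>C. q (x + y)) \<le> (INF q\<in>C. q x) + (INF q\<in>C. q y)" by simp
  next
    obtain q where "q \<in> C" using ne by blast
    then show "(INF q\<in>C. q 0) \<le> 0"
      using lower[of q 0] sublinear_zero[OF subl, of q] by simp
  next
    fix t :: real and x assume t: "t > 0"
    have "(INF q\<in>C. q (t *\<^sub>R x)) / t \<le> (INF q\<in>C. q x)"
    proof (rule cINF_greatest[OF ne])
      fix q assume q: "q \<in> C"
      show "(INF q\<in>C. q (t *\<^sub>R x)) / t \<le> q x"
        using lower[OF q, of "t *\<^sub>R x"] sublinear_scale[OF subl[OF q], of t x] t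
        by (simp add: field_simps)
    qed
    then show "(INF q\<in>C. q (t *\<^sub>R x)) \<le> t * (INF q\<in>C. q x)"
      using t by (simp add: field_simps)
  qed
qed

text \<open>Take the infimum over \<open>t \<ge> 0\<close> of
  \<open>q (x + t *\<^sub>R v) - t * q v\<close>: \<open>t = 0\<close> gives
  \<open>q' \<le> q\<close> and \<open>t = 1\<close> the bound along \<open>v\<close>. Since
  \<open>q (t *\<^sub>R v) = t * q v\<close>, it stays above \<open>- q (- x)\<close>. This replaces
  the one-dimensional extension step of the usual proof of Hahn--Banach.\<close>

lemma sublinear_lower_along:
  assumes q: "sublinear q"
  obtains q' where "sublinear q'" "q' \<le> q" "\<And>x. q' x \<le> q (x + v) - q v"
proof
  let ?q' = "\<lambda>x. INF t\<in>{0..}. q (x + t *\<^sub>R v) - t * q v"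
  have bdd: "bdd_below ((\<lambda>t. q (x + t *\<^sub>R v) - t * q v) ` {0..})" for x
  proof (rule bdd_belowI2)
    fix t :: real assume "t \<in> {0..}"
    have "q (t *\<^sub>R v) = t * q v" if "t > 0"
      using sublinear_scale[OF q, of t v] sublinear_scale[OF q, of "1 / t" "t *\<^sub>R v"] that
      by (simp add: field_simps)
    then have "q (t *\<^sub>R v) = t * q v"
      using \<open>t \<in> {0..}\<close> sublinear_zero[OF q] by (cases "t = 0") auto
    then show "- q (- x) \<le> q (x + t *\<^sub>R v) - t * q v"
      using sublinear_add[OF q, of "x + t *\<^sub>R v" "- x"] by simp
  qed
  have lower: "?q' x \<le> q (x + t *\<^sub>R v) - t * q v" if "t \<ge> 0" for t x
    using bdd by (rule cINF_lower) (use that in auto)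
  show "?q' \<le> q"
    using lower[of 0] by (auto intro!: le_funI)
  show "?q' x \<le> q (x + v) - q v" for x
    using lower[of 1 x] by simp
  show "sublinear ?q'"
  proof (rule sublinearI)
    fix x y
    have *: "?q' (x + y) \<le> (q (x + s *\<^sub>R v) - s * q v) + (q (y + t *\<^sub>R v) - t * q v)"
      if "s \<ge> 0" "t \<ge> 0" for s t
      using lower[of "s + t" "x + y"] that sublinear_add[OF q, of "x + s *\<^sub>R v" "y + t *\<^sub>R v"]
      by (simp add: algebra_simps)
    have "?q' (x + y) - (q (y + t *\<^sub>R v) - t * q v) \<le> ?q' x" if "t \<ge> 0" for t
      using *[OF _ that] by (intro cINF_greatest) (auto simp: algebra_simps)
    then have "?q' (x + y) - ?q' x \<le> ?q' y"
      by (intro cINF_greatest) (auto simp: algebra_simps)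
    then show "?q' (x + y) \<le> ?q' x + ?q' y" by simp
  next
    show "?q' 0 \<le> 0"
      using lower[of 0 0] sublinear_zero[OF q] by simp
  next
    fix r :: real and x assume r: "r > 0"
    have "?q' (r *\<^sub>R x) / r \<le> ?q' x"
    proof (rule cINF_greatest)
      fix t :: real assume t: "t \<in> {0..}"
      have "?q' (r *\<^sub>R x) \<le> q (r *\<^sub>R (x + t *\<^sub>R v)) - r * t * q v"
        using lower[of "r * t" "r *\<^sub>R x"] r t by (simp add: algebra_simps)
      also have "\<dots> \<le> r * q (x + t *\<^sub>R v) - r * t * q v"
        using sublinear_scale[OF q, of r] r by simp
      finally show "?q' (r *\<^sub>R x) / r \<le> q (x + t *\<^sub>R v) - t * q v"
        using r by (simp add: field_simps)
    qed simp
    then show "?q' (r *\<^sub>R x) \<le> r * ?q' x"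
      using r by (simp add: field_simps)
  qed
qed

text \<open>A minimal sublinear functional is linear: it cannot be lowered along any direction.\<close>

theorem hahn_banach_dominated:
  fixes p :: "'v::real_vector \<Rightarrow> real"
  assumes p: "sublinear p"
  shows "\<exists>f. linear f \<and> (\<forall>x. f x \<le> p x)"
proof -
  define A where "A = {q. sublinear q \<and> q \<le> p}"
  \<comment> \<open>The order is reversed: a maximal element for \<open>P\<close> is a minimal
    sublinear functional below \<open>p\<close>.\<close>
  define P where "P = (\<lambda>q r :: 'v \<Rightarrow> real. r \<le> q)"
  have po: "partial_order_on A (relation_of P A)"
    by (rule partial_order_on_relation_ofI) (auto simp: P_def)
  have "\<exists>u\<in>A. \<forall>a\<in>C. P a u" if C: "C \<in> Chains (relation_of P A)" for C
  proof (cases "C = {}")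
    case True
    then show ?thesis using p by (auto simp: A_def)
  next
    case False
    have CA: "q \<in> A" if "q \<in> C" for q
      using C that by (auto simp: Chains_def relation_of_def)
    have chain: "q \<le> r \<or> r \<le> q" if "q \<in> C" "r \<in> C" for q r
      using C that by (auto simp: Chains_def relation_of_def P_def)
    note * = sublinear_chain_INF[OF False _ chain, of p]
    let ?u = "\<lambda>x. INF q\<in>C. q x"
    have "sublinear ?u" "\<And>q. q \<in> C \<Longrightarrow> ?u \<le> q"
      using * CA by (auto simp: A_def le_fun_def)
    moreover obtain q where "q \<in> C" using False by blast
    ultimately have "?u \<in> A"
      using CA[of q] by (auto simp: A_def intro: order_trans)
    then show ?thesis
      using \<open>\<And>q. q \<in> C \<Longrightarrow> ?u \<le> q\<close> by (auto simp: P_def)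
  qed
  from predicate_Zorn[OF po this] obtain q where q: "q \<in> A"
    and minimal: "\<And>r. r \<in> A \<Longrightarrow> r \<le> q \<Longrightarrow> r = q"
    unfolding P_def by blast
  then have subl: "sublinear q" and "q \<le> p"
    by (auto simp: A_def)
  have add: "q (x + v) = q x + q v" for x v
  proof -
    obtain q' where q': "sublinear q'" "q' \<le> q" "\<And>x. q' x \<le> q (x + v) - q v"
      using sublinear_lower_along[OF subl] by blast
    then have "q' = q"
      using \<open>q \<le> p\<close> by (intro minimal) (auto simp: A_def intro: order_trans)
    then show ?thesis
      using q'(3)[of x] sublinear_add[OF subl, of x v] by simp
  qed
  have neg: "q (- x) = - q x" for x
    using add[of x "- x"] sublinear_zero[OF subl] by simp
  have pos: "q (t *\<^sub>R x) = t * q x" if "t \<ge> 0" for t x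
    using sublinear_scale[OF subl that, of x] sublinear_scale[OF subl that, of "- x"] neg by simp
  have "q (t *\<^sub>R x) = t * q x" for t x
    using pos[of t x] pos[of "- t" "x"] neg[of "t *\<^sub>R x"] by (cases "t \<ge> 0") auto
  then have "linear q"
    using add by (intro linearI) auto
  then show ?thesis
    using \<open>q \<le> p\<close> by (auto simp: le_fun_def)
qed

text \<open>The functional \<open>p\<close> of the proof is the infimal convolution of the
  positively homogeneous hull of \<open>g\<close> with \<open>M' * norm\<close>. The lower cone
  keeps it above \<open>- M' * norm v\<close>. A linear functional below \<open>p\<close> is below
  \<open>g\<close> (take \<open>t = 1\<close> and the argument itself for \<open>x\<close>) and
  below \<open>M' * norm\<close> (take \<open>t = 0\<close>), hence bounded.\<close>

lemma convex_ge_cone_imp_linear_minorant: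
  fixes g :: "'v::real_normed_vector \<Rightarrow> real"
  assumes conv: "convex_on UNIV g" and lower: "\<And>x. - M * norm x \<le> g x"
  obtains y :: "'v \<Rightarrow>\<^sub>L real" where "\<And>x. blinfun_apply y x \<le> g x"
proof -
  define M' where "M' = max M 0"
  have lower': "- M' * norm x \<le> g x" for x
  proof -
    have "M * norm x \<le> M' * norm x" unfolding M'_def by (intro mult_right_mono) auto
    then show ?thesis using lower[of x] by simp
  qed
  let ?A = "{0..} \<times> (UNIV :: 'v set)"
  let ?F = "\<lambda>v (t, x). t * g x + M' * norm (v - t *\<^sub>R x)"
  define p where "p v = (INF a\<in>?A. ?F v a)" for v
  have bound: "- M' * norm v \<le> ?F v (t, x)" if "t \<ge> 0" for v t x
  proof -
    have "M' * norm (t *\<^sub>R x) \<le> M' * (norm v + norm (v - t *\<^sub>R x))"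
      using norm_triangle_ineq4[of v "v - t *\<^sub>R x"] by (intro mult_left_mono) (auto simp: M'_def)
    moreover have "t * (- M' * norm x) \<le> t * g x"
      using lower'[of x] that by (rule mult_left_mono)
    ultimately show ?thesis
      using that by (simp add: algebra_simps)
  qed
  have bdd: "bdd_below (?F v ` ?A)" for v
    using bound by (intro bdd_belowI2[where m = "- M' * norm v"]) auto
  have p_le: "p v \<le> t * g x + M' * norm (v - t *\<^sub>R x)" if "t \<ge> 0" for v t x
    using cINF_lower[OF bdd, of "(t, x)" v] that by (auto simp: p_def)
  have p_greatest: "b \<le> p v" if "\<And>t x. t \<ge> 0 \<Longrightarrow> b \<le> t * g x + M' * norm (v - t *\<^sub>R x)" for b v
    unfolding p_def using that by (intro cINF_greatest) auto
  have "sublinear p"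
  proof (rule sublinearI)
    fix v w
    have *: "p (v + w) \<le> (s * g x + M' * norm (v - s *\<^sub>R x)) + (t * g z + M' * norm (w - t *\<^sub>R z))"
      if st: "s \<ge> 0" "t \<ge> 0" for s t x z
    proof (cases "s + t = 0")
      case True
      then have "s = 0" "t = 0" using st by auto
      moreover have "M' * norm (v + w) \<le> M' * (norm v + norm w)"
        by (intro mult_left_mono norm_triangle_ineq) (auto simp: M'_def)
      ultimately show ?thesis
        using p_le[of 0 "v + w" 0] by (simp add: algebra_simps)
    next
      case False
      \<comment> \<open>The weighted mean with
        \<open>(s + t) *\<^sub>R c = s *\<^sub>R x + t *\<^sub>R z\<close>: convexity of
        \<open>g\<close> merges the two terms into one with parameter \<open>s + t\<close>.\<close>
      define c where "c = (s / (s + t)) *\<^sub>R x + (t / (s + t)) *\<^sub>R z"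
      have "s / (s + t) + t / (s + t) = 1"
        using False by (simp add: add_divide_distrib[symmetric])
      then have "g c \<le> s / (s + t) * g x + t / (s + t) * g z"
        using conv st unfolding c_def convex_on_def by (metis UNIV_I add_nonneg_nonneg divide_nonneg_nonneg)
      then have "(s + t) * g c \<le> (s + t) * (s / (s + t) * g x + t / (s + t) * g z)"
        using st by (intro mult_left_mono) auto
      also have "\<dots> = s * g x + t * g z"
        using False by (simp add: distrib_left)
      finally have 1: "(s + t) * g c \<le> s * g x + t * g z" .
      have "(s + t) *\<^sub>R c = s *\<^sub>R x + t *\<^sub>R z"
        using False by (simp add: c_def scaleR_add_right)
      then have "v + w - (s + t) *\<^sub>R c = (v - s *\<^sub>R x) + (w - t *\<^sub>R z)"
        by simp
      then have "norm (v + w - (s + t) *\<^sub>R c) \<le> norm (v - s *\<^sub>R x) + norm (w - t *\<^sub>R z)"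
        by (metis norm_triangle_ineq)
      then have "M' * norm (v + w - (s + t) *\<^sub>R c) \<le> M' * (norm (v - s *\<^sub>R x) + norm (w - t *\<^sub>R z))"
        by (intro mult_left_mono) (auto simp: M'_def)
      then show ?thesis
        using 1 p_le[of "s + t" "v + w" c] st by (simp add: algebra_simps)
    qed
    have "p (v + w) - (t * g z + M' * norm (w - t *\<^sub>R z)) \<le> p v" if "t \<ge> 0" for t z
      using *[OF _ that] by (intro p_greatest) (auto simp: algebra_simps)
    then have "p (v + w) - p v \<le> p w"
      by (intro p_greatest) (auto simp: algebra_simps)
    then show "p (v + w) \<le> p v + p w" by simp
  next
    show "p 0 \<le> 0" using p_le[of 0 0 0] by simp
  next
    fix r :: real and v assume r: "r > 0"
    have "p (r *\<^sub>R v) / r \<le> p v"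
    proof (rule p_greatest)
      fix t :: real and x assume "t \<ge> 0"
      then have "p (r *\<^sub>R v) \<le> r * t * g x + M' * norm (r *\<^sub>R (v - t *\<^sub>R x))"
        using p_le[of "r * t" "r *\<^sub>R v" x] r by (simp add: scaleR_diff_right)
      also have "\<dots> = r * (t * g x + M' * norm (v - t *\<^sub>R x))"
        using r by (simp only: norm_scaleR) (simp add: distrib_left)
      finally show "p (r *\<^sub>R v) / r \<le> t * g x + M' * norm (v - t *\<^sub>R x)"
        using r by (simp add: field_simps)
    qed
    then show "p (r *\<^sub>R v) \<le> r * p v"
      using r by (simp add: field_simps)
  qed
  from hahn_banach_dominated[OF this] obtain f where f: "linear f" "\<And>x. f x \<le> p x"
    by blast
  have le_norm: "f x \<le> M' * norm x" for x
    using f(2)[of x] p_le[of 0 x 0] by simp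
  have "bounded_linear f"
  proof (rule bounded_linear_intro[where K = M'])
    fix x
    show "norm (f x) \<le> norm x * M'"
      using le_norm[of x] le_norm[of "- x"] linear_neg[OF f(1), of x] by (simp add: mult.commute abs_le_iff)
  qed (use f(1) in \<open>auto simp: linear_add linear_scale\<close>)
  then have "blinfun_apply (Blinfun f) x \<le> g x" for x
    using f(2)[of x] p_le[of 1 x x] by (simp add: bounded_linear_Blinfun_apply)
  then show ?thesis by (rule that)
qed

lemma convex_on_UNIV_translate:
  assumes "convex_on UNIV g"
  shows "convex_on UNIV (\<lambda>z. g (x + z) + c)"
proof (rule convex_onI)
  fix t :: real and y z assume t: "0 < t" "t < 1"
  have "x + ((1 - t) *\<^sub>R y + t *\<^sub>R z) = (1 - t) *\<^sub>R (x + y) + t *\<^sub>R (x + z)"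
    by (simp add: algebra_simps)
  then have "g (x + ((1 - t) *\<^sub>R y + t *\<^sub>R z)) \<le> (1 - t) * g (x + y) + t * g (x + z)"
    using convex_onD[OF assms, of t "x + y" "x + z"] t by simp
  then show "g (x + ((1 - t) *\<^sub>R y + t *\<^sub>R z)) + c \<le> (1 - t) * (g (x + y) + c) + t * (g (x + z) + c)"
    by (simp add: algebra_simps)
qed simp

lemma convex_lower_cone:
  fixes g :: "'v::real_normed_vector \<Rightarrow> real"
  assumes conv: "convex_on UNIV g"
    and cone: "\<And>z. a - M * norm z \<le> g (x + z)"
  obtains y :: "'v \<Rightarrow>\<^sub>L real" where "\<And>z. a + blinfun_apply y z \<le> g (x + z)"
proof -
  have "- M * norm z \<le> g (x + z) + - a" for z
    using cone[of z] by simp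
  from convex_ge_cone_imp_linear_minorant[OF convex_on_UNIV_translate[OF conv] this]
  obtain y :: "'v \<Rightarrow>\<^sub>L real" where "\<And>z. blinfun_apply y z \<le> g (x + z) + - a"
    by blast
  then show ?thesis by (intro that[of y]) (simp add: algebra_simps)
qed

text \<open>Convexity spreads the local bound to a global cone. For \<open>norm z \<ge> r\<close>
  the segment from \<open>x\<close> to \<open>x + z\<close> contains a point at distance
  \<open>r / 2\<close> from \<open>x\<close>, where \<open>g\<close> is below \<open>g x\<close> by
  less than \<open>g x - a\<close>. Extrapolation along the segment gives a descent of slope at most
  \<open>2 * (g x - a) / r\<close>, which is the constant \<open>M\<close>.\<close>

lemma convex_locally_gt_imp_affine_minorant:
  fixes g :: "'v::real_normed_vector \<Rightarrow> real"
  assumes conv: "convex_on UNIV g" and r: "r > 0" and gt: "\<And>z. norm z < r \<Longrightarrow> a < g (x + z)"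
  obtains y :: "'v \<Rightarrow>\<^sub>L real" where "\<And>z. a + blinfun_apply y z \<le> g (x + z)"
proof -
  define M where "M = 2 * (g x - a) / r"
  have ax: "a < g x" using gt[of 0] r by simp
  then have M: "M \<ge> 0" using r by (simp add: M_def)
  have "a - M * norm z \<le> g (x + z)" for z
  proof (cases "norm z < r")
    case True
    then show ?thesis using gt[OF True] mult_nonneg_nonneg[OF M norm_ge_zero, of z] by linarith
  next
    case False
    define s where "s = r / (2 * norm z)"
    have nz: "norm z > 0" using False r by linarith
    have s: "0 < s" "s \<le> 1" using False r nz by (auto simp: s_def field_simps)
    have "norm (s *\<^sub>R z) < r" using nz r by (simp add: s_def)
    then have "a < g (x + s *\<^sub>R z)" by (rule gt)
    also have "x + s *\<^sub>R z = (1 - s) *\<^sub>R x + s *\<^sub>R (x + z)" by (simp add: algebra_simps)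
    also have "g \<dots> \<le> (1 - s) * g x + s * g (x + z)"
      using convex_onD[OF conv, of s x "x + z"] s by simp
    finally have "s * g x - (g x - a) < s * g (x + z)"
      by (simp add: algebra_simps)
    moreover have "s * (g x - (g x - a) / s) = s * g x - (g x - a)"
      using s by (simp add: field_simps)
    ultimately have "s * (g x - (g x - a) / s) < s * g (x + z)" by simp
    then have "g x - (g x - a) / s < g (x + z)" using s by simp
    moreover have "(g x - a) / s = M * norm z" using r nz by (simp add: s_def M_def)
    ultimately show ?thesis using ax by simp
  qed
  from convex_lower_cone[OF conv this] that show ?thesis by blast
qed

section \<open>Riesz representation on compact metric spaces\<close>

text \<open>The distance to the complement has these properties; \<open>U = UNIV\<close> is treated
  apart because \<open>infdist\<close> to the empty set is \<open>0\<close>.\<close>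

lemma open_cozero_function:
  fixes U :: "'b::metric_space set"
  assumes "open U"
  obtains d :: "'b \<Rightarrow> real"
  where "continuous_on UNIV d" "\<And>x. 0 \<le> d x" "\<And>x. 0 < d x \<longleftrightarrow> x \<in> U"
proof (cases "U = UNIV")
  case True
  then show ?thesis by (intro that[of "\<lambda>_. 1"]) auto
next
  case False
  have "0 < infdist x (- U) \<longleftrightarrow> x \<in> U" for x
    using in_closed_iff_infdist_zero[of "- U" x] False assms infdist_nonneg[of x "- U"]
    by (metis Compl_UNIV_eq Compl_iff closed_Compl double_complement less_eq_real_def less_irrefl)
  then show ?thesis
    by (intro that[of "\<lambda>x. infdist x (- U)"]) (auto intro!: continuous_intros simp: infdist_nonneg)
qed

lemma truncated_multiples_tendsto:
  fixes t :: real
  assumes "t > 0"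
  shows "(\<lambda>n. min 1 (real n * t)) \<longlonglongrightarrow> 1"
proof (rule tendsto_eventually)
  obtain N where N: "1 < real N * t" using reals_Archimedean3[OF assms] by blast
  have "min 1 (real n * t) = 1" if "n \<ge> N" for n
    using N mult_right_mono[of "real N" "real n" t] that assms by (intro min_absorb1) linarith
  then show "\<forall>\<^sub>F n in sequentially. min 1 (real n * t) = 1"
    by (auto simp: eventually_sequentially)
qed

text \<open>The indicator of an open set is the limit of continuous truncations
  \<open>min 1 (n * d)\<close>. Dominated convergence turns equality of integrals into equality on
  open sets, which form an intersection-stable generator.\<close>

lemma borel_prob_measure_eqI:
  fixes M N :: "'b::metric_space measure"
  assumes M: "prob_space M" "sets M = sets borel" and N: "prob_space N" "sets N = sets borel"
    and eq: "\<And>f. continuous_on UNIV f \<Longrightarrow> bounded (range f) \<Longrightarrow>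
                (\<integral>x. f x \<partial>M) = (\<integral>x. f x \<partial>N :: real)"
  shows "M = N"
proof (rule measure_eqI_generator_eq[where E = "{U. open U}" and \<Omega> = UNIV and A = "\<lambda>_. UNIV"])
  interpret M: prob_space M by fact
  interpret N: prob_space N by fact
  fix U :: "'b set" assume "U \<in> {U. open U}"
  then have U: "open U" by simp
  obtain d :: "'b \<Rightarrow> real" where d: "continuous_on UNIV d" "\<And>x. 0 \<le> d x" "\<And>x. 0 < d x \<longleftrightarrow> x \<in> U"
    using open_cozero_function[OF U] by blast
  define s where "s n x = min 1 (real n * d x)" for n x
  have cont: "continuous_on UNIV (s n)" for n
    unfolding s_def by (intro continuous_intros d(1))
  have s: "0 \<le> s n x" "s n x \<le> 1" for n x
    using d(2)[of x] by (auto simp: s_def)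
  have lim: "(\<lambda>n. s n x) \<longlonglongrightarrow> indicator U x" for x
  proof (cases "x \<in> U")
    case True
    then show ?thesis using truncated_multiples_tendsto[of "d x"] d(3)[of x] by (simp add: s_def)
  next
    case False
    then have "d x = 0" using d(2)[of x] d(3)[of x] by simp
    with False show ?thesis by (simp add: s_def)
  qed
  have conv: "(\<lambda>n. \<integral>x. s n x \<partial>L) \<longlonglongrightarrow> measure L U" if "prob_space L" "sets L = sets borel" for L
  proof -
    interpret L: prob_space L by fact
    have "(\<lambda>n. \<integral>x. s n x \<partial>L) \<longlonglongrightarrow> (\<integral>x. indicator U x \<partial>L)"
    proof (rule integral_dominated_convergence[where w = "\<lambda>_. 1"])
      show "s n \<in> borel_measurable L" for n
        using borel_measurable_continuous_onI[OF cont[of n]] that(2) by (simp cong: measurable_cong_sets)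
      show "indicator U \<in> borel_measurable L"
        using U that(2) by (intro borel_measurable_indicator) auto
    qed (use lim s in auto)
    also have "(\<integral>x. indicator U x \<partial>L) = measure L U"
      using U that(2) sets_eq_imp_space_eq[OF that(2)] by simp
    finally show ?thesis .
  qed
  have "(\<integral>x. s n x \<partial>M) = (\<integral>x. s n x \<partial>N)" for n
    using s by (intro eq cont) (auto simp: bounded_iff intro!: exI[of _ 1])
  then have "measure M U = measure N U"
    using LIMSEQ_unique[OF conv[OF M] ] conv[OF N] by simp
  then show "emeasure M U = emeasure N U"
    by (simp add: M.emeasure_eq_measure N.emeasure_eq_measure)
next
  show "sets M = sigma_sets UNIV {U. open U}" "sets N = sigma_sets UNIV {U. open U}"
    using M N by (auto simp: borel_def)
  interpret M: prob_space M by fact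
  show "emeasure M UNIV \<noteq> \<infinity>" for i :: nat
    by simp
qed (auto simp: Int_stable_def)

text \<open>\<open>I\<close> acts on plain functions, with laws for continuous arguments only, so
  that sums, multiples and truncations can be formed pointwise. The normalisation
  \<open>I_one\<close> makes the representing measure a probability.\<close>

locale positive_functional =
  fixes I :: "('b::metric_space \<Rightarrow> real) \<Rightarrow> real"
  assumes cpt: "compact (UNIV :: 'b set)"
    and I_add: "continuous_on UNIV f \<Longrightarrow> continuous_on UNIV g \<Longrightarrow> I (\<lambda>x. f x + g x) = I f + I g"
    and I_scale: "continuous_on UNIV f \<Longrightarrow> I (\<lambda>x. c * f x) = c * I f"
    and I_mono: "continuous_on UNIV f \<Longrightarrow> continuous_on UNIV g \<Longrightarrow> (\<And>x. f x \<le> g x) \<Longrightarrow> I f \<le> I g"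
    and I_one: "I (\<lambda>_. 1) = 1"
begin

lemma I_const: "I (\<lambda>_. c) = c"
  using I_scale[of "\<lambda>_. 1" c] I_one by simp

lemma I_sum:
  assumes "\<And>i. i \<in> A \<Longrightarrow> continuous_on UNIV (f i)"
  shows "I (\<lambda>x. \<Sum>i\<in>A. f i x) = (\<Sum>i\<in>A. I (f i))"
  using assms
proof (induction A rule: infinite_finite_induct)
  case (insert a A)
  then have "I (\<lambda>x. f a x + (\<Sum>i\<in>A. f i x)) = I (f a) + I (\<lambda>x. \<Sum>i\<in>A. f i x)"
    by (intro I_add continuous_on_sum) auto
  then show ?case using insert by simp
qed (simp_all add: I_const)

text \<open>Test functions have to vanish outside \<open>U\<close>, but need not have compact
  support inside \<open>U\<close>. The gap to the boundary is created where it is needed, by giving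
  away some \<open>e > 0\<close>.\<close>

definition below :: "'b set \<Rightarrow> ('b \<Rightarrow> real) set" where
  "below U = {f. continuous_on UNIV f \<and> (\<forall>x. 0 \<le> f x \<and> f x \<le> indicator U x)}"

definition inner_content :: "'b set \<Rightarrow> real" where
  "inner_content U = (SUP f\<in>below U. I f)"

definition outer_content :: "'b set \<Rightarrow> real" where
  "outer_content A = (INF U\<in>{U. open U \<and> A \<subseteq> U}. inner_content U)"

lemma zero_below: "(\<lambda>_. 0) \<in> below U"
  by (auto simp: below_def)

lemma belowD:
  assumes "f \<in> below U"
  shows "continuous_on UNIV f" "0 \<le> f x" "f x \<le> 1" "x \<notin> U \<Longrightarrow> f x = 0"
proof -
  show "continuous_on UNIV f" using assms by (simp add: below_def)
  have "0 \<le> f x \<and> f x \<le> indicator U x" using assms by (simp add: below_def)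
  then show "0 \<le> f x" "f x \<le> 1" "x \<notin> U \<Longrightarrow> f x = 0"
    by (cases "x \<in> U"; simp)+
qed

lemma belowI:
  assumes "continuous_on UNIV f" "\<And>x. 0 \<le> f x" "\<And>x. f x \<le> 1" "\<And>x. x \<notin> U \<Longrightarrow> f x = 0"
  shows "f \<in> below U"
  using assms by (auto simp: below_def indicator_def)

lemma I_le_1: "f \<in> below U \<Longrightarrow> I f \<le> 1"
  using I_mono[of f "\<lambda>_. 1"] I_one belowD by simp

lemma I_le_inner_content: "f \<in> below U \<Longrightarrow> I f \<le> inner_content U"
  unfolding inner_content_def using I_le_1 by (intro cSUP_upper bdd_aboveI2) auto

lemma inner_content_least: "(\<And>f. f \<in> below U \<Longrightarrow> I f \<le> b) \<Longrightarrow> inner_content U \<le> b"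
  unfolding inner_content_def using zero_below by (intro cSUP_least) auto

lemma inner_content_nonneg: "0 \<le> inner_content U"
  using I_le_inner_content[OF zero_below] I_const[of 0] by simp

lemma inner_content_mono: "U \<subseteq> V \<Longrightarrow> inner_content U \<le> inner_content V"
  by (intro inner_content_least I_le_inner_content belowI) (auto dest: belowD)

lemma outer_le: "open U \<Longrightarrow> A \<subseteq> U \<Longrightarrow> outer_content A \<le> inner_content U"
  unfolding outer_content_def using inner_content_nonneg by (intro cINF_lower bdd_belowI2) auto

lemma outer_greatest: "(\<And>U. open U \<Longrightarrow> A \<subseteq> U \<Longrightarrow> b \<le> inner_content U) \<Longrightarrow> b \<le> outer_content A"
  unfolding outer_content_def by (intro cINF_greatest) auto

lemma outer_nonneg: "0 \<le> outer_content A"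
  by (intro outer_greatest inner_content_nonneg)

lemma outer_mono: "A \<subseteq> B \<Longrightarrow> outer_content A \<le> outer_content B"
  by (intro outer_greatest outer_le) auto

lemma outer_open: "open U \<Longrightarrow> outer_content U = inner_content U"
  by (intro antisym outer_le outer_greatest inner_content_mono) auto

lemma outer_empty: "outer_content {} = 0"
proof -
  have "inner_content {} \<le> 0"
  proof (rule inner_content_least)
    fix f :: "'b \<Rightarrow> real" assume "f \<in> below {}"
    then have "f = (\<lambda>_. 0)" by (auto dest: belowD)
    then show "I f \<le> 0" using I_const[of 0] by simp
  qed
  then show ?thesis using outer_open[of "{}"] inner_content_nonneg[of "{}"] by simp
qed

lemma outer_UNIV: "outer_content UNIV = 1"
proof -
  have "(\<lambda>_. 1) \<in> below UNIV" by (auto simp: below_def)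
  then have "1 \<le> inner_content UNIV" using I_le_inner_content[of "\<lambda>_. 1" UNIV] I_one by simp
  moreover have "inner_content UNIV \<le> 1" by (intro inner_content_least I_le_1)
  ultimately show ?thesis using outer_open[of UNIV] by simp
qed

text \<open>By compactness a test function for the union is, up to \<open>e\<close>, dominated by finitely many test
  functions for the members.\<close>

lemma inner_content_Union_le:
  assumes U: "\<And>i::nat. open (U i)" and f: "f \<in> below (\<Union>i. U i)" and e: "e > 0"
  shows "\<exists>n. I f \<le> e + (\<Sum>i<n. inner_content (U i))"
proof -
  have "\<exists>d :: 'b \<Rightarrow> real. continuous_on UNIV d \<and> (\<forall>x. 0 \<le> d x) \<and> (\<forall>x. 0 < d x \<longleftrightarrow> x \<in> U i)" for i
    using open_cozero_function[OF U[of i]] by metis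
  then obtain d :: "nat \<Rightarrow> 'b \<Rightarrow> real" where d: "\<And>i. continuous_on UNIV (d i)" "\<And>i x. 0 \<le> d i x"
    "\<And>i x. 0 < d i x \<longleftrightarrow> x \<in> U i" by metis
  define g where "g n i x = min 1 (real n * d i x)" for n i x
  have cont: "continuous_on UNIV (g n i)" for n i
    unfolding g_def by (intro continuous_intros d(1))
  have "g n i x \<le> indicator (U i) x" for n i x
    using d(2)[of i x] d(3)[of i x] by (auto simp: g_def indicator_def)
  then have g: "g n i \<in> below (U i)" for n i
    using cont d(2) by (auto simp: below_def g_def)
  have contf: "continuous_on UNIV f" and f1: "0 \<le> f x" "f x \<le> indicator (\<Union>i. U i) x" for x
    using f by (auto simp: below_def)
  \<comment> \<open>Both the number of members used and the multiple in the truncations grow with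
    \<open>n\<close>, so these open sets increase and a finite subcover reduces to a single
    one.\<close>
  define B where "B n = {x. f x < e + (\<Sum>i<n. g n i x)}" for n
  have "\<exists>D\<subseteq>range B. finite D \<and> UNIV \<subseteq> \<Union>D"
  proof (rule compactE[OF cpt])
    show "UNIV \<subseteq> \<Union>(range B)"
    proof
      fix x
      show "x \<in> \<Union>(range B)"
      proof (cases "\<exists>i. x \<in> U i")
        case True
        then obtain i where "x \<in> U i" by blast
        then have "(\<lambda>n. g n i x) \<longlonglongrightarrow> 1"
          unfolding g_def using d(3)[of i x] by (intro truncated_multiples_tendsto) simp
        then have "\<forall>\<^sub>F n in sequentially. 1 - e < g n i x"
          using e by (intro order_tendstoD) auto
        then have "\<forall>\<^sub>F n in sequentially. 1 - e < g n i x \<and> i < n"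
          using eventually_gt_at_top[of i] by eventually_elim simp
        then obtain n where n: "1 - e < g n i x" "i < n"
          using eventually_happens'[OF sequentially_bot] by blast
        have "g n i x \<le> (\<Sum>i<n. g n i x)"
          using n d(2) by (intro member_le_sum) (auto simp: g_def)
        moreover have "f x \<le> 1" using belowD(3)[OF f] .
        ultimately show ?thesis using n by (auto simp: B_def intro!: exI[of _ n])
      next
        case False
        then have "f x \<le> 0" using f1(2)[of x] by simp
        then show ?thesis using e by (auto simp: B_def intro!: exI[of _ 0])
      qed
    qed
    show "open C" if "C \<in> range B" for C
      using that cont contf unfolding B_def by (auto intro!: open_Collect_less continuous_intros)
  qed metis
  then obtain D where D: "D \<subseteq> range B" "finite D" "UNIV \<subseteq> \<Union>D" by blast
  obtain J where J: "finite J" "D = B ` J" using finite_subset_image[OF D(2,1)] by metis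
  have B_mono: "B m \<subseteq> B n" if "m \<le> n" for m n
  proof
    fix x assume "x \<in> B m"
    moreover have "(\<Sum>i<m. g m i x) \<le> (\<Sum>i<n. g n i x)"
    proof -
      have "g m i x \<le> g n i x" for i
        using that d(2)[of i x] mult_right_mono[of "real m" "real n" "d i x"] by (auto simp: g_def)
      then have "(\<Sum>i<m. g m i x) \<le> (\<Sum>i<m. g n i x)" by (intro sum_mono)
      also have "\<dots> \<le> (\<Sum>i<n. g n i x)"
        using that d(2) by (intro sum_mono2) (auto simp: g_def)
      finally show ?thesis .
    qed
    ultimately show "x \<in> B n" by (auto simp: B_def)
  qed
  have "B j \<subseteq> B (Max J)" if "j \<in> J" for j
    using that J by (intro B_mono) auto
  then have *: "x \<in> B (Max J)" for x
    using D J by blast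
  define n where "n = Max J"
  have "I f \<le> I (\<lambda>x. e + (\<Sum>i<n. g n i x))"
    using * cont by (intro I_mono contf continuous_intros) (auto simp: B_def n_def intro: less_imp_le)
  also have "\<dots> = e + (\<Sum>i<n. I (g n i))"
    using cont by (subst I_add) (auto intro!: continuous_intros simp: I_const I_sum)
  also have "\<dots> \<le> e + (\<Sum>i<n. inner_content (U i))"
    using g by (intro add_left_mono sum_mono I_le_inner_content)
  finally show ?thesis ..
qed

text \<open>Open supersets \<open>U i\<close> are chosen with errors \<open>e / 4 * (1/2)^i\<close>,
  in total at most \<open>e / 2\<close>; the other \<open>e / 2\<close> pays for the passage from a
  test function for the union to finitely many members. The series may diverge, hence
  \<open>ennreal\<close>.\<close>

lemma outer_Union_le:
  fixes A :: "nat \<Rightarrow> 'b set"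
  shows "ennreal (outer_content (\<Union>i. A i)) \<le> (\<Sum>i. ennreal (outer_content (A i)))"
proof (rule ennreal_le_epsilon)
  fix e :: real assume e: "e > 0"
  have "\<exists>U. open U \<and> A i \<subseteq> U \<and> inner_content U \<le> outer_content (A i) + e / 4 * (1/2)^i" for i
  proof (rule ccontr)
    assume "\<not> ?thesis"
    then have "outer_content (A i) + e / 4 * (1/2)^i \<le> outer_content (A i)"
      by (intro outer_greatest) (auto simp: not_le intro: less_imp_le)
    moreover have "0 < e / 4 * (1/2)^i" using e by simp
    ultimately show False by linarith
  qed
  then obtain U where U: "\<And>i. open (U i)" "\<And>i. A i \<subseteq> U i"
    "\<And>i. inner_content (U i) \<le> outer_content (A i) + e / 4 * (1/2)^i" by metis
  have "ennreal (I f) \<le> (\<Sum>i. ennreal (outer_content (A i))) + ennreal e" if f: "f \<in> below (\<Union>i. U i)" for f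
  proof -
    obtain n where "I f \<le> e / 2 + (\<Sum>i<n. inner_content (U i))"
      using inner_content_Union_le[OF U(1) f, of "e / 2"] e by auto
    also have "\<dots> \<le> e / 2 + (\<Sum>i<n. outer_content (A i) + e / 4 * (1/2)^i)"
      by (intro add_left_mono sum_mono U)
    also have "\<dots> = e / 2 + e / 4 * (\<Sum>i<n. (1/2)^i) + (\<Sum>i<n. outer_content (A i))"
      by (simp add: sum.distrib sum_distrib_left)
    also have "(\<Sum>i<n. (1/2)^i) \<le> (2::real)"
      by (subst geometric_sum) auto
    finally have "I f \<le> e + (\<Sum>i<n. outer_content (A i))"
      using e by (simp add: field_simps)
    then have "ennreal (I f) \<le> ennreal (e + (\<Sum>i<n. outer_content (A i)))"
      by (rule ennreal_leI)
    also have "\<dots> = ennreal e + (\<Sum>i<n. ennreal (outer_content (A i)))"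
      using e outer_nonneg by (simp add: ennreal_plus sum_nonneg)
    also have "\<dots> \<le> ennreal e + (\<Sum>i. ennreal (outer_content (A i)))"
      by (intro add_left_mono sum_le_suminf) auto
    finally show ?thesis by (simp add: add.commute)
  qed
  note I_le = this
  have "outer_content (\<Union>i. A i) \<le> inner_content (\<Union>i. U i)"
    using U by (intro outer_le) auto
  then have "ennreal (outer_content (\<Union>i. A i)) \<le> ennreal (inner_content (\<Union>i. U i))"
    by (rule ennreal_leI)
  also have "\<dots> \<le> (\<Sum>i. ennreal (outer_content (A i))) + ennreal e"
  proof (cases "(\<Sum>i. ennreal (outer_content (A i))) + ennreal e")
    case (real r)
    then have "I f \<le> r" if "f \<in> below (\<Union>i. U i)" for f
      using I_le[OF that] by simp
    then have "inner_content (\<Union>i. U i) \<le> r" by (rule inner_content_least)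
    then show ?thesis unfolding real by (rule ennreal_leI)
  qed simp
  finally show "ennreal (outer_content (\<Union>i. A i)) \<le> (\<Sum>i. ennreal (outer_content (A i))) + ennreal e" .
qed

lemma outer_measure_space_outer: "outer_measure_space (Pow UNIV) (\<lambda>A. ennreal (outer_content A))"
  by (auto simp: outer_measure_space_def positive_def increasing_def countably_subadditive_def
      outer_empty intro!: ennreal_leI outer_mono outer_Union_le)

lemma outer_Un_le: "outer_content (A \<union> B) \<le> outer_content A + outer_content B"
proof -
  have "ennreal (outer_content (A \<union> B)) \<le> (\<Sum>i. ennreal (outer_content (binaryset A B i)))"
    using outer_Union_le[of "binaryset A B"] by (simp add: UN_binaryset_eq)
  also have "\<dots> = ennreal (outer_content A) + ennreal (outer_content B)"
    by (rule suminf_binaryset_eq) (simp add: outer_empty)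
  finally show ?thesis
    using outer_nonneg by (simp add: ennreal_plus[symmetric] del: ennreal_plus)
qed

text \<open>A test function for \<open>V \<inter> U\<close>, lowered by \<open>e\<close>, has support at positive distance from \<open>V - U\<close>, so
  it can be added to a test function for a neighbourhood of \<open>V - U\<close>.\<close>

lemma outer_split_open:
  assumes U: "open U"
  shows "outer_content (A \<inter> U) + outer_content (A - U) \<le> outer_content A"
proof (rule outer_greatest)
  fix V assume V: "open V" "A \<subseteq> V"
  have "I f \<le> inner_content V - outer_content (A - U)" if f: "f \<in> below (V \<inter> U)" for f
  proof (rule field_le_epsilon)
    fix e :: real assume e: "e > 0"
    have contf: "continuous_on UNIV f" and f1: "0 \<le> f x" "f x \<le> indicator (V \<inter> U) x" for x
      using f by (auto simp: below_def)
    define W where "W = V \<inter> {x. f x < e}"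
    have "open W"
      unfolding W_def using V contf by (intro open_Int open_Collect_less) auto
    moreover have "A - U \<subseteq> W"
    proof
      fix x assume x: "x \<in> A - U"
      then have "f x \<le> 0" using f1(2)[of x] by simp
      then show "x \<in> W" using x V e by (auto simp: W_def)
    qed
    ultimately have "outer_content (A - U) \<le> inner_content W" by (rule outer_le)
    also have "inner_content W \<le> inner_content V + e - I f"
    proof (rule inner_content_least)
      fix g assume g: "g \<in> below W"
      then have contg: "continuous_on UNIV g" and g1: "0 \<le> g x" "g x \<le> indicator W x" for x
        by (auto simp: below_def)
      define f' where "f' x = max 0 (f x - e)" for x
      have contf': "continuous_on UNIV f'" unfolding f'_def by (intro continuous_intros contf)
      have "f' x + g x \<le> indicator V x" for x
        using f1[of x] g1[of x] e
        by (cases "x \<in> W"; cases "x \<in> V \<inter> U") (auto simp: f'_def W_def indicator_def split: if_splits)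
      then have "(\<lambda>x. f' x + g x) \<in> below V"
        using contf' contg g1 by (auto simp: below_def f'_def intro!: continuous_intros add_nonneg_nonneg)
      then have "I f' + I g \<le> inner_content V"
        using I_le_inner_content I_add[OF contf' contg] by metis
      moreover have "I f \<le> I (\<lambda>x. f' x + e)"
        using contf contf' by (intro I_mono) (auto simp: f'_def intro!: continuous_intros)
      then have "I f \<le> I f' + e"
        using I_add[OF contf', of "\<lambda>_. e"] I_const by simp
      ultimately show "I g \<le> inner_content V + e - I f" by simp
    qed
    finally show "I f \<le> inner_content V - outer_content (A - U) + e" by simp
  qed
  then have "inner_content (V \<inter> U) \<le> inner_content V - outer_content (A - U)" by (rule inner_content_least)
  moreover have "outer_content (A \<inter> U) \<le> inner_content (V \<inter> U)" using U V by (intro outer_le) auto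
  ultimately show "outer_content (A \<inter> U) + outer_content (A - U) \<le> inner_content V" by simp
qed

definition riesz_measure :: "'b measure" where
  "riesz_measure = measure_of UNIV (sets borel) (\<lambda>A. ennreal (outer_content A))"

text \<open>Caratheodory's construction: the sets that split every set additively form a
  sigma-algebra on which the outer content is a measure. Open sets belong to it by
  \<open>outer_split_open\<close> and subadditivity, hence so do all Borel sets.\<close>

lemma sets_riesz_measure: "sets riesz_measure = sets borel"
  and space_riesz_measure: "space riesz_measure = UNIV"
  and emeasure_riesz_measure: "A \<in> sets borel \<Longrightarrow> emeasure riesz_measure A = ennreal (outer_content A)"
proof -
  let ?f = "\<lambda>A. ennreal (outer_content A)"
  let ?L = "lambda_system UNIV (Pow UNIV) ?f"
  have L: "measure_space UNIV ?L ?f"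
    by (rule sigma_algebra.caratheodory_lemma[OF sigma_algebra_Pow outer_measure_space_outer])
  then have sL: "sigma_algebra UNIV ?L" by (simp add: measure_space_def)
  have "U \<in> ?L" if "open U" for U
  proof -
    have "outer_content (U \<inter> A) + outer_content ((UNIV - U) \<inter> A) = outer_content A" for A
    proof (rule antisym)
      have "outer_content A \<le> outer_content (U \<inter> A) + outer_content ((UNIV - U) \<inter> A)"
        using outer_Un_le[of "U \<inter> A" "(UNIV - U) \<inter> A"] by (simp add: Int_Un_distrib2[symmetric])
      then show "outer_content A \<le> outer_content (U \<inter> A) + outer_content ((UNIV - U) \<inter> A)" .
      have "(UNIV - U) \<inter> A = A - U" by blast
      then show "outer_content (U \<inter> A) + outer_content ((UNIV - U) \<inter> A) \<le> outer_content A"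
        using outer_split_open[OF that, of A] by (simp add: Int_commute)
    qed
    then have "?f (U \<inter> A) + ?f ((UNIV - U) \<inter> A) = ?f A" for A
      using outer_nonneg by (simp add: ennreal_plus[symmetric] del: ennreal_plus)
    then show ?thesis by (simp add: lambda_system_def)
  qed
  then have "sigma_sets UNIV {U. open U} \<subseteq> ?L"
    by (intro sigma_algebra.sigma_sets_subset[OF sL]) auto
  then have sub: "sets borel \<subseteq> ?L" by (simp add: borel_def)
  have "sigma_algebra UNIV (sets (borel :: 'b measure))"
    using sets.sigma_algebra_axioms[of borel] by simp
  then have ms: "measure_space UNIV (sets borel) ?f"
    by (rule measure_down[OF L _ sub])
  show "sets riesz_measure = sets borel"
    unfolding riesz_measure_def by (rule sets.sets_measure_of_eq[of borel, unfolded space_borel])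
  show "space riesz_measure = UNIV"
    unfolding riesz_measure_def by (rule space_measure_of) simp
  show "emeasure riesz_measure A = ?f A" if "A \<in> sets borel"
    unfolding riesz_measure_def using ms that
    by (intro emeasure_measure_of_sigma) (auto simp: measure_space_def)
qed

lemma prob_space_riesz_measure: "prob_space riesz_measure"
  by (rule prob_spaceI) (simp add: space_riesz_measure emeasure_riesz_measure outer_UNIV)

lemma measure_riesz_open: "open U \<Longrightarrow> measure riesz_measure U = inner_content U"
  by (simp add: measure_def emeasure_riesz_measure outer_open inner_content_nonneg)

lemma integrable_riesz:
  assumes "continuous_on UNIV f"
  shows "integrable riesz_measure (f :: 'b \<Rightarrow> real)"
proof -
  interpret prob_space riesz_measure by (rule prob_space_riesz_measure)
  have "bounded (range f)"
    using compact_continuous_image[OF assms cpt] by (rule compact_imp_bounded)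
  then obtain B where "\<And>x. norm (f x) \<le> B" by (auto simp: bounded_iff)
  moreover have "f \<in> borel_measurable riesz_measure"
    using borel_measurable_continuous_onI[OF assms] by (simp add: sets_riesz_measure cong: measurable_cong_sets)
  ultimately show ?thesis by (intro integrable_const_bound[of _ B]) auto
qed

text \<open>Layer \<open>k\<close> is the part of \<open>y\<close> between the heights
  \<open>k\<close> and \<open>k + 1\<close>.\<close>

lemma sum_layers:
  assumes "0 \<le> (y::real)"
  shows "(\<Sum>k<n. min 1 (max 0 (y - real k))) = min y (real n)"
proof (induction n)
  case (Suc n)
  then show ?case using assms by (simp add: min_def max_def)
qed (use assms in simp)

text \<open>A layer-cake argument at scale \<open>1 / N\<close>. The layer \<open>F k\<close> of
  \<open>N * f\<close> is a test function for the open set \<open>U k\<close>, so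
  \<open>I (F k)\<close> is at most the measure of \<open>U k\<close>, and the indicators of these
  sets add up to at most \<open>N * f + 1\<close>. Division by \<open>N\<close> leaves the error
  \<open>1 / N\<close>.\<close>

lemma I_le_integral:
  assumes cont: "continuous_on UNIV f" and f: "\<And>x. 0 \<le> f x" "\<And>x. f x \<le> 1"
  shows "I f \<le> (\<integral>x. f x \<partial>riesz_measure)"
proof (rule field_le_epsilon)
  interpret prob_space riesz_measure by (rule prob_space_riesz_measure)
  fix e :: real assume e: "e > 0"
  obtain n where n: "inverse (real (Suc n)) < e" using reals_Archimedean[OF e] by blast
  define N where "N = Suc n"
  have N: "real N > 0" "1 / real N < e" using n by (auto simp: N_def inverse_eq_divide)
  define F where "F k x = min 1 (max 0 (real N * f x - real k))" for k x
  define U where "U k = {x. real k < real N * f x}" for k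
  have U: "open (U k)" for k
    unfolding U_def by (intro open_Collect_less continuous_intros cont)
  have contF: "continuous_on UNIV (F k)" for k
    unfolding F_def by (intro continuous_intros cont)
  have "F k \<in> below (U k)" for k
    using contF by (intro belowI) (auto simp: F_def U_def)
  then have IF: "I (F k) \<le> measure riesz_measure (U k)" for k
    using I_le_inner_content measure_riesz_open[OF U] by simp
  have "real N * f x = (\<Sum>k<N. F k x)" for x
    using sum_layers[of "real N * f x" N] f[of x] by (simp add: F_def mult_left_le)
  then have "real N * I f = (\<Sum>k<N. I (F k))"
    using I_scale[OF cont, of "real N"] I_sum[of "{..<N}" F, OF contF] by simp
  also have "\<dots> \<le> (\<Sum>k<N. measure riesz_measure (U k))"
    by (intro sum_mono IF)
  also have "\<dots> = (\<integral>x. (\<Sum>k<N. indicator (U k) x) \<partial>riesz_measure)"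
    using U by (subst Bochner_Integration.integral_sum)
      (auto simp: sets_riesz_measure space_riesz_measure emeasure_eq_measure)
  also have "\<dots> \<le> (\<integral>x. real N * f x + 1 \<partial>riesz_measure)"
  proof (rule integral_mono)
    show "integrable riesz_measure (\<lambda>x. \<Sum>k<N. indicator (U k) x :: real)"
      using U by (intro Bochner_Integration.integrable_sum integrable_real_indicator)
        (auto simp: sets_riesz_measure less_top[symmetric])
    show "integrable riesz_measure (\<lambda>x. real N * f x + 1)"
      by (intro integrable_riesz continuous_intros cont)
    fix x
    \<comment> \<open>On \<open>U k\<close> the value \<open>N * f x + 1\<close> exceeds
      \<open>k + 1\<close>, so its layer \<open>k\<close> is full; this is the source of the extra
      \<open>1\<close>.\<close>
    have "(indicator (U k) x :: real) \<le> min 1 (max 0 (real N * f x + 1 - real k))" for k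
      by (auto simp: U_def indicator_def)
    then have "(\<Sum>k<N. indicator (U k) x) \<le> (\<Sum>k<N. min 1 (max 0 (real N * f x + 1 - real k)))"
      by (intro sum_mono)
    also have "\<dots> \<le> real N * f x + 1"
      using f[of x] by (subst sum_layers) (auto intro!: add_nonneg_nonneg)
    finally show "(\<Sum>k<N. indicator (U k) x) \<le> real N * f x + 1" .
  qed
  also have "\<dots> = real N * (\<integral>x. f x \<partial>riesz_measure) + 1"
    using integrable_riesz[OF cont] by (simp add: prob_space)
  finally have "I f \<le> (\<integral>x. f x \<partial>riesz_measure) + 1 / real N"
    using N by (simp add: field_simps)
  then show "I f \<le> (\<integral>x. f x \<partial>riesz_measure) + e" using N by simp
qed

text \<open>The one-sided bound for \<open>g\<close> and for \<open>1 - g\<close> gives equality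
  when \<open>g\<close> has values between \<open>0\<close> and \<open>1\<close>; an affine change
  of scale reduces any continuous function to that case.\<close>

theorem riesz_representation:
  assumes cont: "continuous_on UNIV f"
  shows "I f = (\<integral>x. f x \<partial>riesz_measure)"
proof -
  interpret prob_space riesz_measure by (rule prob_space_riesz_measure)
  have unit: "I g = (\<integral>x. g x \<partial>riesz_measure)"
    if g: "continuous_on UNIV g" "\<And>x. 0 \<le> g x" "\<And>x. g x \<le> 1" for g
  proof (rule antisym)
    show "I g \<le> (\<integral>x. g x \<partial>riesz_measure)" by (rule I_le_integral[OF g])
    have "I (\<lambda>x. 1 + (-1) * g x) \<le> (\<integral>x. 1 + (-1) * g x \<partial>riesz_measure)"
      using g by (intro I_le_integral) (auto intro!: continuous_intros)
    moreover have "I (\<lambda>x. 1 + (-1) * g x) = 1 - I g"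
      using I_add[of "\<lambda>_. 1" "\<lambda>x. (-1) * g x"] I_scale[OF g(1), of "-1"] g I_one
      by (simp add: continuous_on_minus)
    ultimately show "(\<integral>x. g x \<partial>riesz_measure) \<le> I g"
      using integrable_riesz[OF g(1)] by (simp add: prob_space)
  qed
  have "bounded (range f)"
    using compact_continuous_image[OF cont cpt] by (rule compact_imp_bounded)
  then obtain B where B: "B > 0" "\<And>x. \<bar>f x\<bar> \<le> B" by (auto simp: bounded_pos)
  define g where "g x = (f x + B) / (2 * B)" for x
  have g01: "0 \<le> g x" "g x \<le> 1" for x
    using B(1) B(2)[of x] by (auto simp: g_def field_simps abs_le_iff)
  have gc: "continuous_on UNIV g"
    unfolding g_def using B by (intro continuous_intros cont) auto
  have f: "f = (\<lambda>x. (2 * B) * g x + - B)"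
    using B by (simp add: g_def)
  have "I f = 2 * B * I g - B"
    unfolding f using I_add[of "\<lambda>x. (2 * B) * g x" "\<lambda>_. - B"] I_scale[OF gc, of "2 * B"] gc I_const
    by (simp add: continuous_on_mult_left)
  also have "\<dots> = (\<integral>x. f x \<partial>riesz_measure)"
    unfolding f using integrable_riesz[OF gc] unit[OF gc g01] by (simp add: prob_space)
  finally show ?thesis .
qed

end

section \<open>Weak-star compactness in the dual of a space of continuous functions\<close>

lemma tendsto_fun_iff:
  fixes f :: "'c \<Rightarrow> 'i \<Rightarrow> 'b::topological_space"
  shows "(f \<longlongrightarrow> l) F \<longleftrightarrow> (\<forall>i. ((\<lambda>x. f x i) \<longlongrightarrow> l i) F)"
proof -
  have "(f \<longlongrightarrow> l) F \<longleftrightarrow> limitin (product_topology (\<lambda>_. euclidean) UNIV) f l F"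
    by (simp add: euclidean_product_topology)
  also have "\<dots> \<longleftrightarrow> (\<forall>i. ((\<lambda>x. f x i) \<longlongrightarrow> l i) F)"
    by (simp add: limitin_componentwise)
  finally show ?thesis .
qed

lemma compact_Pi:
  fixes S :: "'i \<Rightarrow> 'b::topological_space set"
  assumes "\<And>i. compact (S i)"
  shows "compact (Pi UNIV S)"
proof -
  have "compactin (product_topology (\<lambda>_. euclidean) UNIV) (PiE UNIV S)"
    using assms by (subst compactin_PiE) (auto simp: compactin_euclidean_iff)
  then show ?thesis
    by (simp add: euclidean_product_topology compactin_euclidean_iff PiE_UNIV_domain)
qed

lemma compact_UNIV_fun:
  assumes "compact (UNIV :: 'b::topological_space set)"
  shows "compact (UNIV :: ('i \<Rightarrow> 'b) set)"
  using compact_Pi[of "\<lambda>_. UNIV", OF assms] by simp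

lemma apply_Bcontfun:
  fixes f :: "'b::topological_space \<Rightarrow> 'c::metric_space"
  assumes "compact (UNIV :: 'b set)" "continuous_on UNIV f"
  shows "apply_bcontfun (Bcontfun f) = f"
  using assms compact_continuous_image[OF assms(2,1)]
  by (intro Bcontfun_inverse) (auto simp: bcontfun_def compact_imp_bounded)

lemma norm_bcontfun_le:
  fixes \<phi> :: "'b::topological_space \<Rightarrow>\<^sub>C real"
  assumes "\<And>x. \<bar>\<phi> x\<bar> \<le> b"
  shows "norm \<phi> \<le> b"
  using assms by (intro norm_bound) auto

lemma abs_bcontfun_le_norm:
  fixes \<phi> :: "'b::topological_space \<Rightarrow>\<^sub>C real"
  shows "\<bar>\<phi> x\<bar> \<le> norm \<phi>"
  using norm_bounded[of \<phi> x] by simp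

lemma apply_bcontfun_sum:
  fixes f :: "'i \<Rightarrow> 'b::topological_space \<Rightarrow>\<^sub>C real"
  shows "apply_bcontfun (\<Sum>i\<in>A. f i) x = (\<Sum>i\<in>A. apply_bcontfun (f i) x)"
  by (induction A rule: infinite_finite_induct) auto

text \<open>The dense sequence consists of partitions of unity subordinate to finer and finer nets.\<close>

lemma separable_bcontfun:
  assumes compact: "compact (UNIV :: 'b::metric_space set)"
  obtains p :: "nat \<Rightarrow> 'b::metric_space \<Rightarrow>\<^sub>C real"
  where "\<And>\<phi> e. 0 < e \<Longrightarrow> \<exists>\<psi>\<in>span (range p). norm (\<phi> - \<psi>) \<le> e"
proof -
  have "\<exists>F :: 'b set. finite F \<and> (\<forall>y. \<exists>x\<in>F. dist y x < 1 / real (Suc n))" for n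
  proof -
    have "1 / real (Suc n) > 0" by simp
    then obtain F :: "'b set" where "finite F" "UNIV \<subseteq> (\<Union>x\<in>F. ball x (1 / real (Suc n)))"
      using compact unfolding compact_eq_totally_bounded by meson
    then show ?thesis by (intro exI[of _ F]) (auto simp: subset_eq dist_commute)
  qed
  then obtain F :: "nat \<Rightarrow> 'b set" where F: "\<And>n. finite (F n)"
    and net: "\<And>n y. \<exists>x\<in>F n. dist y x < 1 / real (Suc n)" by metis
  define b where "b n x y = max 0 (1 / real (Suc n) - dist y x)" for n and x y :: 'b
  define s where "s n y = (\<Sum>x\<in>F n. b n x y)" for n y
  define q where "q n x y = b n x y / s n y" for n x y
  have s_pos: "0 < s n y" for n y
  proof -
    obtain x where "x \<in> F n" "dist y x < 1 / real (Suc n)" using net by blast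
    then show ?thesis
      unfolding s_def by (intro sum_pos2[OF F, of x]) (auto simp: b_def)
  qed
  have "continuous_on UNIV (q n x)" for n x
    unfolding q_def s_def b_def using s_pos[unfolded s_def b_def]
    by (intro continuous_intros) (metis less_irrefl)
  then have app: "apply_bcontfun (Bcontfun (q n x)) = q n x" for n x
    by (intro apply_Bcontfun compact)
  define J where "J = (SIGMA n:UNIV. F n)"
  define p where "p i = (case from_nat_into J i of (n, x) \<Rightarrow> Bcontfun (q n x))" for i
  have J: "countable J" "J \<noteq> {}"
    using F net[where n = 0] by (auto simp: J_def countable_finite)
  have p: "Bcontfun (q n x) \<in> range p" if "x \<in> F n" for n x
  proof -
    have "(n, x) \<in> range (from_nat_into J)"
      using that by (subst range_from_nat_into[OF J(2,1)]) (simp add: J_def)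
    then obtain i where "(n, x) = from_nat_into J i" by blast
    then have "p i = Bcontfun (q n x)" by (metis p_def case_prod_conv)
    then show ?thesis by (metis rangeI)
  qed
  show thesis
  proof (rule that[of p])
    fix \<phi> :: "'b \<Rightarrow>\<^sub>C real" and e :: real assume e: "e > 0"
    have "uniformly_continuous_on UNIV (apply_bcontfun \<phi>)"
      using compact by (intro compact_uniformly_continuous) auto
    then obtain d where d: "d > 0" "\<And>x y. dist x y < d \<Longrightarrow> \<bar>\<phi> x - \<phi> y\<bar> < e"
      using e unfolding uniformly_continuous_on_def dist_real_def by blast
    obtain n where n: "inverse (real (Suc n)) < d" using reals_Archimedean[OF d(1)] by blast
    define \<psi> where "\<psi> = (\<Sum>x\<in>F n. \<phi> x *\<^sub>R Bcontfun (q n x))"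
    have "\<psi> \<in> span (range p)"
      unfolding \<psi>_def by (intro span_sum span_scale span_base p)
    moreover have "norm (\<phi> - \<psi>) \<le> e"
    proof (rule norm_bcontfun_le)
      fix y
      have sum1: "(\<Sum>x\<in>F n. q n x y) = 1"
        using s_pos[of n y] by (simp add: q_def sum_divide_distrib[symmetric] s_def[symmetric])
      have q0: "q n x y \<ge> 0" for x
        using s_pos[of n y] by (simp add: q_def b_def)
      \<comment> \<open>As the weights \<open>q n x y\<close> sum to \<open>1\<close>, the error at
        \<open>y\<close> is a weighted mean of the differences \<open>\<phi> y - \<phi> x\<close>,
        and only points \<open>x\<close> closer to \<open>y\<close> than \<open>d\<close> carry
        weight.\<close>
      have "(\<phi> - \<psi>) y = (\<Sum>x\<in>F n. q n x y) * \<phi> y - (\<Sum>x\<in>F n. q n x y * \<phi> x)"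
        using sum1 by (simp add: \<psi>_def apply_bcontfun_sum app mult.commute)
      also have "\<dots> = (\<Sum>x\<in>F n. q n x y * (\<phi> y - \<phi> x))"
        by (simp add: sum_distrib_right right_diff_distrib sum_subtractf)
      also have "\<bar>\<dots>\<bar> \<le> (\<Sum>x\<in>F n. q n x y * e)"
      proof (rule order_trans[OF sum_abs], rule sum_mono)
        fix x
        show "\<bar>q n x y * (\<phi> y - \<phi> x)\<bar> \<le> q n x y * e"
        proof (cases "dist y x < d")
          case True
          then show ?thesis
            using d(2)[OF True] q0[of x] by (simp add: abs_mult mult_left_mono)
        next
          case False
          then have "q n x y = 0" using n by (simp add: q_def b_def inverse_eq_divide)
          then show ?thesis by simp
        qed
      qed
      also have "\<dots> = e" using sum1 by (simp add: sum_distrib_right[symmetric])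
      finally show "\<bar>(\<phi> - \<psi>) y\<bar> \<le> e" .
    qed
    ultimately show "\<exists>\<psi>\<in>span (range p). norm (\<phi> - \<psi>) \<le> e" ..
  qed
qed

lemma blinfun_apply_diff_le:
  fixes F :: "'v::real_normed_vector \<Rightarrow>\<^sub>L real"
  assumes "norm F \<le> B" "norm (\<phi> - \<psi>) \<le> d"
  shows "\<bar>F \<phi> - F \<psi>\<bar> \<le> B * d"
proof -
  have "\<bar>F \<phi> - F \<psi>\<bar> \<le> norm F * norm (\<phi> - \<psi>)"
    using norm_blinfun[of F "\<phi> - \<psi>"] by (simp add: blinfun.diff_right)
  also have "\<dots> \<le> B * d"
    using assms norm_ge_zero[of F] by (intro mult_mono) (linarith | simp)+
  finally show ?thesis .
qed

lemma tendsto_of_tendsto_on_dense: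
  fixes F :: "nat \<Rightarrow> 'v::real_normed_vector \<Rightarrow>\<^sub>L real" and p :: "nat \<Rightarrow> 'v"
  assumes dense: "\<And>\<phi> e. 0 < e \<Longrightarrow> \<exists>\<psi>\<in>span (range p). norm (\<phi> - \<psi>) \<le> e"
    and bound: "\<And>n. norm (F n) \<le> B" and bound': "norm \<Lambda> \<le> B"
    and lim: "\<And>i. (\<lambda>n. F n (p i)) \<longlonglongrightarrow> blinfun_apply \<Lambda> (p i)"
  shows "(\<lambda>n. F n \<phi>) \<longlonglongrightarrow> \<Lambda> \<phi>"
proof -
  have B: "B \<ge> 0" using bound' norm_ge_zero[of \<Lambda>] by linarith
  have span: "(\<lambda>n. F n \<psi>) \<longlonglongrightarrow> \<Lambda> \<psi>" if "\<psi> \<in> span (range p)" for \<psi>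
    using that
  proof (induction rule: span_induct_alt)
    case base
    then show ?case by (simp add: blinfun.zero_right)
  next
    case (step c x y)
    then obtain i where "x = p i" by blast
    then show ?case
      using step lim[of i] by (auto simp: blinfun.add_right blinfun.scaleR_right intro!: tendsto_intros)
  qed
  show ?thesis
  proof (rule LIMSEQ_I)
    fix e :: real assume e: "e > 0"
    \<comment> \<open>Chosen to make \<open>B * d < e / 3\<close>; the \<open>+ 1\<close> covers
      \<open>B = 0\<close>.\<close>
    define d where "d = e / (4 * (B + 1))"
    have d: "d > 0" "B * d < e / 3"
    proof -
      show d: "d > 0" using B e by (simp add: d_def)
      have "4 * ((B + 1) * d) = e" using B unfolding d_def by (simp add: nonzero_eq_divide_eq mult.commute mult.left_commute)
      then have "4 * (B * d) + 4 * d = e" by (simp add: algebra_simps)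
      then show "B * d < e / 3" using d e mult_nonneg_nonneg[OF B less_imp_le[OF d]] by linarith
    qed
    obtain \<psi> where \<psi>: "\<psi> \<in> span (range p)" "norm (\<phi> - \<psi>) \<le> d" using dense[OF d(1)] by blast
    obtain N where N: "\<And>n. n \<ge> N \<Longrightarrow> norm (F n \<psi> - \<Lambda> \<psi>) < e / 3"
      using LIMSEQ_D[OF span[OF \<psi>(1)], of "e / 3"] e by auto
    have "norm (F n \<phi> - \<Lambda> \<phi>) < e" if "n \<ge> N" for n
      using N[OF that] d blinfun_apply_diff_le[OF bound \<psi>(2), of n] blinfun_apply_diff_le[OF bound' \<psi>(2)]
      unfolding real_norm_def by linarith
    then show "\<exists>no. \<forall>n\<ge>no. norm (F n \<phi> - \<Lambda> \<phi>) < e" by blast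
  qed
qed

lemma convergent_of_convergent_on_dense:
  fixes F :: "nat \<Rightarrow> 'v::real_normed_vector \<Rightarrow>\<^sub>L real" and p :: "nat \<Rightarrow> 'v"
  assumes dense: "\<And>\<phi> e. 0 < e \<Longrightarrow> \<exists>\<psi>\<in>span (range p). norm (\<phi> - \<psi>) \<le> e"
    and bound: "\<And>n. norm (F n) \<le> B"
    and conv: "\<And>i. convergent (\<lambda>n. F n (p i))"
  shows "convergent (\<lambda>n. F n \<phi>)"
proof -
  have B: "B \<ge> 0" using bound[of 0] norm_ge_zero[of "F 0"] by linarith
  have span: "convergent (\<lambda>n. F n \<psi>)" if "\<psi> \<in> span (range p)" for \<psi>
    using that
  proof (induction rule: span_induct_alt)
    case base
    then show ?case by (simp add: blinfun.zero_right convergent_const)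
  next
    case (step c x y)
    then obtain i where "x = p i" by blast
    then show ?case
      using step conv[of i]
      by (auto simp: blinfun.add_right blinfun.scaleR_right intro!: convergent_add convergent_mult convergent_const)
  qed
  have "Cauchy (\<lambda>n. F n \<phi>)"
  proof (rule metric_CauchyI)
    fix e :: real assume e: "e > 0"
    define d where "d = e / (4 * (B + 1))"
    have d: "d > 0" "B * d < e / 3"
    proof -
      show d: "d > 0" using B e by (simp add: d_def)
      have "4 * ((B + 1) * d) = e" using B unfolding d_def by (simp add: nonzero_eq_divide_eq mult.commute mult.left_commute)
      then have "4 * (B * d) + 4 * d = e" by (simp add: algebra_simps)
      then show "B * d < e / 3" using d e mult_nonneg_nonneg[OF B less_imp_le[OF d]] by linarith
    qed
    obtain \<psi> where \<psi>: "\<psi> \<in> span (range p)" "norm (\<phi> - \<psi>) \<le> d" using dense[OF d(1)] by blast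
    have "Cauchy (\<lambda>n. F n \<psi>)" using span[OF \<psi>(1)] by (simp add: Cauchy_convergent_iff)
    then obtain N where N: "\<And>m n. m \<ge> N \<Longrightarrow> n \<ge> N \<Longrightarrow> dist (F m \<psi>) (F n \<psi>) < e / 3"
      using e unfolding Cauchy_def by (metis divide_pos_pos zero_less_numeral)
    have "dist (F m \<phi>) (F n \<phi>) < e" if "m \<ge> N" "n \<ge> N" for m n
      using N[OF that] d blinfun_apply_diff_le[OF bound \<psi>(2), of m] blinfun_apply_diff_le[OF bound \<psi>(2), of n]
      unfolding dist_real_def by linarith
    then show "\<exists>M. \<forall>m\<ge>M. \<forall>n\<ge>M. dist (F m \<phi>) (F n \<phi>) < e" by blast
  qed
  then show ?thesis by (simp add: Cauchy_convergent_iff)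
qed

lemma pointwise_limit_blinfun:
  fixes F :: "nat \<Rightarrow> 'v::real_normed_vector \<Rightarrow>\<^sub>L real"
  assumes bound: "\<And>n. norm (F n) \<le> B" and lim: "\<And>\<phi>. (\<lambda>n. F n \<phi>) \<longlonglongrightarrow> l \<phi>"
  obtains \<Lambda> :: "'v \<Rightarrow>\<^sub>L real" where "\<And>\<phi>. \<Lambda> \<phi> = l \<phi>" "norm \<Lambda> \<le> B"
proof -
  have le: "norm (l \<phi>) \<le> norm \<phi> * B" for \<phi>
  proof (rule LIMSEQ_le_const2[OF tendsto_norm[OF lim]])
    have "norm (F n \<phi>) \<le> norm \<phi> * B" for n
      using norm_blinfun[of "F n" \<phi>] mult_right_mono[OF bound[of n], of "norm \<phi>"]
      by (simp add: mult.commute)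
    then show "\<exists>N. \<forall>n\<ge>N. norm (F n \<phi>) \<le> norm \<phi> * B" by blast
  qed
  have "bounded_linear l"
  proof (rule bounded_linear_intro[OF _ _ le])
    show "l (x + y) = l x + l y" for x y
      using LIMSEQ_unique[OF lim[of "x + y"]] tendsto_add[OF lim[of x] lim[of y]]
      by (simp add: blinfun.add_right)
    show "l (r *\<^sub>R x) = r *\<^sub>R l x" for r x
      using LIMSEQ_unique[OF lim[of "r *\<^sub>R x"]] tendsto_scaleR[OF tendsto_const lim[of x], of r]
      by (simp add: blinfun.scaleR_right)
  qed
  then have app: "blinfun_apply (Blinfun l) \<phi> = l \<phi>" for \<phi>
    by (simp add: bounded_linear_Blinfun_apply)
  have "B \<ge> 0" using bound[of 0] norm_ge_zero[of "F 0"] by linarith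
  then have "norm (Blinfun l) \<le> B"
    using le by (intro norm_blinfun_bound) (auto simp: app mult.commute)
  with app show ?thesis by (rule that)
qed

text \<open>The diagonal argument is contained in the sequential compactness of the countable
  product of the intervals of radius \<open>B * norm (p i)\<close>. The uniform norm bound extends
  convergence from the dense span to every argument.\<close>

lemma weak_star_seq_compact:
  fixes F :: "nat \<Rightarrow> ('b::metric_space \<Rightarrow>\<^sub>C real) \<Rightarrow>\<^sub>L real"
  assumes compact: "compact (UNIV :: 'b set)" and bound: "\<And>n. norm (F n) \<le> B"
  obtains r :: "nat \<Rightarrow> nat" and \<Lambda> where "strict_mono r" "norm \<Lambda> \<le> B"
    "\<And>\<phi>. (\<lambda>n. F (r n) \<phi>) \<longlonglongrightarrow> blinfun_apply \<Lambda> \<phi>"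
proof -
  obtain p :: "nat \<Rightarrow> 'b \<Rightarrow>\<^sub>C real"
    where p: "\<And>\<phi> e. 0 < e \<Longrightarrow> \<exists>\<psi>\<in>span (range p). norm (\<phi> - \<psi>) \<le> e"
    using separable_bcontfun[OF compact] by blast
  define S where "S = Pi UNIV (\<lambda>i. cball (0::real) (B * norm (p i)))"
  have "seq_compact S"
    unfolding S_def by (intro compact_imp_seq_compact compact_Pi compact_cball)
  moreover have "(\<lambda>i. F n (p i)) \<in> S" for n
  proof -
    have "norm (F n (p i)) \<le> B * norm (p i)" for i
      using norm_blinfun[of "F n" "p i"] mult_right_mono[OF bound[of n], of "norm (p i)"] by simp
    then show ?thesis by (simp add: S_def)
  qed
  ultimately obtain l r where r: "strict_mono r" "((\<lambda>n i. F n (p i)) \<circ> r) \<longlonglongrightarrow> l"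
    using seq_compactE[of S "\<lambda>n i. F n (p i)"] by blast
  then have "(\<lambda>n. F (r n) (p i)) \<longlonglongrightarrow> l i" for i
    by (simp add: tendsto_fun_iff)
  then have conv: "convergent (\<lambda>n. F (r n) (p i))" for i
    by (rule convergentI)
  have "convergent (\<lambda>n. F (r n) \<phi>)" for \<phi>
    by (rule convergent_of_convergent_on_dense[where F = "\<lambda>n. F (r n)", OF p bound conv])
  then have lim: "(\<lambda>n. F (r n) \<phi>) \<longlonglongrightarrow> lim (\<lambda>n. F (r n) \<phi>)" for \<phi>
    by (simp add: convergent_LIMSEQ_iff)
  obtain \<Lambda> :: "('b \<Rightarrow>\<^sub>C real) \<Rightarrow>\<^sub>L real"
    where "\<And>\<phi>. \<Lambda> \<phi> = lim (\<lambda>n. F (r n) \<phi>)" "norm \<Lambda> \<le> B"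
    using pointwise_limit_blinfun[of "\<lambda>n. F (r n)", OF bound lim] by blast
  then show ?thesis using that[OF r(1)] lim by simp
qed

text \<open>Evaluation at the dense sequence embeds \<open>A\<close> into the metrizable space of
  real sequences, where the image is sequentially compact, hence compact. Its inverse
  \<open>\<Psi>\<close> is continuous, because convergence on the dense span together with the norm
  bound gives convergence everywhere. Sequential closedness of \<open>A\<close> therefore
  suffices.\<close>

lemma compactin_strong_operator_topology:
  fixes A :: "(('b::metric_space \<Rightarrow>\<^sub>C real) \<Rightarrow>\<^sub>L real) set"
  assumes compact: "compact (UNIV :: 'b set)" and bound: "\<And>\<mu>. \<mu> \<in> A \<Longrightarrow> norm \<mu> \<le> B"
    and closed: "\<And>F \<Lambda>. range F \<subseteq> A \<Longrightarrow>
      (\<And>\<phi>. (\<lambda>n::nat. blinfun_apply (F n) \<phi>) \<longlonglongrightarrow> blinfun_apply \<Lambda> \<phi>) \<Longrightarrow> \<Lambda> \<in> A"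
  shows "compactin strong_operator_topology A"
proof -
  obtain p :: "nat \<Rightarrow> 'b \<Rightarrow>\<^sub>C real"
    where p: "\<And>\<phi> e. 0 < e \<Longrightarrow> \<exists>\<psi>\<in>span (range p). norm (\<phi> - \<psi>) \<le> e"
    using separable_bcontfun[OF compact] by blast
  define \<Phi> where "\<Phi> \<mu> = (\<lambda>i. blinfun_apply \<mu> (p i))" for \<mu> :: "('b \<Rightarrow>\<^sub>C real) \<Rightarrow>\<^sub>L real"
  define S where "S = \<Phi> ` A"
  have "seq_compact S"
    unfolding seq_compact_def
  proof (intro allI impI)
    fix s :: "nat \<Rightarrow> nat \<Rightarrow> real" assume "\<forall>n. s n \<in> S"
    then have "\<forall>n. \<exists>\<mu>\<in>A. s n = \<Phi> \<mu>" by (auto simp: S_def)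
    then obtain F where F: "\<And>n. F n \<in> A" "\<And>n. s n = \<Phi> (F n)" by metis
    obtain r \<Lambda> where r: "strict_mono r" "\<And>\<phi>. (\<lambda>n. F (r n) \<phi>) \<longlonglongrightarrow> blinfun_apply \<Lambda> \<phi>"
      using weak_star_seq_compact[OF compact, of F B] bound F by metis
    have "\<Lambda> \<in> A" using F r by (intro closed[of "\<lambda>n. F (r n)"]) auto
    moreover have "(s \<circ> r) \<longlonglongrightarrow> \<Phi> \<Lambda>"
      using r(2) by (simp add: tendsto_fun_iff F \<Phi>_def)
    ultimately show "\<exists>l\<in>S. \<exists>r. strict_mono r \<and> (s \<circ> r) \<longlonglongrightarrow> l"
      using r(1) by (auto simp: S_def)
  qed
  then have S: "compact S" by (simp add: compact_eq_seq_compact_metric)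
  define \<Psi> where "\<Psi> s = (SOME \<mu>. \<mu> \<in> A \<and> \<Phi> \<mu> = s)" for s
  have \<Psi>: "\<Psi> s \<in> A \<and> \<Phi> (\<Psi> s) = s" if s: "s \<in> S" for s
  proof -
    obtain \<mu> where "\<mu> \<in> A \<and> \<Phi> \<mu> = s" using s by (auto simp: S_def)
    then show ?thesis unfolding \<Psi>_def by (rule someI)
  qed
  have inj: "\<mu> = \<nu>" if \<mu>: "\<mu> \<in> A" and \<nu>: "\<nu> \<in> A" and eq: "\<Phi> \<mu> = \<Phi> \<nu>" for \<mu> \<nu>
  proof (rule blinfun_eqI)
    fix \<phi>
    have "\<mu> (p i) = \<nu> (p i)" for i using fun_cong[OF eq, of i] by (simp add: \<Phi>_def)
    then have lim: "(\<lambda>n::nat. \<mu> (p i)) \<longlonglongrightarrow> \<nu> (p i)" for i by simp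
    have "(\<lambda>n::nat. \<mu> \<phi>) \<longlonglongrightarrow> \<nu> \<phi>"
      by (rule tendsto_of_tendsto_on_dense[where F = "\<lambda>_. \<mu>", OF p bound[OF \<mu>] bound[OF \<nu>] lim])
    then show "\<mu> \<phi> = \<nu> \<phi>" by (simp add: LIMSEQ_const_iff)
  qed
  have image: "\<Psi> ` S = A"
  proof
    show "\<Psi> ` S \<subseteq> A" using \<Psi> by blast
    show "A \<subseteq> \<Psi> ` S"
    proof
      fix \<mu> assume "\<mu> \<in> A"
      then have "\<Phi> \<mu> \<in> S" "\<mu> = \<Psi> (\<Phi> \<mu>)" using \<Psi> inj by (auto simp: S_def)
      then show "\<mu> \<in> \<Psi> ` S" by blast
    qed
  qed
  have "continuous_on S (\<lambda>s. \<Psi> s \<phi>)" for \<phi>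
  proof (rule continuous_on_sequentiallyI)
    fix s a assume s: "\<forall>n. s n \<in> S" "a \<in> S" "s \<longlonglongrightarrow> a"
    show "(\<lambda>n. \<Psi> (s n) \<phi>) \<longlonglongrightarrow> \<Psi> a \<phi>"
    proof (rule tendsto_of_tendsto_on_dense[where F = "\<lambda>n. \<Psi> (s n)" and B = B, OF p])
      fix i
      have "\<Psi> t (p i) = t i" if "t \<in> S" for t
        using \<Psi>[OF that] by (metis \<Phi>_def)
      then show "(\<lambda>n. \<Psi> (s n) (p i)) \<longlonglongrightarrow> \<Psi> a (p i)"
        using s by (simp add: tendsto_fun_iff)
    qed (use s \<Psi> bound in auto)
  qed
  then have "continuous_map (top_of_set S) strong_operator_topology \<Psi>"
    by (subst continuous_on_strong_operator_topo_iff_coordinatewise) simp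
  moreover have "compactin (top_of_set S) S"
    using S by (simp add: compactin_subtopology compactin_euclidean_iff)
  ultimately show ?thesis
    using image image_compactin by metis
qed

lemma limitin_strong_operator_topology_iff:
  fixes F :: "'c \<Rightarrow> 'v::real_normed_vector \<Rightarrow>\<^sub>L 'w::real_normed_vector"
  shows "limitin strong_operator_topology F \<mu> net \<longleftrightarrow> (\<forall>\<phi>. ((\<lambda>n. F n \<phi>) \<longlongrightarrow> \<mu> \<phi>) net)"
proof
  assume lim: "limitin strong_operator_topology F \<mu> net"
  show "\<forall>\<phi>. ((\<lambda>n. F n \<phi>) \<longlongrightarrow> \<mu> \<phi>) net"
  proof
    fix \<phi>
    show "((\<lambda>n. F n \<phi>) \<longlongrightarrow> \<mu> \<phi>) net"
      using continuous_map_limit[OF strong_operator_topology_continuous_evaluation[of \<phi>] lim]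
      by (simp add: o_def)
  qed
next
  assume lim: "\<forall>\<phi>. ((\<lambda>n. F n \<phi>) \<longlongrightarrow> \<mu> \<phi>) net"
  show "limitin strong_operator_topology F \<mu> net"
    unfolding limitin_def strong_operator_topology_topspace
  proof (intro conjI allI impI)
    fix U assume "openin strong_operator_topology U \<and> \<mu> \<in> U"
    then obtain W where W: "open W" "U = blinfun_apply -` W" "blinfun_apply \<mu> \<in> W"
      by (auto simp: strong_operator_topology_def openin_pullback_topology)
    have "((\<lambda>n. blinfun_apply (F n)) \<longlongrightarrow> blinfun_apply \<mu>) net"
      using lim by (simp add: tendsto_fun_iff)
    then show "\<forall>\<^sub>F x in net. F x \<in> U"
      using W topological_tendstoD by fastforce
  qed simp
qed

section \<open>Invariant functionals and entropy\<close>

lemma continuous_on_fst_coordinate_append: "continuous_on UNIV (\<lambda>\<omega>. case_nat \<omega> \<sigma> :: nat \<Rightarrow> 'a::topological_space)"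
proof (rule continuous_on_coordinatewise_then_product)
  show "continuous_on UNIV (\<lambda>\<omega>. case_nat \<omega> \<sigma> i)" for i by (cases i) (auto intro: continuous_intros)
qed

lemma continuous_on_append: "continuous_on UNIV (\<lambda>\<sigma>. case_nat \<omega> \<sigma> :: nat \<Rightarrow> 'a::topological_space)"
proof (rule continuous_on_coordinatewise_then_product)
  show "continuous_on UNIV (\<lambda>\<sigma>. case_nat \<omega> \<sigma> i)" for i
    by (cases i) (auto intro: continuous_intros)
qed

lemma continuous_on_shift_map: "continuous_on UNIV (shift_map :: (nat \<Rightarrow> 'a::topological_space) \<Rightarrow> _)"
  unfolding shift_map_def by (intro continuous_on_coordinatewise_then_product continuous_on_product_coordinates)

lemma shift_map_append: "shift_map (case_nat \<omega> \<sigma>) = \<sigma>"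
  by (simp add: shift_map_def)

lemma dist_fun_lt_of_agree:
  fixes d :: real
  assumes "d > 0"
  obtains n where "\<And>\<sigma> \<sigma>' :: nat \<Rightarrow> 'a::metric_space. (\<And>i. i < n \<Longrightarrow> \<sigma> i = \<sigma>' i) \<Longrightarrow> dist \<sigma> \<sigma>' < d"
proof -
  obtain N where N: "(1/2) ^ N < d" using real_arch_pow_inv[OF assms, of "1/2"] by auto
  \<comment> \<open>The product metric enumerates the coordinates by \<open>from_nat\<close> and
    weights the \<open>k\<close>-th of them by a power of \<open>1/2\<close>; \<open>n\<close> has
    to exceed every index enumerated up to \<open>N\<close>.\<close>
  define n where "n = Suc (Max (from_nat ` {..N}))"
  have "dist \<sigma> \<sigma>' < d" if agree: "\<And>i. i < n \<Longrightarrow> \<sigma> i = \<sigma>' i" for \<sigma> \<sigma>' :: "nat \<Rightarrow> 'a"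
  proof -
    have "from_nat k < n" if "k \<le> N" for k
      using that unfolding n_def by (intro le_imp_less_Suc Max_ge) auto
    then have "{dist (\<sigma> (from_nat k)) (\<sigma>' (from_nat k)) | k. k \<le> N} = {0}"
      using agree by (auto intro!: exI[of _ 0])
    then show ?thesis
      using dist_fun_le_dist_first_terms[of \<sigma> \<sigma>' N] N by simp
  qed
  then show ?thesis by (rule that)
qed

locale symbolic =
  fixes m :: "'a::metric_space measure"
  assumes compact_alphabet: "compact (UNIV :: 'a set)"
    and prob_m: "prob_space m" and sets_m: "sets m = sets borel"
begin

lemma compact_seq: "compact (UNIV :: (nat \<Rightarrow> 'a) set)"
  by (rule compact_UNIV_fun[OF compact_alphabet])

lemmas apply_Bcont = apply_Bcontfun[OF compact_seq]

section \<open>Invariant functionals as positive normalised functionals\<close>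

definition shift_cf :: "'a cfun \<Rightarrow> 'a cfun" where
  "shift_cf \<phi> = Bcontfun (\<lambda>\<sigma>. \<phi> (shift_map \<sigma>))"

lemma apply_shift_cf: "shift_cf \<phi> \<sigma> = \<phi> (shift_map \<sigma>)"
  unfolding shift_cf_def
  using continuous_on_compose2[OF continuous_on_apply_bcontfun[of UNIV \<phi>] continuous_on_shift_map]
  by (subst apply_Bcont) auto

text \<open>The linear conditions on the right pass at once to convex combinations and pointwise
  limits. For the converse the Riesz measure represents the functional, and it equals its image
  under the shift because both integrate continuous functions alike.\<close>

lemma inv_functionals_iff:
  "\<Lambda> \<in> inv_functionals \<longleftrightarrow>
     (\<forall>\<phi> :: 'a cfun. (\<forall>\<sigma>. 0 \<le> apply_bcontfun \<phi> \<sigma>) \<longrightarrow> 0 \<le> blinfun_apply \<Lambda> \<phi>) \<and> \<Lambda> (const_bcontfun 1) = 1 \<and>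
     (\<forall>\<phi> :: 'a cfun. \<Lambda> (shift_cf \<phi>) = \<Lambda> \<phi>)"
  (is "_ \<longleftrightarrow> ?R")
proof
  assume "\<Lambda> \<in> inv_functionals"
  then obtain M where M: "represents M \<Lambda>" and inv: "distr M borel shift_map = M"
    by (auto simp: inv_functionals_def)
  then interpret prob_space M by (simp add: represents_def)
  have sets_M: "sets M = sets borel" and app: "\<Lambda> \<phi> = (\<integral>\<sigma>. \<phi> \<sigma> \<partial>M)" for \<phi> :: "'a cfun"
    using M by (auto simp: represents_def)
  have shift: "shift_map \<in> M \<rightarrow>\<^sub>M borel"
    using borel_measurable_continuous_onI[OF continuous_on_shift_map] sets_M by (simp cong: measurable_cong_sets)
  have "\<Lambda> (shift_cf \<phi>) = \<Lambda> \<phi>" for \<phi>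
  proof -
    have "\<Lambda> \<phi> = (\<integral>\<sigma>. \<phi> \<sigma> \<partial>(distr M borel shift_map))" using app inv by simp
    also have "\<dots> = (\<integral>\<sigma>. \<phi> (shift_map \<sigma>) \<partial>M)"
      by (rule integral_distr[OF shift]) (intro borel_measurable_continuous_onI continuous_on_apply_bcontfun)
    finally show ?thesis by (simp add: app apply_shift_cf)
  qed
  then show ?R
    by (auto simp: app const_bcontfun.rep_eq prob_space)
next
  assume R: ?R
  define I where "I f = \<Lambda> (Bcontfun f)" for f
  interpret positive_functional I
  proof
    fix f g :: "(nat \<Rightarrow> 'a) \<Rightarrow> real" and c
    assume f: "continuous_on UNIV f"
    have "Bcontfun (\<lambda>x. c * f x) = c *\<^sub>R Bcontfun f"
      by (rule bcontfun_eqI) (simp add: apply_Bcont f continuous_on_mult_left)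
    then show "I (\<lambda>x. c * f x) = c * I f" by (simp add: I_def blinfun.scaleR_right)
    assume g: "continuous_on UNIV g"
    have "Bcontfun (\<lambda>x. f x + g x) = Bcontfun f + Bcontfun g"
      by (rule bcontfun_eqI) (simp add: apply_Bcont f g continuous_on_add)
    then show "I (\<lambda>x. f x + g x) = I f + I g" by (simp add: I_def blinfun.add_right)
    assume le: "\<And>x. f x \<le> g x"
    have "0 \<le> \<Lambda> (Bcontfun g - Bcontfun f)"
      using R le by (simp add: apply_Bcont f g)
    then show "I f \<le> I g" by (simp add: I_def blinfun.diff_right)
  next
    show "I (\<lambda>_. 1) = 1" using R by (simp add: I_def const_bcontfun_def)
  qed (rule compact_seq)
  interpret prob_space riesz_measure by (rule prob_space_riesz_measure)
  have app: "\<Lambda> \<phi> = (\<integral>\<sigma>. \<phi> \<sigma> \<partial>riesz_measure)" for \<phi> :: "'a cfun"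
    using riesz_representation[of "apply_bcontfun \<phi>"] by (simp add: I_def apply_bcontfun_inverse)
  then have rep: "represents riesz_measure \<Lambda>"
    by (simp add: represents_def prob_space_riesz_measure sets_riesz_measure)
  have shift: "shift_map \<in> riesz_measure \<rightarrow>\<^sub>M borel"
    using borel_measurable_continuous_onI[OF continuous_on_shift_map] sets_riesz_measure
    by (simp cong: measurable_cong_sets)
  have "distr riesz_measure borel shift_map = riesz_measure"
  proof (rule borel_prob_measure_eqI)
    fix f :: "(nat \<Rightarrow> 'a) \<Rightarrow> real" assume f: "continuous_on UNIV f"
    have "(\<integral>x. f x \<partial>distr riesz_measure borel shift_map) = (\<integral>\<sigma>. f (shift_map \<sigma>) \<partial>riesz_measure)"
      by (rule integral_distr[OF shift]) (intro borel_measurable_continuous_onI f)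
    also have "\<dots> = \<Lambda> (shift_cf (Bcontfun f))"
      by (simp add: app apply_shift_cf apply_Bcont f)
    also have "\<dots> = \<Lambda> (Bcontfun f)" using R by blast
    also have "\<dots> = (\<integral>x. f x \<partial>riesz_measure)"
      by (simp add: app apply_Bcont f)
    finally show "(\<integral>x. f x \<partial>distr riesz_measure borel shift_map) = (\<integral>x. f x \<partial>riesz_measure)" .
  qed (use prob_space_distr[OF shift] prob_space_riesz_measure sets_riesz_measure in auto)
  then show "\<Lambda> \<in> inv_functionals"
    using rep by (auto simp: inv_functionals_def prob_functionals_def)
qed

lemma inv_mono:
  fixes \<phi> \<psi> :: "'a cfun"
  assumes "\<mu> \<in> inv_functionals" "\<And>\<sigma>. \<phi> \<sigma> \<le> \<psi> \<sigma>"
  shows "blinfun_apply \<mu> \<phi> \<le> blinfun_apply \<mu> \<psi>"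
proof -
  have "0 \<le> \<mu> (\<psi> - \<phi>)" using assms by (auto simp: inv_functionals_iff)
  then show ?thesis by (simp add: blinfun.diff_right)
qed

lemma inv_const:
  assumes "\<mu> \<in> inv_functionals"
  shows "blinfun_apply \<mu> (const_bcontfun c :: 'a cfun) = c"
proof -
  have "const_bcontfun c = c *\<^sub>R (const_bcontfun 1 :: 'a cfun)"
    by (rule bcontfun_eqI) (simp add: const_bcontfun.rep_eq)
  then show ?thesis using assms by (simp add: inv_functionals_iff blinfun.scaleR_right)
qed

lemma inv_norm:
  assumes "\<mu> \<in> inv_functionals"
  shows "norm (\<mu> :: 'a cdual) \<le> 1"
proof (rule norm_blinfun_bound)
  fix \<phi> :: "'a cfun"
  have "\<mu> \<phi> \<le> \<mu> (const_bcontfun (norm \<phi>))" "\<mu> (const_bcontfun (- norm \<phi>)) \<le> \<mu> \<phi>"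
    using abs_bcontfun_le_norm[of \<phi>]
    by (auto intro!: inv_mono[OF assms] simp: const_bcontfun.rep_eq abs_le_iff minus_le_iff)
  then show "norm (\<mu> \<phi>) \<le> 1 * norm \<phi>"
    by (simp add: inv_const[OF assms] abs_le_iff)
qed simp

lemma inv_closed:
  fixes F :: "nat \<Rightarrow> 'a cdual"
  assumes F: "\<And>n. F n \<in> inv_functionals" and lim: "\<And>\<phi>. (\<lambda>n. F n \<phi>) \<longlonglongrightarrow> blinfun_apply \<mu> \<phi>"
  shows "\<mu> \<in> inv_functionals"
  unfolding inv_functionals_iff
proof (intro conjI allI impI)
  fix \<phi> :: "'a cfun" assume "\<forall>\<sigma>. 0 \<le> \<phi> \<sigma>"
  then have "0 \<le> F n \<phi>" for n using F[of n] by (simp add: inv_functionals_iff)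
  then show "0 \<le> \<mu> \<phi>" by (intro LIMSEQ_le_const[OF lim]) auto
next
  show "\<mu> (const_bcontfun 1) = 1"
    using lim[of "const_bcontfun 1"] inv_const[OF F] by (simp add: LIMSEQ_const_iff)
next
  fix \<phi>
  have "F n (shift_cf \<phi>) = F n \<phi>" for n using F[of n] by (simp add: inv_functionals_iff)
  then have "(\<lambda>n. F n \<phi>) \<longlonglongrightarrow> \<mu> (shift_cf \<phi>)" using lim[of "shift_cf \<phi>"] by simp
  then show "\<mu> (shift_cf \<phi>) = \<mu> \<phi>" using lim LIMSEQ_unique by blast
qed

lemma inv_seq_compact:
  fixes F :: "nat \<Rightarrow> 'a cdual"
  assumes F: "\<And>n. F n \<in> inv_functionals"
  obtains r :: "nat \<Rightarrow> nat" and \<mu> where "strict_mono r" "\<mu> \<in> inv_functionals"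
    "\<And>\<phi>. (\<lambda>n. F (r n) \<phi>) \<longlonglongrightarrow> blinfun_apply \<mu> \<phi>"
proof -
  obtain r :: "nat \<Rightarrow> nat" and \<mu> where r: "strict_mono r"
    "\<And>\<phi>. (\<lambda>n. F (r n) \<phi>) \<longlonglongrightarrow> blinfun_apply \<mu> \<phi>"
    by (rule weak_star_seq_compact[OF compact_seq, of F]) (auto intro: inv_norm F)
  have "\<mu> \<in> inv_functionals"
    by (rule inv_closed[OF F r(2)])
  with r(1) show ?thesis using r(2) by (rule that)
qed

lemma inv_convex: "convex (inv_functionals :: 'a cdual set)"
proof (rule convexI)
  fix \<mu> \<nu> :: "'a cdual" and u v :: real
  assume "\<mu> \<in> inv_functionals" "\<nu> \<in> inv_functionals" "0 \<le> u" "0 \<le> v" "u + v = 1"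
  then show "u *\<^sub>R \<mu> + v *\<^sub>R \<nu> \<in> inv_functionals"
    by (auto simp: inv_functionals_iff blinfun.add_left blinfun.scaleR_left)
qed

section \<open>The transfer operator\<close>

lemma integrable_append:
  fixes \<phi> :: "'a cfun"
  shows "integrable m (\<lambda>\<omega>. apply_bcontfun \<phi> (case_nat \<omega> \<sigma>))"
proof -
  interpret prob_space m by (rule prob_m)
  have "(\<lambda>\<omega>. \<phi> (case_nat \<omega> \<sigma>)) \<in> borel_measurable m"
    using borel_measurable_continuous_onI[OF continuous_on_compose2[OF continuous_on_apply_bcontfun[of UNIV \<phi>]
        continuous_on_fst_coordinate_append]] sets_m
    by (simp cong: measurable_cong_sets)
  then show ?thesis
    using abs_bcontfun_le_norm[of \<phi>] by (intro integrable_const_bound[of _ "norm \<phi>"]) auto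
qed

lemma continuous_on_transfer_op:
  fixes \<phi> :: "'a cfun"
  shows "continuous_on UNIV (transfer_op m \<phi>)"
proof (rule continuous_on_sequentiallyI)
  fix u and a :: "nat \<Rightarrow> 'a" assume u: "u \<longlonglongrightarrow> a"
  interpret prob_space m by (rule prob_m)
  show "(\<lambda>n. transfer_op m \<phi> (u n)) \<longlonglongrightarrow> transfer_op m \<phi> a"
    unfolding transfer_op_def
  proof (rule integral_dominated_convergence[where w = "\<lambda>_. norm \<phi>"])
    show "AE \<omega> in m. (\<lambda>n. \<phi> (case_nat \<omega> (u n))) \<longlonglongrightarrow> \<phi> (case_nat \<omega> a)"
    proof (rule AE_I2)
      fix \<omega>
      have "continuous_on UNIV (\<lambda>\<sigma>. \<phi> (case_nat \<omega> \<sigma>))"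
        by (rule continuous_on_compose2[OF continuous_on_apply_bcontfun[of UNIV \<phi>] continuous_on_append]) simp
      then show "(\<lambda>n. \<phi> (case_nat \<omega> (u n))) \<longlonglongrightarrow> \<phi> (case_nat \<omega> a)"
        using u by (rule continuous_on_tendsto_compose) auto
    qed
  qed (use integrable_append abs_bcontfun_le_norm[of \<phi>] in auto)
qed

definition transfer :: "'a cfun \<Rightarrow> 'a cfun" where
  "transfer \<phi> = Bcontfun (transfer_op m \<phi>)"

lemma apply_transfer: "transfer \<phi> \<sigma> = transfer_op m \<phi> \<sigma>"
  unfolding transfer_def by (simp add: apply_Bcont continuous_on_transfer_op)

lemma transfer_add: "transfer (\<phi> + \<psi>) = transfer \<phi> + transfer \<psi>"
  by (rule bcontfun_eqI) (simp add: apply_transfer transfer_op_def integrable_append)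

lemma transfer_scaleR: "transfer (c *\<^sub>R \<phi>) = c *\<^sub>R transfer \<phi>"
  by (rule bcontfun_eqI) (simp add: apply_transfer transfer_op_def)

lemma transfer_mono:
  fixes \<phi> \<psi> :: "'a cfun"
  assumes "\<And>\<sigma>. \<phi> \<sigma> \<le> \<psi> \<sigma>"
  shows "transfer \<phi> \<sigma> \<le> transfer \<psi> \<sigma>"
  unfolding apply_transfer transfer_op_def by (intro integral_mono integrable_append assms)

lemma transfer_const: "transfer (const_bcontfun c) = const_bcontfun c"
proof -
  interpret prob_space m by (rule prob_m)
  show ?thesis
    by (rule bcontfun_eqI) (simp add: apply_transfer transfer_op_def const_bcontfun.rep_eq prob_space)
qed

text \<open>The shift drops the prepended letter, so the integrand is constant. Consequently every
  functional fixed by \<open>transfer\<close> is shift-invariant.\<close>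

lemma transfer_shift: "transfer (shift_cf \<phi>) = \<phi>"
proof -
  interpret prob_space m by (rule prob_m)
  show ?thesis
    by (rule bcontfun_eqI) (simp add: apply_transfer transfer_op_def apply_shift_cf shift_map_append prob_space)
qed

lemma positive_bounded_below:
  fixes \<phi> :: "'a cfun"
  assumes "\<And>\<sigma>. 0 < \<phi> \<sigma>"
  obtains c where "0 < c" "\<And>\<sigma>. c \<le> \<phi> \<sigma>"
proof -
  obtain \<sigma>0 where "\<forall>\<sigma>\<in>UNIV. \<phi> \<sigma>0 \<le> \<phi> \<sigma>"
    using continuous_attains_inf[OF compact_seq _ continuous_on_apply_bcontfun[of UNIV \<phi>]] by auto
  then show ?thesis using that[of "\<phi> \<sigma>0"] assms by auto
qed

lemma transfer_pos:
  fixes \<phi> :: "'a cfun"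
  assumes "\<And>\<sigma>. 0 < \<phi> \<sigma>"
  shows "0 < transfer \<phi> \<sigma>"
proof -
  obtain c where c: "0 < c" "\<And>\<sigma>. c \<le> \<phi> \<sigma>" using positive_bounded_below[of \<phi>] assms by blast
  have "c \<le> transfer \<phi> \<sigma>"
    using transfer_mono[of "const_bcontfun c" \<phi> \<sigma>] c(2)
    by (simp add: transfer_const const_bcontfun.rep_eq)
  with c show ?thesis by simp
qed

section \<open>The entropy as an infimum of linear functionals\<close>

definition log_ratio :: "'a cfun \<Rightarrow> 'a cfun" where
  "log_ratio \<phi> = Bcontfun (\<lambda>\<sigma>. ln (transfer_op m \<phi> \<sigma> / \<phi> \<sigma>))"

lemma apply_log_ratio:
  fixes \<phi> :: "'a cfun"
  assumes pos: "\<And>\<sigma>. 0 < \<phi> \<sigma>"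
  shows "log_ratio \<phi> \<sigma> = ln (transfer_op m \<phi> \<sigma> / \<phi> \<sigma>)"
proof -
  have "transfer_op m \<phi> \<sigma> / \<phi> \<sigma> \<noteq> 0" "\<phi> \<sigma> \<noteq> 0" for \<sigma>
    using pos[of \<sigma>] transfer_pos[OF pos, of \<sigma>] by (auto simp: apply_transfer)
  then have "continuous_on UNIV (\<lambda>\<sigma>. ln (transfer_op m \<phi> \<sigma> / \<phi> \<sigma>))"
    by (intro continuous_on_ln continuous_on_divide continuous_on_transfer_op continuous_on_apply_bcontfun ballI)
  then show ?thesis unfolding log_ratio_def by (simp add: apply_Bcont)
qed

lemma represents_rep_measure:
  assumes "\<mu> \<in> inv_functionals"
  shows "represents (rep_measure \<mu>) (\<mu> :: 'a cdual)"
  using assms unfolding inv_functionals_def prob_functionals_def rep_measure_def by (auto intro: someI)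

text \<open>Each positive \<open>\<phi>\<close> contributes the evaluation
  \<open>\<mu> (log_ratio \<phi>)\<close>, linear and weak-star continuous in \<open>\<mu>\<close>.
  Concavity and upper semicontinuity of the entropy are read off from this form.\<close>

lemma entropy_eq:
  assumes "\<mu> \<in> inv_functionals"
  shows "entropy_h m \<mu> = (INF \<phi>\<in>{\<phi> :: 'a cfun. \<forall>\<sigma>. 0 < apply_bcontfun \<phi> \<sigma>}. ereal (\<mu> (log_ratio \<phi>)))"
  unfolding entropy_h_def
proof (rule INF_cong[OF refl])
  fix \<phi> :: "'a cfun" assume "\<phi> \<in> {\<phi> :: 'a cfun. \<forall>\<sigma>. 0 < apply_bcontfun \<phi> \<sigma>}"
  then show "ereal (\<integral>\<sigma>. ln (transfer_op m \<phi> \<sigma> / \<phi> \<sigma>) \<partial>rep_measure \<mu>) = ereal (\<mu> (log_ratio \<phi>))"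
    using represents_rep_measure[OF assms] by (simp add: represents_def apply_log_ratio)
qed

lemma entropy_ge_iff:
  assumes "\<mu> \<in> inv_functionals"
  shows "ereal c \<le> entropy_h m \<mu> \<longleftrightarrow> (\<forall>\<phi> :: 'a cfun. (\<forall>\<sigma>. 0 < apply_bcontfun \<phi> \<sigma>) \<longrightarrow> c \<le> \<mu> (log_ratio \<phi>))"
  by (simp add: entropy_eq[OF assms] le_INF_iff)

lemma entropy_le_0:
  assumes "\<mu> \<in> inv_functionals"
  shows "entropy_h m \<mu> \<le> 0"
proof -
  have "log_ratio (const_bcontfun 1) = 0"
    using transfer_const[of 1] apply_transfer[of "const_bcontfun 1"]
    by (intro bcontfun_eqI) (simp add: apply_log_ratio const_bcontfun.rep_eq)
  then show ?thesis
    unfolding entropy_eq[OF assms]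
    by (intro INF_lower2[of "const_bcontfun 1"]) (auto simp: const_bcontfun.rep_eq blinfun.zero_right)
qed

section \<open>Powers of the transfer operator and the product measure\<close>

lemma transfer_power_near:
  fixes \<phi> :: "'a cfun"
  assumes "\<And>\<sigma>. \<bar>\<phi> \<sigma> - c\<bar> \<le> e"
  shows "\<bar>(transfer ^^ n) \<phi> \<sigma> - c\<bar> \<le> e"
proof (induction n arbitrary: \<sigma>)
  case (Suc n)
  let ?\<psi> = "(transfer ^^ n) \<phi>"
  have "c - e \<le> ?\<psi> \<sigma>" "?\<psi> \<sigma> \<le> c + e" for \<sigma> using Suc[of \<sigma>] by (auto simp: abs_le_iff)
  then have "transfer (const_bcontfun (c - e)) \<sigma> \<le> transfer ?\<psi> \<sigma>"
    "transfer ?\<psi> \<sigma> \<le> transfer (const_bcontfun (c + e)) \<sigma>"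
    by (auto intro!: transfer_mono simp: const_bcontfun.rep_eq)
  then show ?case
    unfolding transfer_const by (simp add: const_bcontfun.rep_eq abs_le_iff)
qed (use assms in simp)

text \<open>Prepending the same letter to both sequences lengthens their agreement by one, so
  \<open>transfer \<phi>\<close> needs one coordinate of agreement less than
  \<open>\<phi>\<close>.\<close>

lemma transfer_close:
  fixes \<phi> :: "'a cfun"
  assumes close: "\<And>\<sigma> \<sigma>'. (\<And>i. i < Suc n \<Longrightarrow> \<sigma> i = \<sigma>' i) \<Longrightarrow> \<bar>\<phi> \<sigma> - \<phi> \<sigma>'\<bar> \<le> e"
    and agree: "\<And>i. i < n \<Longrightarrow> \<sigma> i = \<sigma>' i"
  shows "\<bar>transfer \<phi> \<sigma> - transfer \<phi> \<sigma>'\<bar> \<le> e"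
proof -
  interpret prob_space m by (rule prob_m)
  have "transfer \<phi> \<tau> \<le> transfer \<phi> \<tau>' + e" if "\<And>i. i < n \<Longrightarrow> \<tau> i = \<tau>' i" for \<tau> \<tau>'
  proof -
    have "\<phi> (case_nat \<omega> \<tau>) \<le> \<phi> (case_nat \<omega> \<tau>') + e" for \<omega>
    proof -
      have "case_nat \<omega> \<tau> i = case_nat \<omega> \<tau>' i" if "i < Suc n" for i
        using that \<open>\<And>i. i < n \<Longrightarrow> \<tau> i = \<tau>' i\<close> by (cases i) auto
      then show ?thesis using close[of "case_nat \<omega> \<tau>" "case_nat \<omega> \<tau>'"] by (simp add: abs_le_iff)
    qed
    then have "transfer_op m \<phi> \<tau> \<le> (\<integral>\<omega>. \<phi> (case_nat \<omega> \<tau>') + e \<partial>m)"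
      unfolding transfer_op_def by (intro integral_mono) (auto intro: integrable_append)
    then show ?thesis
      by (simp add: apply_transfer transfer_op_def integrable_append prob_space)
  qed
  from this[of \<sigma> \<sigma>'] this[of \<sigma>' \<sigma>] show ?thesis using agree by (auto simp: abs_le_iff)
qed

text \<open>Each application uses up one coordinate of agreement; after \<open>n\<close> of them
  none is required, so the bound holds for arbitrary \<open>\<sigma>\<close> and
  \<open>\<sigma>'\<close>.\<close>

lemma transfer_power_close:
  fixes \<phi> :: "'a cfun"
  assumes "\<And>\<sigma> \<sigma>'. (\<And>i. i < n \<Longrightarrow> \<sigma> i = \<sigma>' i) \<Longrightarrow> \<bar>\<phi> \<sigma> - \<phi> \<sigma>'\<bar> \<le> e"
  shows "\<bar>(transfer ^^ n) \<phi> \<sigma> - (transfer ^^ n) \<phi> \<sigma>'\<bar> \<le> e"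
  using assms
proof (induction n arbitrary: \<phi>)
  case (Suc n)
  have "\<bar>(transfer ^^ n) (transfer \<phi>) \<sigma> - (transfer ^^ n) (transfer \<phi>) \<sigma>'\<bar> \<le> e"
  proof (rule Suc.IH)
    fix \<tau> \<tau>' :: "nat \<Rightarrow> 'a" assume agree: "\<And>i. i < n \<Longrightarrow> \<tau> i = \<tau>' i"
    show "\<bar>transfer \<phi> \<tau> - transfer \<phi> \<tau>'\<bar> \<le> e"
      by (rule transfer_close[OF Suc.prems agree])
  qed
  then show ?case by (simp add: funpow_swap1)
qed simp

text \<open>By uniform continuity \<open>\<phi>\<close> is determined up to \<open>e / 3\<close> by
  \<open>N\<close> coordinates. Its \<open>N\<close>-th iterate is then nearly constant, and the
  later iterates, being averages of it, stay near the same constant.\<close>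

lemma transfer_power_convergent: "convergent (\<lambda>n. apply_bcontfun ((transfer ^^ n) \<phi>) \<sigma>)"
proof -
  have "Cauchy (\<lambda>n. apply_bcontfun ((transfer ^^ n) \<phi>) \<sigma>)"
  proof (rule metric_CauchyI)
    fix e :: real assume e: "e > 0"
    have "uniformly_continuous_on UNIV (apply_bcontfun \<phi>)"
      using compact_seq by (intro compact_uniformly_continuous) auto
    then obtain d where d: "d > 0" "\<And>\<sigma> \<sigma>'. dist \<sigma> \<sigma>' < d \<Longrightarrow> \<bar>\<phi> \<sigma> - \<phi> \<sigma>'\<bar> < e / 3"
      using e unfolding uniformly_continuous_on_def dist_real_def
      by (metis UNIV_I divide_pos_pos zero_less_numeral)
    obtain N where N: "\<And>\<sigma> \<sigma>' :: nat \<Rightarrow> 'a. (\<And>i. i < N \<Longrightarrow> \<sigma> i = \<sigma>' i) \<Longrightarrow> dist \<sigma> \<sigma>' < d"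
      using dist_fun_lt_of_agree[OF d(1)] by blast
    have close: "\<bar>\<phi> \<rho> - \<phi> \<rho>'\<bar> \<le> e / 3" if agree: "\<And>i. i < N \<Longrightarrow> \<rho> i = \<rho>' i" for \<rho> \<rho>'
    proof -
      have "dist \<rho> \<rho>' < d" by (rule N) (rule agree)
      then show ?thesis using d(2) by (simp add: less_imp_le)
    qed
    have "\<bar>(transfer ^^ N) \<phi> \<tau> - (transfer ^^ N) \<phi> \<sigma>\<bar> \<le> e / 3" for \<tau>
      by (rule transfer_power_close) (rule close)
    then have near: "\<bar>(transfer ^^ k) ((transfer ^^ N) \<phi>) \<sigma> - (transfer ^^ N) \<phi> \<sigma>\<bar> \<le> e / 3" for k
      by (rule transfer_power_near)
    have tail: "\<bar>(transfer ^^ n) \<phi> \<sigma> - (transfer ^^ N) \<phi> \<sigma>\<bar> \<le> e / 3" if "n \<ge> N" for n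
    proof -
      have "(transfer ^^ n) \<phi> = (transfer ^^ (n - N)) ((transfer ^^ N) \<phi>)"
        using that by (metis comp_apply funpow_add le_add_diff_inverse2)
      then show ?thesis using near by simp
    qed
    have "dist ((transfer ^^ n) \<phi> \<sigma>) ((transfer ^^ k) \<phi> \<sigma>) < e" if "n \<ge> N" "k \<ge> N" for n k
      using tail[OF that(1)] tail[OF that(2)] e unfolding dist_real_def by linarith
    then show "\<exists>M. \<forall>n\<ge>M. \<forall>k\<ge>M. dist ((transfer ^^ n) \<phi> \<sigma>) ((transfer ^^ k) \<phi> \<sigma>) < e"
      by blast
  qed
  then show ?thesis by (simp add: Cauchy_convergent_iff)
qed

lemma transfer_power_add: "(transfer ^^ n) (\<phi> + \<psi>) = (transfer ^^ n) \<phi> + (transfer ^^ n) \<psi>"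
  by (induction n) (auto simp: transfer_add)

lemma transfer_power_scaleR: "(transfer ^^ n) (c *\<^sub>R \<phi>) = c *\<^sub>R (transfer ^^ n) \<phi>"
  by (induction n) (auto simp: transfer_scaleR)

lemma transfer_power_nonneg:
  fixes \<phi> :: "'a cfun"
  assumes "\<And>\<sigma>. 0 \<le> \<phi> \<sigma>"
  shows "0 \<le> (transfer ^^ n) \<phi> \<sigma>"
proof (induction n arbitrary: \<sigma>)
  case (Suc n)
  then have "transfer (const_bcontfun 0) \<sigma> \<le> transfer ((transfer ^^ n) \<phi>) \<sigma>"
    by (intro transfer_mono) (simp add: const_bcontfun.rep_eq)
  then show ?case
    unfolding transfer_const by (simp add: const_bcontfun.rep_eq)
qed (use assms in simp)

text \<open>The limits of the iterates at an arbitrary base point are the integrals against the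
  product measure with factors \<open>m\<close>; taking limits spares the construction of that
  measure.\<close>

lemma transfer_invariant_functional:
  obtains \<Lambda> :: "'a cdual" where "\<Lambda> \<in> inv_functionals" "\<And>\<phi>. \<Lambda> (transfer \<phi>) = \<Lambda> \<phi>"
proof -
  fix \<sigma>0 :: "nat \<Rightarrow> 'a"
  define l where "l \<phi> = lim (\<lambda>n. (transfer ^^ n) \<phi> \<sigma>0)" for \<phi>
  have lim: "(\<lambda>n. (transfer ^^ n) \<phi> \<sigma>0) \<longlonglongrightarrow> l \<phi>" for \<phi>
    using transfer_power_convergent unfolding l_def by (simp add: convergent_LIMSEQ_iff)
  define F where "F n = Blinfun (\<lambda>\<phi>. (transfer ^^ n) \<phi> \<sigma>0)" for n
  have le: "norm ((transfer ^^ n) \<phi> \<sigma>0) \<le> norm \<phi> * 1" for n \<phi>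
    using transfer_power_near[of \<phi> 0 "norm \<phi>" n \<sigma>0] abs_bcontfun_le_norm[of \<phi>] by simp
  have F: "blinfun_apply (F n) \<phi> = (transfer ^^ n) \<phi> \<sigma>0" for n \<phi>
    unfolding F_def
    by (subst bounded_linear_Blinfun_apply)
      (auto intro!: bounded_linear_intro[OF _ _ le] simp: transfer_power_add transfer_power_scaleR)
  have norm_F: "norm (F n) \<le> 1" for n
    using le by (intro norm_blinfun_bound) (auto simp: F)
  have lim_F: "(\<lambda>n. F n \<phi>) \<longlonglongrightarrow> l \<phi>" for \<phi>
    using lim by (simp add: F)
  obtain \<Lambda> :: "'a cdual" where \<Lambda>: "\<And>\<phi>. \<Lambda> \<phi> = l \<phi>"
    using pointwise_limit_blinfun[OF norm_F lim_F] by blast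
  have transfer: "\<Lambda> (transfer \<phi>) = \<Lambda> \<phi>" for \<phi>
  proof -
    have "(\<lambda>n. (transfer ^^ n) (transfer \<phi>) \<sigma>0) \<longlonglongrightarrow> l \<phi>"
      using LIMSEQ_Suc[OF lim[of \<phi>]] by (simp add: funpow_swap1)
    then show ?thesis using lim LIMSEQ_unique by (auto simp: \<Lambda>)
  qed
  have "\<Lambda> \<in> inv_functionals"
    unfolding inv_functionals_iff
  proof (intro conjI allI impI)
    fix \<phi> :: "'a cfun" assume "\<forall>\<sigma>. 0 \<le> \<phi> \<sigma>"
    then show "0 \<le> \<Lambda> \<phi>"
      unfolding \<Lambda> by (intro LIMSEQ_le_const[OF lim]) (auto intro: transfer_power_nonneg)
  next
    have "(transfer ^^ n) (const_bcontfun 1) = const_bcontfun 1" for n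
      by (induction n) (auto simp: transfer_const)
    then show "\<Lambda> (const_bcontfun 1) = 1"
      using lim[of "const_bcontfun 1"] by (simp add: \<Lambda> const_bcontfun.rep_eq LIMSEQ_const_iff)
  next
    show "\<Lambda> (shift_cf \<phi>) = \<Lambda> \<phi>" for \<phi>
      using transfer[of "shift_cf \<phi>"] by (simp add: transfer_shift)
  qed
  then show ?thesis using transfer by (rule that)
qed

text \<open>The witness is the product measure; its entropy is nonnegative by Jensen's inequality.\<close>

lemma entropy_nonneg_point:
  obtains \<Lambda> :: "'a cdual" where "\<Lambda> \<in> inv_functionals" "0 \<le> entropy_h m \<Lambda>"
proof -
  obtain \<Lambda> :: "'a cdual" where \<Lambda>: "\<Lambda> \<in> inv_functionals" "\<And>\<phi>. \<Lambda> (transfer \<phi>) = \<Lambda> \<phi>"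
    using transfer_invariant_functional by blast
  interpret prob_space m by (rule prob_m)
  have "0 \<le> \<Lambda> (log_ratio \<phi>)" if "\<forall>\<sigma>. 0 < apply_bcontfun \<phi> \<sigma>" for \<phi> :: "'a cfun"
  proof -
    have pos: "0 < \<phi> \<sigma>" for \<sigma> using that by blast
    define \<psi> where "\<psi> = Bcontfun (\<lambda>\<sigma>. ln (\<phi> \<sigma>))"
    have "continuous_on UNIV (\<lambda>\<sigma>. ln (\<phi> \<sigma>))"
      using pos by (intro continuous_on_ln continuous_on_apply_bcontfun) (metis less_irrefl)
    then have \<psi>: "\<psi> \<sigma> = ln (\<phi> \<sigma>)" for \<sigma>
      by (simp add: \<psi>_def apply_Bcont)
    \<comment> \<open>A functional fixed by \<open>transfer\<close> vanishes on
      \<open>transfer \<psi> - \<psi>\<close>, so this pointwise bound is enough. It comes from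
      integrating the tangent of \<open>ln\<close> at \<open>?L\<close>, the mean of
      \<open>\<phi>\<close> over the prepended letter.\<close>
    have "(transfer \<psi> - \<psi>) \<sigma> \<le> log_ratio \<phi> \<sigma>" for \<sigma>
    proof -
      let ?L = "transfer \<phi> \<sigma>"
      have L: "0 < ?L" by (rule transfer_pos[OF pos])
      have "\<psi> (case_nat \<omega> \<sigma>) \<le> ln ?L + (\<phi> (case_nat \<omega> \<sigma>) / ?L - 1)" for \<omega>
        using ln_le_minus_one[of "\<phi> (case_nat \<omega> \<sigma>) / ?L"] pos[of "case_nat \<omega> \<sigma>"] L
        by (simp add: \<psi> ln_div)
      then have "transfer_op m \<psi> \<sigma> \<le> (\<integral>\<omega>. ln ?L + (\<phi> (case_nat \<omega> \<sigma>) / ?L - 1) \<partial>m)"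
        unfolding transfer_op_def
        by (intro integral_mono integrable_append Bochner_Integration.integrable_add
            Bochner_Integration.integrable_diff Bochner_Integration.integrable_divide) auto
      also have "\<dots> = ln ?L"
        using L by (simp add: integrable_append prob_space)
          (simp add: apply_transfer transfer_op_def)
      finally show ?thesis
        using L pos[of \<sigma>] by (simp add: apply_log_ratio[OF pos] ln_div \<psi> apply_transfer[symmetric])
    qed
    then have "\<Lambda> (transfer \<psi> - \<psi>) \<le> \<Lambda> (log_ratio \<phi>)"
      by (rule inv_mono[OF \<Lambda>(1)])
    then show ?thesis using \<Lambda>(2) by (simp add: blinfun.diff_right)
  qed
  then have "ereal 0 \<le> entropy_h m \<Lambda>"
    unfolding entropy_ge_iff[OF \<Lambda>(1)] by blast
  then show ?thesis using \<Lambda>(1) that by (simp add: zero_ereal_def)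
qed

text \<open>Real lower bounds \<open>c\<close> and \<open>d\<close> replace the two entropies, so
  that no arithmetic with \<open>-\<infinity>\<close> occurs.\<close>

lemma entropy_concave:
  assumes "\<mu> \<in> inv_functionals" "\<nu> \<in> inv_functionals" "ereal c \<le> entropy_h m \<mu>" "ereal d \<le> entropy_h m \<nu>"
    and uv: "0 \<le> u" "0 \<le> v" "u + v = 1"
  shows "ereal (u * c + v * d) \<le> entropy_h m (u *\<^sub>R \<mu> + v *\<^sub>R \<nu>)"
proof -
  have "u *\<^sub>R \<mu> + v *\<^sub>R \<nu> \<in> inv_functionals"
    using inv_convex assms by (auto simp: convex_def)
  then show ?thesis
    using assms by (auto simp: entropy_ge_iff blinfun.add_left blinfun.scaleR_left
        intro!: add_mono mult_left_mono)
qed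

text \<open>Each evaluation at a \<open>log_ratio\<close> passes to the limit. The convergent real
  bounds \<open>c n\<close> stand in for an upper limit of entropies.\<close>

lemma entropy_usc:
  fixes F :: "nat \<Rightarrow> 'a cdual"
  assumes F: "\<And>n. F n \<in> inv_functionals" and lim: "\<And>\<phi>. (\<lambda>n. F n \<phi>) \<longlonglongrightarrow> blinfun_apply \<mu> \<phi>"
    and ge: "\<And>n. ereal (c n) \<le> entropy_h m (F n)" and c: "c \<longlonglongrightarrow> c'"
  shows "ereal c' \<le> entropy_h m \<mu>"
proof -
  have "\<mu> \<in> inv_functionals" using F lim by (rule inv_closed)
  moreover have "c' \<le> \<mu> (log_ratio \<phi>)" if "\<forall>\<sigma>. 0 < apply_bcontfun \<phi> \<sigma>" for \<phi> :: "'a cfun"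
    using ge that F by (intro LIMSEQ_le[OF c lim[of "log_ratio \<phi>"]]) (auto simp: entropy_ge_iff)
  ultimately show ?thesis by (simp add: entropy_ge_iff)
qed

end

text \<open>Otherwise there are \<open>f n\<close> with
  \<open>norm (\<theta> (f n)) > (n + 1) * norm (f n)\<close>. Scaled to norm
  \<open>1 / (n + 1)\<close> they tend to \<open>0\<close> pointwise and boundedly, while their
  images keep norm at least \<open>1\<close>. Boundedness makes \<open>onorm \<theta>\<close> the
  operator norm it is meant to be.\<close>

lemma sigma_normal_bounded_linear:
  fixes \<theta> :: "'a::metric_space bmfun \<Rightarrow> 'x::real_normed_vector"
  assumes lin: "linear \<theta>" and normal: "sigma_normal \<theta>"
  shows "bounded_linear \<theta>"
proof -
  have "\<exists>K. \<forall>f. norm (\<theta> f) \<le> norm f * K"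
  proof (rule ccontr)
    assume "\<not> ?thesis"
    then have "\<exists>f. norm f * real (Suc n) < norm (\<theta> f)" for n by (meson not_le)
    then obtain f where f: "\<And>n. norm (f n) * real (Suc n) < norm (\<theta> (f n))" by metis
    have pos: "0 < norm (f n)" for n
      using f[of n] linear_0[OF lin] by (cases "f n = 0") auto
    define g where "g n = (1 / (real (Suc n) * norm (f n))) *\<^sub>R f n" for n
    have norm_g: "norm (g n) = 1 / real (Suc n)" for n
      using pos[of n] by (simp add: g_def)
    have "norm (g n) \<le> 1" for n by (simp add: norm_g)
    then have "bounded (range g)" by (auto simp: bounded_iff)
    moreover have "(\<lambda>n. apply_bmfun (g n) \<phi>) \<longlonglongrightarrow> apply_bmfun 0 \<phi>" if "\<phi> \<in> unit_ball" for \<phi>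
    proof (rule Lim_null_comparison[of _ "\<lambda>n. 1 / real (Suc n)", THEN tendsto_eq_rhs])
      show "\<forall>\<^sub>F n in sequentially. norm (apply_bmfun (g n) \<phi>) \<le> 1 / real (Suc n)"
        using abs_apply_bmfun_le_norm[OF that, of "g _"] by (simp add: norm_g)
      show "(\<lambda>n. 1 / real (Suc n)) \<longlonglongrightarrow> 0"
        using LIMSEQ_inverse_real_of_nat by (simp add: inverse_eq_divide)
    qed (simp add: zero_bmfun.rep_eq)
    ultimately have "(\<lambda>n. \<theta> (g n)) \<longlonglongrightarrow> \<theta> 0"
      using normal unfolding sigma_normal_def by blast
    then have "(\<lambda>n. norm (\<theta> (g n))) \<longlonglongrightarrow> 0"
      using linear_0[OF lin] tendsto_norm_zero by fastforce
    moreover have "1 \<le> norm (\<theta> (g n))" for n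
    proof -
      have "norm (\<theta> (g n)) = norm (\<theta> (f n)) / (real (Suc n) * norm (f n))"
        using pos[of n] by (simp add: g_def linear_scale[OF lin])
      then show ?thesis
        using f[of n] pos[of n] by (simp add: le_divide_eq mult.commute)
    qed
    ultimately have "(1::real) \<le> 0" by (intro LIMSEQ_le_const) auto
    then show False by simp
  qed
  then show ?thesis
    using lin by (auto simp: bounded_linear_def bounded_linear_axioms_def)
qed

lemma restr_S_linear: "linear (restr_S :: 'a::metric_space cdual \<Rightarrow> 'a bmfun)"
  by (rule linearI; rule bmfun_eqI)
    (simp_all add: restr_S.rep_eq plus_bmfun.rep_eq scaleR_bmfun.rep_eq blinfun.add_left blinfun.scaleR_left)

lemma norm_restr_S_le:
  fixes \<mu> :: "'a::metric_space cdual"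
  shows "norm (restr_S \<mu>) \<le> norm \<mu>"
proof (rule norm_bmfun_le)
  fix \<phi> :: "'a cfun" assume \<phi>: "\<phi> \<in> unit_ball"
  have "\<bar>\<mu> \<phi>\<bar> \<le> norm \<mu> * norm \<phi>" using norm_blinfun[of \<mu> \<phi>] by simp
  also have "\<dots> \<le> norm \<mu> * 1" using \<phi> by (intro mult_left_mono) (auto simp: unit_ball_def)
  finally show "\<bar>apply_bmfun (restr_S \<mu>) \<phi>\<bar> \<le> norm \<mu>" using \<phi> by (simp add: restr_S.rep_eq)
qed

lemma sigma_normal_restr_S_tendsto:
  fixes F :: "nat \<Rightarrow> 'a::metric_space cdual"
  assumes normal: "sigma_normal \<theta>" and bound: "\<And>n. norm (F n) \<le> B"
    and lim: "\<And>\<phi>. (\<lambda>n. F n \<phi>) \<longlonglongrightarrow> blinfun_apply \<mu> \<phi>"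
  shows "(\<lambda>n. \<theta> (restr_S (F n))) \<longlonglongrightarrow> \<theta> (restr_S \<mu>)"
proof -
  have "norm (restr_S (F n)) \<le> B" for n using norm_restr_S_le[of "F n"] bound[of n] by simp
  then have "bounded (range (\<lambda>n. restr_S (F n)))" by (auto simp: bounded_iff)
  then show ?thesis
    using normal lim by (auto simp: sigma_normal_def restr_S.rep_eq)
qed

section \<open>Duality for the nonlinear pressure\<close>

lemma convex_bounded_continuous:
  fixes g :: "'v::real_normed_vector \<Rightarrow> real"
  assumes conv: "convex_on UNIV g" and bounded: "bounded_on_bounded_sets g"
  shows "continuous_on UNIV g"
proof -
  have "continuous (at x) g" for x
  proof -
    have "bounded (g ` ball x 1)" using bounded bounded_ball by (auto simp: bounded_on_bounded_sets_def)
    then obtain b where "\<forall>z\<in>ball x 1. \<bar>g z\<bar> \<le> b" by (auto simp: bounded_iff)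
    then have "continuous_on (ball x 1) g"
      using convex_on_subset[OF conv, of "ball x 1"] by (intro convex_on_bounded_continuous) auto
    then show ?thesis by (simp add: continuous_on_eq_continuous_at)
  qed
  then show ?thesis by (simp add: continuous_at_imp_continuous_on)
qed

text \<open>With \<open>t = norm z\<close> and \<open>u\<close> the unit vector along
  \<open>z\<close>, the point \<open>x\<close> is the mean of \<open>x + z\<close> and
  \<open>x - u\<close> with weights \<open>1 / (1 + t)\<close> and \<open>t / (1 + t)\<close>. As
  \<open>g\<close> is bounded by \<open>b\<close> in absolute value on the unit ball about
  \<open>x\<close>, convexity keeps \<open>g\<close> above a cone of slope \<open>2 * b\<close> with
  apex at \<open>x\<close>.\<close>

lemma convex_bounded_subdiff_nonempty:
  fixes g :: "'v::real_normed_vector \<Rightarrow> real"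
  assumes conv: "convex_on UNIV g" and bounded: "bounded_on_bounded_sets g"
  obtains y where "y \<in> subdiff g x"
proof -
  have "bounded (g ` cball x 1)" using bounded bounded_cball by (auto simp: bounded_on_bounded_sets_def)
  then obtain b where "\<forall>z\<in>cball x 1. \<bar>g z\<bar> \<le> b" by (auto simp: bounded_iff)
  then have b: "\<And>z. z \<in> cball x 1 \<Longrightarrow> \<bar>g z\<bar> \<le> b" by blast
  have "g x - 2 * b * norm z \<le> g (x + z)" for z
  proof (cases "z = 0")
    case False
    define t where "t = norm z"
    have t: "t > 0" using False by (simp add: t_def)
    define u where "u = (1 / t) *\<^sub>R z"
    have u: "t *\<^sub>R u = z" "norm u = 1" using t by (auto simp: u_def t_def)
    have "(1 / (1 + t)) *\<^sub>R (x + z) + (t / (1 + t)) *\<^sub>R (x - u) = (1 / (1 + t)) *\<^sub>R ((x + z) + t *\<^sub>R (x - u))"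
      using t by (simp add: scaleR_add_right)
    also have "(x + z) + t *\<^sub>R (x - u) = (1 + t) *\<^sub>R x"
      by (simp add: u algebra_simps)
    finally have "x = (1 / (1 + t)) *\<^sub>R (x + z) + (t / (1 + t)) *\<^sub>R (x - u)"
      using t by simp
    moreover have "1 / (1 + t) + t / (1 + t) = 1" using t by (simp add: add_divide_distrib[symmetric])
    ultimately have "g x \<le> 1 / (1 + t) * g (x + z) + t / (1 + t) * g (x - u)"
      using conv t unfolding convex_on_def by (metis UNIV_I divide_nonneg_nonneg add_nonneg_nonneg
          less_imp_le zero_le_one)
    then have "(1 + t) * g x \<le> (1 + t) * (1 / (1 + t) * g (x + z) + t / (1 + t) * g (x - u))"
      using t by (intro mult_left_mono) auto
    also have "\<dots> = g (x + z) + t * g (x - u)"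
      using t by (simp add: distrib_left)
    finally have "g x - t * (g (x - u) - g x) \<le> g (x + z)" by (simp add: algebra_simps)
    moreover have "t * (g (x - u) - g x) \<le> t * (2 * b)"
      using t b[of "x - u"] b[of x] u by (intro mult_left_mono) (auto simp: dist_norm abs_le_iff)
    ultimately show ?thesis by (simp add: t_def mult.commute mult.left_commute)
  qed simp
  from convex_lower_cone[OF conv this] obtain y :: "'v \<Rightarrow>\<^sub>L real"
    where y: "\<And>z. g x + blinfun_apply y z \<le> g (x + z)" by blast
  have "y \<in> subdiff g x"
    unfolding subdiff_def using y[of "_ - x"] by (auto simp: le_diff_eq add.commute)
  then show ?thesis by (rule that)
qed

lemma fenchel_young: "ereal (blinfun_apply y x - g x) \<le> conjugate g y"
  unfolding conjugate_def by (rule SUP_upper) simp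

lemma conjugate_le_iff: "conjugate g y \<le> ereal c \<longleftrightarrow> (\<forall>x. blinfun_apply y x - g x \<le> c)"
  by (simp add: conjugate_def SUP_le_iff)

text \<open>The equality case of Fenchel--Young; the opposite inequality is
  \<open>fenchel_young\<close>.\<close>

lemma subdiff_iff_conjugate: "y \<in> subdiff g x \<longleftrightarrow> conjugate g y \<le> ereal (blinfun_apply y x - g x)"
  by (auto simp: subdiff_def conjugate_le_iff blinfun.diff_right algebra_simps)

text \<open>Difference quotients from the right bound every subgradient by the Gateaux derivative in
  each direction; the directions \<open>v\<close> and \<open>- v\<close> together force
  equality.\<close>

lemma gateaux_subdiff_unique:
  assumes diff: "gateaux_differentiable g" and y: "y \<in> subdiff g x" and y': "y' \<in> subdiff g x"
  shows "y = y'"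
proof -
  obtain D :: "'a \<Rightarrow>\<^sub>L real" where D: "\<And>v. ((\<lambda>t. (g (x + t *\<^sub>R v) - g x) / t) \<longlongrightarrow> blinfun_apply D v) (at 0)"
    using diff unfolding gateaux_differentiable_def by blast
  have le: "blinfun_apply z v \<le> blinfun_apply D v" if z: "z \<in> subdiff g x" for z v
  proof (rule tendsto_lowerbound)
    show "((\<lambda>t. (g (x + t *\<^sub>R v) - g x) / t) \<longlongrightarrow> blinfun_apply D v) (at_right 0)"
      using D by (rule tendsto_mono[rotated]) (simp add: at_le)
    show "\<forall>\<^sub>F t in at_right 0. blinfun_apply z v \<le> (g (x + t *\<^sub>R v) - g x) / t"
      using eventually_at_right_less[of 0]
    proof eventually_elim
      case (elim t)
      have "blinfun_apply z (x + t *\<^sub>R v - x) \<le> g (x + t *\<^sub>R v) - g x"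
        using z unfolding subdiff_def by blast
      then show ?case using elim by (simp add: blinfun.scaleR_right le_divide_eq mult.commute)
    qed
  qed simp
  have eq: "z = D" if z: "z \<in> subdiff g x" for z
  proof (rule blinfun_eqI)
    fix v
    show "blinfun_apply z v = blinfun_apply D v"
      using le[OF z, of v] le[OF z, of "- v"] by (simp add: blinfun.minus_right)
  qed
  show ?thesis using eq[OF y] eq[OF y'] by simp
qed

lemma minimal_linear_growthD:
  assumes "minimal_linear_growth G l"
  obtains R where "\<And>y. R < norm y \<Longrightarrow> ereal (l * norm y) - G y < ereal b"
proof -
  have "\<forall>\<^sub>F R in at_top. (SUP y\<in>{y. \<not> norm y \<le> R}. ereal (l * norm y) - G y) < ereal b"
    using assms unfolding minimal_linear_growth_def by (rule order_tendstoD) simp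
  then obtain R where "(SUP y\<in>{y. \<not> norm y \<le> R}. ereal (l * norm y) - G y) < ereal b"
    unfolding eventually_at_top_linorder by blast
  then have "ereal (l * norm y) - G y < ereal b" if "R < norm y" for y
    using that SUP_upper[of y "{y. \<not> norm y \<le> R}" "\<lambda>y. ereal (l * norm y) - G y"]
    by (auto simp: not_le intro: le_less_trans)
  then show ?thesis by (rule that)
qed

abbreviation wlim :: "(nat \<Rightarrow> 'v::real_normed_vector \<Rightarrow>\<^sub>L real) \<Rightarrow> ('v \<Rightarrow>\<^sub>L real) \<Rightarrow> bool" where
  "wlim F \<mu> \<equiv> \<forall>\<phi>. (\<lambda>n. blinfun_apply (F n) \<phi>) \<longlonglongrightarrow> blinfun_apply \<mu> \<phi>"

locale nonlinear_pressure = symbolic m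
  for m :: "'a::metric_space measure" +
  fixes \<theta>p :: "'a bmfun \<Rightarrow> 'x::real_normed_vector"
    and \<theta>m :: "'a bmfun \<Rightarrow> 'y::real_normed_vector"
    and gp :: "'x \<Rightarrow> real"
    and gm :: "'y \<Rightarrow> real"
  assumes theta_p: "linear \<theta>p" "sigma_normal \<theta>p"
    and theta_m: "linear \<theta>m" "sigma_normal \<theta>m"
    and gm_lsc: "lower_semicont gm" and gm_convex: "convex_on UNIV gm"
    and gm_growth: "minimal_linear_growth (conjugate gm) (onorm \<theta>m)"
    and gp_convex: "convex_on UNIV gp" and gp_bounded: "bounded_on_bounded_sets gp"
    and gp_conj_real: "range (conjugate gp) \<subseteq> range ereal"
begin

section \<open>Finite entropy and lower semicontinuous costs\<close>

abbreviation tp :: "'a cdual \<Rightarrow> 'x" where "tp \<mu> \<equiv> \<theta>p (restr_S \<mu>)"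
abbreviation tm :: "'a cdual \<Rightarrow> 'y" where "tm \<mu> \<equiv> \<theta>m (restr_S \<mu>)"

text \<open>\<open>real_of_ereal\<close> sends \<open>-\<infinity>\<close> to \<open>0\<close>, so
  \<open>\<eta>\<close> is the entropy on \<open>ent_dom\<close> only.\<close>

definition \<eta> :: "'a cdual \<Rightarrow> real" where
  "\<eta> \<mu> = real_of_ereal (entropy_h m \<mu>)"

definition ent_dom :: "'a cdual set" where
  "ent_dom = {\<mu> \<in> inv_functionals. entropy_h m \<mu> \<noteq> -\<infinity>}"

lemma ent_dom_inv: "\<mu> \<in> ent_dom \<Longrightarrow> \<mu> \<in> inv_functionals"
  by (simp add: ent_dom_def)

lemma entropy_ent_dom: "\<mu> \<in> ent_dom \<Longrightarrow> entropy_h m \<mu> = ereal (\<eta> \<mu>)"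
  using entropy_le_0[of \<mu>] by (cases "entropy_h m \<mu>") (auto simp: ent_dom_def \<eta>_def)

lemma \<eta>_le_0: "\<mu> \<in> ent_dom \<Longrightarrow> \<eta> \<mu> \<le> 0"
  using entropy_le_0[of \<mu>] entropy_ent_dom[of \<mu>] by (simp add: ent_dom_inv)

lemma \<eta>_geI:
  assumes "\<mu> \<in> inv_functionals" "ereal c \<le> entropy_h m \<mu>"
  shows "\<mu> \<in> ent_dom" "c \<le> \<eta> \<mu>"
proof -
  show ent_dom: "\<mu> \<in> ent_dom" using assms by (auto simp: ent_dom_def)
  show "c \<le> \<eta> \<mu>" using assms entropy_ent_dom[OF ent_dom] by simp
qed

lemma ent_dom_nonempty: "ent_dom \<noteq> {}"
proof -
  obtain \<Lambda> :: "'a cdual" where "\<Lambda> \<in> inv_functionals" "0 \<le> entropy_h m \<Lambda>"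
    by (rule entropy_nonneg_point)
  then show ?thesis using \<eta>_geI(1)[of \<Lambda> 0] by (auto simp flip: zero_ereal_def)
qed

lemma \<eta>_concave:
  assumes "\<mu> \<in> ent_dom" "\<nu> \<in> ent_dom" "0 \<le> u" "0 \<le> v" "u + v = 1"
  shows "u *\<^sub>R \<mu> + v *\<^sub>R \<nu> \<in> ent_dom" "u * \<eta> \<mu> + v * \<eta> \<nu> \<le> \<eta> (u *\<^sub>R \<mu> + v *\<^sub>R \<nu>)"
proof -
  have "ereal (u * \<eta> \<mu> + v * \<eta> \<nu>) \<le> entropy_h m (u *\<^sub>R \<mu> + v *\<^sub>R \<nu>)"
    using assms by (intro entropy_concave) (auto simp: ent_dom_inv entropy_ent_dom)
  moreover have "u *\<^sub>R \<mu> + v *\<^sub>R \<nu> \<in> inv_functionals"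
    using assms inv_convex by (auto simp: ent_dom_inv convex_def)
  ultimately show "u *\<^sub>R \<mu> + v *\<^sub>R \<nu> \<in> ent_dom" "u * \<eta> \<mu> + v * \<eta> \<nu> \<le> \<eta> (u *\<^sub>R \<mu> + v *\<^sub>R \<nu>)"
    using \<eta>_geI by blast+
qed

lemma \<eta>_usc:
  assumes F: "\<And>n. F n \<in> ent_dom" and lim: "wlim F \<mu>" and ge: "\<And>n. c n \<le> \<eta> (F n)" and c: "c \<longlonglongrightarrow> c'"
  shows "\<mu> \<in> ent_dom" "c' \<le> \<eta> \<mu>"
proof -
  have inv: "F n \<in> inv_functionals" for n using F by (rule ent_dom_inv)
  have "\<mu> \<in> inv_functionals" by (rule inv_closed[of F, OF inv]) (use lim in blast)
  moreover have c_le: "ereal (c n) \<le> entropy_h m (F n)" for n using ge[of n] by (simp add: entropy_ent_dom[OF F])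
  have "ereal c' \<le> entropy_h m \<mu>"
    by (rule entropy_usc[of F, OF inv _ c_le c]) (use lim in blast)
  ultimately show "\<mu> \<in> ent_dom" "c' \<le> \<eta> \<mu>" using \<eta>_geI by blast+
qed

lemma inv_subseq:
  fixes F :: "nat \<Rightarrow> 'a cdual"
  assumes "\<And>n::nat. F n \<in> inv_functionals"
  obtains r :: "nat \<Rightarrow> nat" and \<mu> where "strict_mono r" "\<mu> \<in> inv_functionals" "wlim (\<lambda>n. F (r n)) \<mu>"
  by (rule inv_seq_compact[of F, OF assms]) (use that in blast)

lemma tp_tendsto: "(\<And>n. F n \<in> inv_functionals) \<Longrightarrow> wlim F \<mu> \<Longrightarrow> (\<lambda>n. tp (F n)) \<longlonglongrightarrow> tp \<mu>"
  by (rule sigma_normal_restr_S_tendsto[OF theta_p(2), of F 1]) (auto intro: inv_norm)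

lemma tm_tendsto: "(\<And>n. F n \<in> inv_functionals) \<Longrightarrow> wlim F \<mu> \<Longrightarrow> (\<lambda>n. tm (F n)) \<longlonglongrightarrow> tm \<mu>"
  by (rule sigma_normal_restr_S_tendsto[OF theta_m(2), of F 1]) (auto intro: inv_norm)

lemma tp_combination: "tp (u *\<^sub>R \<mu> + v *\<^sub>R \<nu>) = u *\<^sub>R tp \<mu> + v *\<^sub>R tp \<nu>"
  by (simp add: linear_add linear_scale restr_S_linear theta_p(1))

lemma tm_combination: "tm (u *\<^sub>R \<mu> + v *\<^sub>R \<nu>) = u *\<^sub>R tm \<mu> + v *\<^sub>R tm \<nu>"
  by (simp add: linear_add linear_scale restr_S_linear theta_m(1))

text \<open>Invariant functionals have norm at most \<open>1\<close>, and restriction to the unit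
  ball does not increase it. For this reason \<open>onorm \<theta>m\<close> is the threshold in the
  growth condition on the conjugate of \<open>gm\<close>.\<close>

lemma norm_tm_le:
  assumes "\<mu> \<in> inv_functionals"
  shows "norm (tm \<mu>) \<le> onorm \<theta>m"
proof -
  have bl: "bounded_linear \<theta>m" using theta_m by (rule sigma_normal_bounded_linear)
  have "norm (tm \<mu>) \<le> onorm \<theta>m * norm (restr_S \<mu>)" by (rule onorm[OF bl])
  also have "\<dots> \<le> onorm \<theta>m * 1"
    using norm_restr_S_le[of \<mu>] inv_norm[OF assms] onorm_pos_le[OF bl] by (intro mult_left_mono) auto
  finally show ?thesis by simp
qed

definition seq_lsc :: "('a cdual \<Rightarrow> real) \<Rightarrow> bool" where
  "seq_lsc G \<longleftrightarrow> (\<forall>F \<mu> a. range F \<subseteq> inv_functionals \<longrightarrow> wlim F \<mu> \<longrightarrow> a < G \<mu> \<longrightarrow> (\<forall>\<^sub>F n in sequentially. a < G (F n)))"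

lemma seq_lsc_gm: "seq_lsc (\<lambda>\<mu>. gm (tm \<mu> + z))"
  unfolding seq_lsc_def
proof (intro allI impI)
  fix F :: "nat \<Rightarrow> 'a cdual" and \<mu> a
  assume F: "range F \<subseteq> inv_functionals" "wlim F \<mu>" and a: "a < gm (tm \<mu> + z)"
  have "(\<lambda>n. tm (F n) + z) \<longlonglongrightarrow> tm \<mu> + z"
    using F by (intro tendsto_intros tm_tendsto) auto
  moreover have "\<forall>\<^sub>F y in nhds (tm \<mu> + z). a < gm y"
    using gm_lsc a unfolding lower_semicont_def by blast
  ultimately show "\<forall>\<^sub>F n in sequentially. a < gm (tm (F n) + z)"
    by (rule eventually_compose_filterlim[rotated])
qed

lemma seq_lsc_diff:
  assumes G: "seq_lsc G"
    and C: "\<And>F \<mu>. (\<And>n::nat. F n \<in> inv_functionals) \<Longrightarrow> wlim F \<mu> \<Longrightarrow> (\<lambda>n. C (F n)) \<longlonglongrightarrow> C \<mu>"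
  shows "seq_lsc (\<lambda>\<mu>. G \<mu> - C \<mu>)"
  unfolding seq_lsc_def
proof (intro allI impI)
  fix F :: "nat \<Rightarrow> 'a cdual" and \<mu> a
  assume F: "range F \<subseteq> inv_functionals" "wlim F \<mu>" and a: "a < G \<mu> - C \<mu>"
  define e where "e = (G \<mu> - C \<mu> - a) / 2"
  have "\<forall>\<^sub>F n in sequentially. G \<mu> - e < G (F n)"
    using G F a unfolding seq_lsc_def by (auto simp: e_def)
  moreover have "\<forall>\<^sub>F n in sequentially. C (F n) < C \<mu> + e"
    using C[of F \<mu>] F a by (intro order_tendstoD) (auto simp: e_def)
  ultimately show "\<forall>\<^sub>F n in sequentially. a < G (F n) - C (F n)"
    by eventually_elim (simp add: e_def field_simps)
qed

lemma seq_lsc_bounded_below: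
  assumes G: "seq_lsc G"
  obtains b where "\<And>\<mu>. \<mu> \<in> inv_functionals \<Longrightarrow> b \<le> G \<mu>"
proof (rule ccontr)
  assume "\<not> thesis"
  then have "\<exists>\<mu>\<in>inv_functionals. G \<mu> < - real n" for n
    using that[of "- real n"] by (meson not_le)
  then obtain F where F: "\<And>n. F n \<in> inv_functionals" "\<And>n. G (F n) < - real n" by metis
  obtain r \<mu> where r: "strict_mono r" "\<mu> \<in> inv_functionals" "wlim (\<lambda>n. F (r n)) \<mu>"
    using inv_subseq[of F] F(1) by metis
  have "\<forall>\<^sub>F n in sequentially. G \<mu> - 1 < G (F (r n))"
    using G r F(1) unfolding seq_lsc_def by (auto simp: image_subset_iff)
  moreover have "\<forall>\<^sub>F n in sequentially. - (G \<mu> - 1) < real n"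
    using filterlim_real_sequentially by (auto simp: filterlim_at_top_dense)
  ultimately have "\<forall>\<^sub>F n in sequentially. False"
  proof eventually_elim
    case (elim n)
    have "n \<le> r n" using r(1) by (rule seq_suble)
    then show ?case using elim F(2)[of "r n"] by linarith
  qed
  then show False by simp
qed

text \<open>Every \<open>a < G \<mu>\<close> eventually lies below \<open>G (F n)\<close>, which
  gives the lower bound \<open>b n + a\<close> for the entropies and, in the limit,
  \<open>b' + a \<le> \<eta> \<mu>\<close>. In particular the limit again has finite
  entropy.\<close>

lemma usc_limit:
  assumes G: "seq_lsc G" and F: "\<And>n. F n \<in> ent_dom" and lim: "wlim F \<mu>"
    and ge: "\<And>n. b n \<le> \<eta> (F n) - G (F n)" and b: "b \<longlonglongrightarrow> b'"
  shows "\<mu> \<in> ent_dom" "b' \<le> \<eta> \<mu> - G \<mu>"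
proof -
  have *: "\<mu> \<in> ent_dom \<and> b' + a \<le> \<eta> \<mu>" if a: "a < G \<mu>" for a
  proof -
    have "\<forall>\<^sub>F n in sequentially. a < G (F n)"
      using G F lim a ent_dom_inv unfolding seq_lsc_def by (auto simp: image_subset_iff)
    then obtain N where N: "\<And>n. n \<ge> N \<Longrightarrow> a < G (F n)" by (auto simp: eventually_sequentially)
    have "wlim (\<lambda>n. F (n + N)) \<mu>" using lim by (auto intro: LIMSEQ_ignore_initial_segment)
    moreover have "b (n + N) + a \<le> \<eta> (F (n + N))" for n
      using ge[of "n + N"] N[of "n + N"] by simp
    moreover have "(\<lambda>n. b (n + N) + a) \<longlonglongrightarrow> b' + a"
      by (intro tendsto_intros LIMSEQ_ignore_initial_segment b)
    ultimately show ?thesis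
      using \<eta>_usc[of "\<lambda>n. F (n + N)" \<mu> "\<lambda>n. b (n + N) + a" "b' + a"] F by blast
  qed
  show "\<mu> \<in> ent_dom" using *[of "G \<mu> - 1"] by simp
  have "b' + G \<mu> \<le> \<eta> \<mu>"
  proof (rule field_le_epsilon)
    fix e :: real assume "e > 0"
    then show "b' + G \<mu> \<le> \<eta> \<mu> + e" using *[of "G \<mu> - e"] by simp
  qed
  then show "b' \<le> \<eta> \<mu> - G \<mu>" by simp
qed

text \<open>The direct method: \<open>\<eta> \<le> 0\<close> and a lower bound for \<open>G\<close>
  make the supremum finite, and a maximising sequence has a subsequence to which
  \<open>usc_limit\<close> applies.\<close>

lemma maximizer_exists:
  assumes G: "seq_lsc G"
  obtains \<mu> where "\<mu> \<in> ent_dom" "\<And>\<nu>. \<nu> \<in> ent_dom \<Longrightarrow> \<eta> \<nu> - G \<nu> \<le> \<eta> \<mu> - G \<mu>"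
proof -
  obtain b where b: "\<And>\<mu>. \<mu> \<in> inv_functionals \<Longrightarrow> b \<le> G \<mu>" using seq_lsc_bounded_below[OF G] by blast
  define s where "s = (SUP \<mu>\<in>ent_dom. \<eta> \<mu> - G \<mu>)"
  have bdd: "bdd_above ((\<lambda>\<mu>. \<eta> \<mu> - G \<mu>) ` ent_dom)"
  proof (rule bdd_aboveI2)
    show "\<eta> \<mu> - G \<mu> \<le> - b" if "\<mu> \<in> ent_dom" for \<mu>
      using b[OF ent_dom_inv[OF that]] \<eta>_le_0[OF that] by simp
  qed
  have "\<exists>\<mu>\<in>ent_dom. s - 1 / real (Suc n) < \<eta> \<mu> - G \<mu>" for n
    using less_cSUP_iff[OF ent_dom_nonempty bdd, of "s - 1 / real (Suc n)"] by (simp add: s_def)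
  then obtain F where F: "\<And>n. F n \<in> ent_dom" "\<And>n. s - 1 / real (Suc n) < \<eta> (F n) - G (F n)" by metis
  obtain r \<mu> where r: "strict_mono r" "\<mu> \<in> inv_functionals" "wlim (\<lambda>n. F (r n)) \<mu>"
    using inv_subseq[of F] ent_dom_inv[OF F(1)] by metis
  have "(\<lambda>n. 1 / real (Suc n)) \<longlonglongrightarrow> 0"
    using LIMSEQ_inverse_real_of_nat by (simp add: inverse_eq_divide)
  then have "(\<lambda>n. s - 1 / real (Suc n)) \<longlonglongrightarrow> s - 0" by (intro tendsto_intros)
  then have lim: "(\<lambda>n. s - 1 / real (Suc n)) \<longlonglongrightarrow> s" by simp
  have ge: "s - 1 / real (Suc n) \<le> \<eta> (F (r n)) - G (F (r n))" for n
  proof -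
    have "1 / real (Suc (r n)) \<le> 1 / real (Suc n)"
      using seq_suble[OF r(1), of n] by (intro divide_left_mono) auto
    then show ?thesis using F(2)[of "r n"] by linarith
  qed
  have "\<mu> \<in> ent_dom" "s \<le> \<eta> \<mu> - G \<mu>"
    using usc_limit[of G "\<lambda>n. F (r n)", OF G F(1) r(3) ge lim] by auto
  moreover have "\<eta> \<nu> - G \<nu> \<le> s" if "\<nu> \<in> ent_dom" for \<nu>
    unfolding s_def using that bdd by (rule cSUP_upper)
  ultimately show ?thesis using that by (meson order_trans)
qed

lemma apply_tp_tendsto:
  "(\<And>n. F n \<in> inv_functionals) \<Longrightarrow> wlim F \<mu> \<Longrightarrow>
    (\<lambda>n. blinfun_apply y (tp (F n))) \<longlonglongrightarrow> blinfun_apply y (tp \<mu>)"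
  by (intro blinfun.tendsto tendsto_const tp_tendsto)

lemma apply_tm_tendsto:
  "(\<And>n. F n \<in> inv_functionals) \<Longrightarrow> wlim F \<mu> \<Longrightarrow>
    (\<lambda>n. blinfun_apply y (tm (F n))) \<longlonglongrightarrow> blinfun_apply y (tm \<mu>)"
  by (intro blinfun.tendsto tendsto_const tm_tendsto)

section \<open>Perturbed costs and their value function\<close>

lemma seq_lsc_cost: "seq_lsc (\<lambda>\<mu>. gm (tm \<mu> + z) - blinfun_apply y (tp \<mu>))"
  by (rule seq_lsc_diff[OF seq_lsc_gm apply_tp_tendsto])

lemma seq_lsc_cost_0: "seq_lsc (\<lambda>\<mu>. gm (tm \<mu>) - blinfun_apply y (tp \<mu>))"
  using seq_lsc_cost[of 0 y] by simp

text \<open>The value function of the primal problem perturbed by \<open>z\<close>; a subgradient at \<open>0\<close> solves the dual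
  problem.\<close>

definition perturbed :: "('x \<Rightarrow>\<^sub>L real) \<Rightarrow> 'y \<Rightarrow> real" where
  "perturbed y z = (INF \<mu>\<in>ent_dom. gm (tm \<mu> + z) - blinfun_apply y (tp \<mu>) - \<eta> \<mu>)"

lemma perturbed_le:
  assumes "\<mu> \<in> ent_dom"
  shows "perturbed y z \<le> gm (tm \<mu> + z) - blinfun_apply y (tp \<mu>) - \<eta> \<mu>"
proof -
  obtain b where b: "\<And>\<mu>. \<mu> \<in> inv_functionals \<Longrightarrow> b \<le> gm (tm \<mu> + z) - blinfun_apply y (tp \<mu>)"
    using seq_lsc_bounded_below[OF seq_lsc_cost] by blast
  show ?thesis
    unfolding perturbed_def
  proof (rule cINF_lower[OF _ assms], rule bdd_belowI2)
    show "b \<le> gm (tm \<nu> + z) - blinfun_apply y (tp \<nu>) - \<eta> \<nu>" if "\<nu> \<in> ent_dom" for \<nu>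
      using b[OF ent_dom_inv[OF that]] \<eta>_le_0[OF that] by simp
  qed
qed

lemma perturbed_greatest:
  "(\<And>\<mu>. \<mu> \<in> ent_dom \<Longrightarrow> c \<le> gm (tm \<mu> + z) - blinfun_apply y (tp \<mu>) - \<eta> \<mu>) \<Longrightarrow> c \<le> perturbed y z"
  unfolding perturbed_def using ent_dom_nonempty by (rule cINF_greatest)

text \<open>The cost is jointly convex in \<open>\<mu>\<close> and \<open>z\<close>, since
  \<open>\<eta>\<close> is concave and \<open>tm\<close>, \<open>tp\<close> are affine; minimising
  over \<open>\<mu>\<close> keeps convexity in \<open>z\<close>. The infima over
  \<open>\<mu>\<close> and \<open>\<nu>\<close> are taken one after the other, each after division
  by its weight.\<close>

lemma convex_on_perturbed: "convex_on UNIV (perturbed y)"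
proof (rule convex_onI)
  fix t :: real and z w :: 'y assume t: "0 < t" "t < 1"
  let ?c = "\<lambda>\<mu> z. gm (tm \<mu> + z) - blinfun_apply y (tp \<mu>) - \<eta> \<mu>"
  have *: "perturbed y ((1 - t) *\<^sub>R z + t *\<^sub>R w) \<le> (1 - t) * ?c \<mu> z + t * ?c \<nu> w"
    if \<mu>: "\<mu> \<in> ent_dom" and \<nu>: "\<nu> \<in> ent_dom" for \<mu> \<nu>
  proof -
    let ?\<kappa> = "(1 - t) *\<^sub>R \<mu> + t *\<^sub>R \<nu>"
    have \<kappa>: "?\<kappa> \<in> ent_dom" "(1 - t) * \<eta> \<mu> + t * \<eta> \<nu> \<le> \<eta> ?\<kappa>"
      using \<eta>_concave[OF \<mu> \<nu>, of "1 - t" t] t by auto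
    have "tm ?\<kappa> + ((1 - t) *\<^sub>R z + t *\<^sub>R w) = (1 - t) *\<^sub>R (tm \<mu> + z) + t *\<^sub>R (tm \<nu> + w)"
      by (simp add: tm_combination scaleR_add_right)
    then have "gm (tm ?\<kappa> + ((1 - t) *\<^sub>R z + t *\<^sub>R w)) \<le> (1 - t) * gm (tm \<mu> + z) + t * gm (tm \<nu> + w)"
      using convex_onD[OF gm_convex, of t "tm \<mu> + z" "tm \<nu> + w"] t by simp
    moreover have "blinfun_apply y (tp ?\<kappa>) = (1 - t) * blinfun_apply y (tp \<mu>) + t * blinfun_apply y (tp \<nu>)"
      by (simp add: tp_combination blinfun.add_right blinfun.scaleR_right)
    ultimately show ?thesis
      using perturbed_le[OF \<kappa>(1), of y "(1 - t) *\<^sub>R z + t *\<^sub>R w"] \<kappa>(2) by (simp add: algebra_simps)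
  qed
  let ?p = "perturbed y ((1 - t) *\<^sub>R z + t *\<^sub>R w)"
  have "(?p - t * ?c \<nu> w) / (1 - t) \<le> perturbed y z" if "\<nu> \<in> ent_dom" for \<nu>
  proof (rule perturbed_greatest)
    fix \<mu> assume "\<mu> \<in> ent_dom"
    then have "?p - t * ?c \<nu> w \<le> ?c \<mu> z * (1 - t)" using *[OF _ that, of \<mu>] by (simp add: mult.commute)
    then show "(?p - t * ?c \<nu> w) / (1 - t) \<le> ?c \<mu> z" using t by (subst pos_divide_le_eq) auto
  qed
  then have **: "?p - t * ?c \<nu> w \<le> perturbed y z * (1 - t)" if "\<nu> \<in> ent_dom" for \<nu>
    using t that by (simp add: pos_divide_le_eq)
  have "(?p - (1 - t) * perturbed y z) / t \<le> perturbed y w"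
  proof (rule perturbed_greatest)
    fix \<nu> assume "\<nu> \<in> ent_dom"
    then have "?p - (1 - t) * perturbed y z \<le> ?c \<nu> w * t" using **[of \<nu>] by (simp add: mult.commute)
    then show "(?p - (1 - t) * perturbed y z) / t \<le> ?c \<nu> w" using t by (subst pos_divide_le_eq) auto
  qed
  then show "?p \<le> (1 - t) * perturbed y z + t * perturbed y w"
    using t by (simp add: pos_divide_le_eq mult.commute)
qed simp

text \<open>Otherwise some \<open>z n\<close> tend to \<open>0\<close> with functionals
  \<open>F n\<close> of perturbed cost below \<open>a'\<close>. A limit point of the
  \<open>F n\<close> then has unperturbed cost at most \<open>a'\<close>, which is below the
  infimum.\<close>

lemma perturbed_lsc_0:
  assumes "a < perturbed y 0"
  shows "\<exists>r>0. \<forall>z. norm z < r \<longrightarrow> a < perturbed y z"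
proof (rule ccontr)
  assume "\<not> ?thesis"
  then have neg: "\<exists>z. norm z < r \<and> perturbed y z \<le> a" if "r > 0" for r
    using that by (meson not_le)
  \<comment> \<open>The room between \<open>a\<close> and \<open>a'\<close> lets an infimum that is
    at most \<open>a\<close> yield a functional of cost strictly below \<open>a'\<close>, attained
    or not.\<close>
  obtain a' where a': "a < a'" "a' < perturbed y 0" using dense[OF assms] by blast
  have "\<exists>z \<mu>. norm z < 1 / real (Suc n) \<and> \<mu> \<in> ent_dom \<and> gm (tm \<mu> + z) - blinfun_apply y (tp \<mu>) - \<eta> \<mu> < a'" for n
  proof -
    obtain z where z: "norm z < 1 / real (Suc n)" "perturbed y z \<le> a"
      using neg[of "1 / real (Suc n)"] by auto
    have "\<not> a' \<le> perturbed y z" using z a' by simp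
    then obtain \<mu> where "\<mu> \<in> ent_dom" "\<not> a' \<le> gm (tm \<mu> + z) - blinfun_apply y (tp \<mu>) - \<eta> \<mu>"
      using perturbed_greatest[of a' z y] by blast
    then show ?thesis using z by (auto simp: not_le)
  qed
  then obtain z F where z: "\<And>n. norm (z n) < 1 / real (Suc n)" and F: "\<And>n. F n \<in> ent_dom"
    and less: "\<And>n. gm (tm (F n) + z n) - blinfun_apply y (tp (F n)) - \<eta> (F n) < a'" by metis
  have "z \<longlonglongrightarrow> 0"
  proof (rule Lim_null_comparison)
    show "(\<lambda>n. 1 / real (Suc n)) \<longlonglongrightarrow> 0"
      using LIMSEQ_inverse_real_of_nat by (simp add: inverse_eq_divide)
  qed (use z in \<open>auto intro!: always_eventually less_imp_le\<close>)
  obtain r \<mu> where r: "strict_mono r" "\<mu> \<in> inv_functionals" "wlim (\<lambda>n. F (r n)) \<mu>"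
    using inv_subseq[of F] ent_dom_inv[OF F] by metis
  have inv: "F (r n) \<in> inv_functionals" for n using F ent_dom_inv by blast
  have "(\<lambda>n. tm (F (r n)) + z (r n)) \<longlonglongrightarrow> tm \<mu> + 0"
    using LIMSEQ_subseq_LIMSEQ[OF \<open>z \<longlonglongrightarrow> 0\<close> r(1)] tm_tendsto[of "\<lambda>n. F (r n)", OF inv r(3)]
    by (intro tendsto_add) (auto simp: o_def)
  then have lim: "(\<lambda>n. tm (F (r n)) + z (r n)) \<longlonglongrightarrow> tm \<mu>" by simp
  have *: "\<mu> \<in> ent_dom \<and> b - a' - blinfun_apply y (tp \<mu>) \<le> \<eta> \<mu>" if b: "b < gm (tm \<mu>)" for b
  proof -
    have "\<forall>\<^sub>F w in nhds (tm \<mu>). b < gm w"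
      using gm_lsc b unfolding lower_semicont_def by blast
    then have "\<forall>\<^sub>F n in sequentially. b < gm (tm (F (r n)) + z (r n))"
      using lim by (rule eventually_compose_filterlim)
    then obtain N where N: "\<And>n. n \<ge> N \<Longrightarrow> b < gm (tm (F (r n)) + z (r n))"
      by (auto simp: eventually_sequentially)
    let ?F = "\<lambda>n. F (r (n + N))"
    have wl: "wlim ?F \<mu>"
    proof
      fix \<phi>
      have "(\<lambda>n. F (r n) \<phi>) \<longlonglongrightarrow> \<mu> \<phi>" using r(3) by blast
      then show "(\<lambda>n. ?F n \<phi>) \<longlonglongrightarrow> \<mu> \<phi>" by (rule LIMSEQ_ignore_initial_segment)
    qed
    have ge: "b - a' - blinfun_apply y (tp (?F n)) \<le> \<eta> (?F n)" for n
      using less[of "r (n + N)"] N[of "n + N"] by simp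
    have "(\<lambda>n. b - a' - blinfun_apply y (tp (?F n))) \<longlonglongrightarrow> b - a' - blinfun_apply y (tp \<mu>)"
      by (intro tendsto_diff tendsto_const apply_tp_tendsto[of ?F] wl ent_dom_inv F)
    with \<eta>_usc[of ?F, OF F wl ge] show ?thesis by blast
  qed
  have \<mu>: "\<mu> \<in> ent_dom" using *[of "gm (tm \<mu>) - 1"] by simp
  have "gm (tm \<mu>) \<le> a' + blinfun_apply y (tp \<mu>) + \<eta> \<mu>"
  proof (rule field_le_epsilon)
    fix e :: real assume "e > 0"
    then show "gm (tm \<mu>) \<le> a' + blinfun_apply y (tp \<mu>) + \<eta> \<mu> + e"
      using *[of "gm (tm \<mu>) - e"] by simp
  qed
  then show False using perturbed_le[OF \<mu>, of y 0] a' by simp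
qed

lemma perturbed_subgradient_0:
  obtains x :: "'y \<Rightarrow>\<^sub>L real" where "\<And>z. perturbed y 0 + blinfun_apply x z \<le> perturbed y z"
proof -
  obtain \<mu>0 where \<mu>0: "\<mu>0 \<in> ent_dom" using ent_dom_nonempty by blast
  let ?p0 = "perturbed y 0" and ?H = "blinfun_apply y (tp \<mu>0) + \<eta> \<mu>0"
  \<comment> \<open>The level is \<open>?p0 - 1 + ?H\<close> so that one \<open>R\<close> serves all
    heights \<open>a\<close> above \<open>?p0 - 1\<close>: an affine minorant of height
    \<open>a\<close> and slope \<open>x\<close> will satisfy
    \<open>onorm \<theta>m * norm x - conjugate gm x \<ge> a + ?H\<close>.\<close>
  obtain R where R: "\<And>x. R < norm x \<Longrightarrow> ereal (onorm \<theta>m * norm x) - conjugate gm x < ereal (?p0 - 1 + ?H)"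
    using minimal_linear_growthD[OF gm_growth] by blast
  have cone: "a - R * norm z \<le> perturbed y z" if a: "?p0 - 1 < a" "a < ?p0" for a z
  proof -
    obtain r where r: "r > 0" "\<And>z. norm z < r \<Longrightarrow> a < perturbed y z"
      using perturbed_lsc_0[OF a(2)] by blast
    have gt: "a < perturbed y (0 + z)" if "norm z < r" for z using r(2)[OF that] by simp
    obtain x :: "'y \<Rightarrow>\<^sub>L real" where x: "\<And>z. a + blinfun_apply x z \<le> perturbed y (0 + z)"
      using convex_locally_gt_imp_affine_minorant[OF convex_on_perturbed r(1) gt] by blast
    \<comment> \<open>Perturbing by \<open>w - tm \<mu>0\<close> makes the cost of
      \<open>\<mu>0\<close> involve \<open>gm w\<close>; the minorant of the value function becomes
      one of \<open>gm\<close> and bounds the conjugate at its slope.\<close>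
    have "blinfun_apply x w - gm w \<le> onorm \<theta>m * norm x - ?H - a" for w
    proof -
      have "a + blinfun_apply x (w - tm \<mu>0) \<le> gm w - ?H"
        using x[of "w - tm \<mu>0"] perturbed_le[OF \<mu>0, of y "w - tm \<mu>0"] by simp
      moreover have "blinfun_apply x (tm \<mu>0) \<le> onorm \<theta>m * norm x"
      proof -
        have "blinfun_apply x (tm \<mu>0) \<le> norm x * norm (tm \<mu>0)" using norm_blinfun[of x "tm \<mu>0"] by simp
        also have "\<dots> \<le> norm x * onorm \<theta>m"
          using norm_tm_le[OF ent_dom_inv[OF \<mu>0]] by (intro mult_left_mono) auto
        finally show ?thesis by (simp add: mult.commute)
      qed
      ultimately show ?thesis by (simp add: blinfun.diff_right)
    qed
    then have conj: "conjugate gm x \<le> ereal (onorm \<theta>m * norm x - ?H - a)"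
      by (simp add: conjugate_le_iff)
    have "norm x \<le> R"
    proof (rule ccontr)
      assume "\<not> norm x \<le> R"
      then have "ereal (onorm \<theta>m * norm x) - conjugate gm x < ereal (?p0 - 1 + ?H)" by (intro R) simp
      with conj a show False by (cases "conjugate gm x") auto
    qed
    then have "norm x * norm z \<le> R * norm z" by (intro mult_right_mono) auto
    then have "- (R * norm z) \<le> blinfun_apply x z"
      using norm_blinfun[of x z] by simp
    then show ?thesis using x[of z] by simp
  qed
  have "?p0 - R * norm z \<le> perturbed y (0 + z)" for z
  proof (rule field_le_epsilon)
    fix e :: real assume e: "e > 0"
    \<comment> \<open>Half of \<open>min e 1\<close> keeps \<open>a\<close> strictly between
      \<open>?p0 - 1\<close> and \<open>?p0\<close>, where \<open>cone\<close> applies, and within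
      \<open>e\<close> of \<open>?p0\<close>.\<close>
    define a where "a = ?p0 - min e 1 / 2"
    have "?p0 - 1 < a" "a < ?p0" "?p0 - e \<le> a" using e by (auto simp: a_def min_def)
    then show "?p0 - R * norm z \<le> perturbed y (0 + z) + e" using cone[of a z] by simp
  qed
  from convex_lower_cone[OF convex_on_perturbed this] obtain x :: "'y \<Rightarrow>\<^sub>L real"
    where "\<And>z. ?p0 + blinfun_apply x z \<le> perturbed y (0 + z)" by blast
  then show ?thesis by (intro that[of x]) simp
qed

section \<open>The problem with \<open>gp\<close> replaced by a linear functional\<close>

definition value_fn :: "('x \<Rightarrow>\<^sub>L real) \<Rightarrow> real" where
  "value_fn y = - perturbed y 0"

definition maximizers :: "('x \<Rightarrow>\<^sub>L real) \<Rightarrow> 'a cdual set" where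
  "maximizers y = {\<mu> \<in> ent_dom. \<eta> \<mu> - (gm (tm \<mu>) - blinfun_apply y (tp \<mu>)) = value_fn y}"

lemma value_fn_ge: "\<mu> \<in> ent_dom \<Longrightarrow> \<eta> \<mu> - (gm (tm \<mu>) - blinfun_apply y (tp \<mu>)) \<le> value_fn y"
  using perturbed_le[of \<mu> y 0] by (simp add: value_fn_def)

lemma maximizers_nonempty: "maximizers y \<noteq> {}"
proof -
  obtain \<mu> where \<mu>: "\<mu> \<in> ent_dom"
    "\<And>\<nu>. \<nu> \<in> ent_dom \<Longrightarrow> \<eta> \<nu> - (gm (tm \<nu>) - blinfun_apply y (tp \<nu>)) \<le> \<eta> \<mu> - (gm (tm \<mu>) - blinfun_apply y (tp \<mu>))"
    using maximizer_exists[OF seq_lsc_cost_0[of y]] by blast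
  then have "- (\<eta> \<mu> - (gm (tm \<mu>) - blinfun_apply y (tp \<mu>))) \<le> perturbed y 0"
    by (intro perturbed_greatest) (simp add: algebra_simps)
  then have "\<mu> \<in> maximizers y"
    using value_fn_ge[OF \<mu>(1), of y] \<mu>(1) by (auto simp: maximizers_def value_fn_def)
  then show ?thesis by blast
qed

lemma maximizers_convex: "convex (maximizers y)"
proof (rule convexI)
  fix \<mu> \<nu> and u v :: real
  assume \<mu>\<nu>: "\<mu> \<in> maximizers y" "\<nu> \<in> maximizers y" and uv: "0 \<le> u" "0 \<le> v" "u + v = 1"
  let ?\<kappa> = "u *\<^sub>R \<mu> + v *\<^sub>R \<nu>"
  let ?J = "\<lambda>\<mu>. \<eta> \<mu> - (gm (tm \<mu>) - blinfun_apply y (tp \<mu>))"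
  have ent_dom: "\<mu> \<in> ent_dom" "\<nu> \<in> ent_dom" and pressure: "?J \<mu> = value_fn y" "?J \<nu> = value_fn y" using \<mu>\<nu> by (auto simp: maximizers_def)
  have \<kappa>: "?\<kappa> \<in> ent_dom" "u * \<eta> \<mu> + v * \<eta> \<nu> \<le> \<eta> ?\<kappa>" using \<eta>_concave[OF ent_dom uv] by auto
  have "gm (tm ?\<kappa>) \<le> u * gm (tm \<mu>) + v * gm (tm \<nu>)"
    using gm_convex uv unfolding tm_combination convex_on_def by blast
  moreover have "blinfun_apply y (tp ?\<kappa>) = u * blinfun_apply y (tp \<mu>) + v * blinfun_apply y (tp \<nu>)"
    by (simp add: tp_combination blinfun.add_right blinfun.scaleR_right)
  ultimately have "u * ?J \<mu> + v * ?J \<nu> \<le> ?J ?\<kappa>" using \<kappa>(2) by (simp add: algebra_simps)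
  moreover have "u * value_fn y + v * value_fn y = value_fn y" using uv by (simp add: distrib_right[symmetric])
  ultimately show "?\<kappa> \<in> maximizers y"
    using value_fn_ge[OF \<kappa>(1), of y] \<kappa>(1) unfolding pressure by (simp add: maximizers_def)
qed

text \<open>Superlevel sets are sequentially closed by \<open>usc_limit\<close>; at the height of an
  upper bound, level and superlevel sets coincide.\<close>

lemma compactin_level_set:
  assumes G: "seq_lsc G" and max: "\<And>\<mu>. \<mu> \<in> ent_dom \<Longrightarrow> \<eta> \<mu> - G \<mu> \<le> c"
  shows "compactin weak_star {\<mu> \<in> ent_dom. \<eta> \<mu> - G \<mu> = c}"
proof (rule compactin_strong_operator_topology[OF compact_seq, of _ 1])
  show "norm \<mu> \<le> 1" if "\<mu> \<in> {\<mu> \<in> ent_dom. \<eta> \<mu> - G \<mu> = c}" for \<mu>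
    using that by (auto intro: inv_norm ent_dom_inv)
  fix F \<Lambda>
  assume F: "range F \<subseteq> {\<mu> \<in> ent_dom. \<eta> \<mu> - G \<mu> = c}"
    and lim: "\<And>\<phi>. (\<lambda>n. blinfun_apply (F n) \<phi>) \<longlonglongrightarrow> blinfun_apply \<Lambda> \<phi>"
  have F': "F n \<in> ent_dom" "c \<le> \<eta> (F n) - G (F n)" for n
    using F by (auto simp: image_subset_iff)
  have wl: "wlim F \<Lambda>" using lim by blast
  have "\<Lambda> \<in> ent_dom" "c \<le> \<eta> \<Lambda> - G \<Lambda>"
    using usc_limit[of G F \<Lambda> "\<lambda>_. c", OF G F'(1) wl F'(2) tendsto_const] by auto
  then show "\<Lambda> \<in> {\<mu> \<in> ent_dom. \<eta> \<mu> - G \<mu> = c}" using max[of \<Lambda>] by auto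
qed

lemma maximizers_compact: "compactin weak_star (maximizers y)"
  unfolding maximizers_def by (rule compactin_level_set[OF seq_lsc_cost_0 value_fn_ge])

section \<open>Duality for a fixed linear functional\<close>

lemma SUP_inv_eq:
  fixes f :: "'a cdual \<Rightarrow> ereal"
  assumes ent_dom: "\<And>\<mu>. \<mu> \<in> ent_dom \<Longrightarrow> f \<mu> = ereal (pressure \<mu>)"
    and not_ent_dom: "\<And>\<mu>. \<mu> \<in> inv_functionals \<Longrightarrow> \<mu> \<notin> ent_dom \<Longrightarrow> f \<mu> = -\<infinity>"
    and \<mu>: "\<mu> \<in> ent_dom" and max: "\<And>\<nu>. \<nu> \<in> ent_dom \<Longrightarrow> pressure \<nu> \<le> pressure \<mu>"
  shows "(SUP \<mu>\<in>inv_functionals. f \<mu>) = ereal (pressure \<mu>)"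
proof (rule antisym)
  show "(SUP \<mu>\<in>inv_functionals. f \<mu>) \<le> ereal (pressure \<mu>)"
  proof (rule SUP_least)
    show "f \<nu> \<le> ereal (pressure \<mu>)" if "\<nu> \<in> inv_functionals" for \<nu>
      using that ent_dom not_ent_dom max by (cases "\<nu> \<in> ent_dom") auto
  qed
  show "ereal (pressure \<mu>) \<le> (SUP \<mu>\<in>inv_functionals. f \<mu>)"
    using ent_dom[OF \<mu>] ent_dom_inv[OF \<mu>] by (metis SUP_upper)
qed

lemma entropy_not_ent_dom: "\<mu> \<in> inv_functionals \<Longrightarrow> \<mu> \<notin> ent_dom \<Longrightarrow> entropy_h m \<mu> = -\<infinity>"
  by (simp add: ent_dom_def)

lemma lin_func_ent_dom:
  "\<mu> \<in> ent_dom \<Longrightarrow> lin_func m \<theta>p \<theta>m yp ym \<mu> = ereal (\<eta> \<mu> - blinfun_apply ym (tm \<mu>) + blinfun_apply yp (tp \<mu>))"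
  by (simp add: lin_func_def entropy_ent_dom)

lemma lin_func_not_ent_dom:
  "\<mu> \<in> inv_functionals \<Longrightarrow> \<mu> \<notin> ent_dom \<Longrightarrow> lin_func m \<theta>p \<theta>m yp ym \<mu> = -\<infinity>"
  by (simp add: lin_func_def entropy_not_ent_dom)

text \<open>Attainment in \<open>ent_dom\<close> makes \<open>P_L\<close> a real number, so that it
  can be added to and cancelled against a conjugate that may be \<open>\<infinity>\<close>.\<close>

lemma P_L_attained:
  obtains \<mu> where "\<mu> \<in> ent_dom"
    "P_L m \<theta>p \<theta>m yp ym = ereal (\<eta> \<mu> - blinfun_apply ym (tm \<mu>) + blinfun_apply yp (tp \<mu>))"
proof -
  have "seq_lsc (\<lambda>\<mu>. 0)" by (simp add: seq_lsc_def)
  then have "seq_lsc (\<lambda>\<mu>. 0 - (blinfun_apply yp (tp \<mu>) - blinfun_apply ym (tm \<mu>)))"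
    by (rule seq_lsc_diff) (intro tendsto_diff apply_tp_tendsto apply_tm_tendsto)
  from maximizer_exists[OF this] obtain \<mu> where \<mu>: "\<mu> \<in> ent_dom"
    "\<And>\<nu>. \<nu> \<in> ent_dom \<Longrightarrow> \<eta> \<nu> - (0 - (blinfun_apply yp (tp \<nu>) - blinfun_apply ym (tm \<nu>)))
        \<le> \<eta> \<mu> - (0 - (blinfun_apply yp (tp \<mu>) - blinfun_apply ym (tm \<mu>)))" by blast
  have "P_L m \<theta>p \<theta>m yp ym = ereal (\<eta> \<mu> - blinfun_apply ym (tm \<mu>) + blinfun_apply yp (tp \<mu>))"
    unfolding P_L_def
    by (rule SUP_inv_eq) (use lin_func_ent_dom lin_func_not_ent_dom \<mu>(1) in auto, use \<mu>(2) in \<open>simp add: algebra_simps\<close>)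
  with \<mu>(1) show ?thesis by (rule that)
qed

lemma P_L_ge:
  assumes "\<mu> \<in> ent_dom"
  shows "ereal (\<eta> \<mu> - blinfun_apply ym (tm \<mu>) + blinfun_apply yp (tp \<mu>)) \<le> P_L m \<theta>p \<theta>m yp ym"
  unfolding P_L_def lin_func_ent_dom[OF assms, symmetric] using assms by (intro SUP_upper ent_dom_inv)

definition conj_gp :: "('x \<Rightarrow>\<^sub>L real) \<Rightarrow> real" where
  "conj_gp y = real_of_ereal (conjugate gp y)"

lemma conjugate_gp: "conjugate gp y = ereal (conj_gp y)"
proof -
  have "conjugate gp y \<in> range ereal" using gp_conj_real by blast
  then show ?thesis by (cases "conjugate gp y") (auto simp: conj_gp_def)
qed

lemma conjugate_not_MInf: "conjugate gm x \<noteq> -\<infinity>"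
  using fenchel_young[of x 0 gm] by auto

text \<open>Weak duality: Fenchel--Young at a maximiser of the nonlinear problem.\<close>

lemma dual_ge_value_fn: "ereal (value_fn y) \<le> P_L m \<theta>p \<theta>m y x + conjugate gm x"
proof -
  obtain \<mu> where \<mu>: "\<mu> \<in> ent_dom" "\<eta> \<mu> - (gm (tm \<mu>) - blinfun_apply y (tp \<mu>)) = value_fn y"
    using maximizers_nonempty[of y] by (auto simp: maximizers_def)
  have "ereal (value_fn y) = ereal (\<eta> \<mu> - blinfun_apply x (tm \<mu>) + blinfun_apply y (tp \<mu>))
      + ereal (blinfun_apply x (tm \<mu>) - gm (tm \<mu>))"
    using \<mu>(2) by simp
  also have "\<dots> \<le> P_L m \<theta>p \<theta>m y x + conjugate gm x"
    by (intro add_mono P_L_ge \<mu>(1) fenchel_young)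
  finally show ?thesis .
qed

text \<open>Let \<open>x\<close> be a subgradient of the perturbed value function at
  \<open>0\<close> and \<open>\<mu>\<close> attain \<open>P_L\<close> for it. The perturbation
  \<open>w - tm \<mu>\<close> then bounds \<open>x w - gm w\<close> by \<open>value_fn y\<close>
  minus \<open>P_L\<close>, for every \<open>w\<close>; this is the missing half of duality.\<close>

lemma dual_attained:
  obtains x where "P_L m \<theta>p \<theta>m y x + conjugate gm x = ereal (value_fn y)"
proof -
  obtain x :: "'y \<Rightarrow>\<^sub>L real" where x: "\<And>z. perturbed y 0 + blinfun_apply x z \<le> perturbed y z"
    using perturbed_subgradient_0[of y] by blast
  obtain \<mu> where \<mu>: "\<mu> \<in> ent_dom"
    and PL: "P_L m \<theta>p \<theta>m y x = ereal (\<eta> \<mu> - blinfun_apply x (tm \<mu>) + blinfun_apply y (tp \<mu>))"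
    by (rule P_L_attained)
  let ?l = "\<eta> \<mu> - blinfun_apply x (tm \<mu>) + blinfun_apply y (tp \<mu>)"
  have "blinfun_apply x w - gm w \<le> value_fn y - ?l" for w
    using x[of "w - tm \<mu>"] perturbed_le[OF \<mu>, of y "w - tm \<mu>"] by (simp add: value_fn_def blinfun.diff_right)
  then have "conjugate gm x \<le> ereal (value_fn y - ?l)" by (simp add: conjugate_le_iff)
  then have "P_L m \<theta>p \<theta>m y x + conjugate gm x \<le> ereal ?l + ereal (value_fn y - ?l)"
    unfolding PL by (rule add_left_mono)
  then show ?thesis using dual_ge_value_fn[of y x] by (intro that[of x] antisym) auto
qed

lemma P_flat_eq: "P_flat m \<theta>p \<theta>m gp gm y = ereal (value_fn y - conj_gp y)"
proof (rule antisym)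
  obtain x where "P_L m \<theta>p \<theta>m y x + conjugate gm x = ereal (value_fn y)" by (rule dual_attained)
  then have "P_NL m \<theta>p \<theta>m gp gm y x = ereal (value_fn y - conj_gp y)" by (simp add: P_NL_def conjugate_gp)
  then show "P_flat m \<theta>p \<theta>m gp gm y \<le> ereal (value_fn y - conj_gp y)"
    unfolding P_flat_def by (metis INF_lower UNIV_I)
  show "ereal (value_fn y - conj_gp y) \<le> P_flat m \<theta>p \<theta>m gp gm y"
    unfolding P_flat_def
  proof (rule INF_greatest)
    fix x
    have "ereal (value_fn y) - ereal (conj_gp y) \<le> P_L m \<theta>p \<theta>m y x + conjugate gm x - ereal (conj_gp y)"
      by (intro ereal_minus_mono dual_ge_value_fn order_refl)
    then show "ereal (value_fn y - conj_gp y) \<le> P_NL m \<theta>p \<theta>m gp gm y x" by (simp add: P_NL_def conjugate_gp)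
  qed
qed

lemma M_flat_iff:
  "x \<in> M_flat m \<theta>p \<theta>m gp gm y \<longleftrightarrow> P_L m \<theta>p \<theta>m y x + conjugate gm x = ereal (value_fn y)"
proof -
  obtain l where "P_L m \<theta>p \<theta>m y x = ereal l" using P_L_attained by metis
  then show ?thesis
    unfolding M_flat_def mem_Collect_eq P_flat_eq P_NL_def conjugate_gp
    using conjugate_not_MInf[of x] by (cases "conjugate gm x") auto
qed

lemma M_flat_nonempty: "M_flat m \<theta>p \<theta>m gp gm y \<noteq> {}"
proof -
  obtain x where "P_L m \<theta>p \<theta>m y x + conjugate gm x = ereal (value_fn y)" by (rule dual_attained)
  then have "x \<in> M_flat m \<theta>p \<theta>m gp gm y" by (simp add: M_flat_iff)
  then show ?thesis by blast
qed

text \<open>For \<open>\<mu>\<close> in \<open>ent_dom\<close> the linear pressure is at most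
  \<open>l\<close>, and the Fenchel--Young term at most \<open>k\<close>. They add up to the
  nonlinear objective, and \<open>l + k = value_fn y\<close>; so the objective is maximal exactly
  when both bounds are equalities, which are the two conditions in \<open>E_sc2\<close>. Outside
  \<open>ent_dom\<close> the linear pressure is \<open>-\<infinity>\<close> and cannot equal
  \<open>l\<close>.\<close>

lemma E_sc2_eq_maximizers:
  assumes x: "x \<in> M_flat m \<theta>p \<theta>m gp gm y"
  shows "E_sc2 m \<theta>p \<theta>m gm y x = maximizers y"
proof -
  have sum: "P_L m \<theta>p \<theta>m y x + conjugate gm x = ereal (value_fn y)" using x by (simp add: M_flat_iff)
  obtain l where l: "P_L m \<theta>p \<theta>m y x = ereal l" using P_L_attained by metis
  obtain k where k: "conjugate gm x = ereal k"
    using sum l conjugate_not_MInf by (cases "conjugate gm x") auto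
  have lk: "l + k = value_fn y" using sum l k by simp
  show ?thesis
  proof (rule set_eqI)
    fix \<mu>
    show "\<mu> \<in> E_sc2 m \<theta>p \<theta>m gm y x \<longleftrightarrow> \<mu> \<in> maximizers y"
    proof (cases "\<mu> \<in> ent_dom")
      case True
      let ?a = "\<eta> \<mu> - blinfun_apply x (tm \<mu>) + blinfun_apply y (tp \<mu>)"
      have a: "?a \<le> l" using P_L_ge[OF True, of x y] l by simp
      have b: "blinfun_apply x (tm \<mu>) - gm (tm \<mu>) \<le> k" using fenchel_young[of x "tm \<mu>" gm] k by simp
      have "\<mu> \<in> E_sc2 m \<theta>p \<theta>m gm y x \<longleftrightarrow> ?a = l \<and> k \<le> blinfun_apply x (tm \<mu>) - gm (tm \<mu>)"
        using ent_dom_inv[OF True] by (simp add: E_sc2_def E_L_def lin_func_ent_dom[OF True] l k subdiff_iff_conjugate)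
      also have "\<dots> \<longleftrightarrow> \<eta> \<mu> - (gm (tm \<mu>) - blinfun_apply y (tp \<mu>)) = value_fn y"
        using a b lk by auto
      finally show ?thesis using True by (simp add: maximizers_def)
    next
      case False
      then show ?thesis
        using lin_func_not_ent_dom[of \<mu> y x] l by (auto simp: E_sc2_def E_L_def maximizers_def)
    qed
  qed
qed

text \<open>The description is definite because \<open>M_flat\<close> is nonempty; over an empty
  index set any \<open>E\<close> would satisfy it.\<close>

lemma E_sc_eq_maximizers: "E_sc m \<theta>p \<theta>m gp gm y = maximizers y"
  unfolding E_sc_def
proof (rule the_equality)
  show "\<forall>x\<in>M_flat m \<theta>p \<theta>m gp gm y. E_sc2 m \<theta>p \<theta>m gm y x = maximizers y"
    using E_sc2_eq_maximizers by blast
  show "E = maximizers y" if "\<forall>x\<in>M_flat m \<theta>p \<theta>m gp gm y. E_sc2 m \<theta>p \<theta>m gm y x = E" for E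
    using that M_flat_nonempty[of y] E_sc2_eq_maximizers by blast
qed

section \<open>The nonlinear pressure and its maximisers\<close>

lemma seq_lsc_total: "seq_lsc (\<lambda>\<mu>. gm (tm \<mu>) - gp (tp \<mu>))"
proof -
  have "seq_lsc (\<lambda>\<mu>. gm (tm \<mu> + 0) - gp (tp \<mu>))"
  proof (rule seq_lsc_diff[OF seq_lsc_gm])
    fix F :: "nat \<Rightarrow> 'a cdual" and \<mu>
    assume "\<And>n. F n \<in> inv_functionals" "wlim F \<mu>"
    then have "(\<lambda>n. tp (F n)) \<longlonglongrightarrow> tp \<mu>" by (rule tp_tendsto)
    \<comment> \<open>\<open>gp\<close> is subtracted from the cost, so its continuity is used here;
      convexity and boundedness on bounded sets provide it.\<close>
    then show "(\<lambda>n. gp (tp (F n))) \<longlonglongrightarrow> gp (tp \<mu>)"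
      by (rule continuous_on_tendsto_compose[OF convex_bounded_continuous[OF gp_convex gp_bounded]]) auto
  qed
  then show ?thesis by simp
qed

definition pressure :: "'a cdual \<Rightarrow> real" where
  "pressure \<mu> = \<eta> \<mu> - (gm (tm \<mu>) - gp (tp \<mu>))"

definition max_pressure :: real where
  "max_pressure = (SUP \<mu>\<in>ent_dom. pressure \<mu>)"

lemma pressure_maximum: "\<exists>\<nu>\<in>ent_dom. pressure \<nu> = max_pressure \<and> (\<forall>\<mu>\<in>ent_dom. pressure \<mu> \<le> pressure \<nu>)"
proof -
  obtain \<nu> where \<nu>: "\<nu> \<in> ent_dom" "\<And>\<mu>. \<mu> \<in> ent_dom \<Longrightarrow> pressure \<mu> \<le> pressure \<nu>"
    using maximizer_exists[OF seq_lsc_total] unfolding pressure_def by blast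
  then have "max_pressure = pressure \<nu>" unfolding max_pressure_def by (intro cSup_eq_maximum) auto
  then show ?thesis using \<nu> by auto
qed

lemma max_pressure_attained: obtains \<mu> where "\<mu> \<in> ent_dom" "pressure \<mu> = max_pressure"
  using pressure_maximum by blast

lemma pressure_le_max: "\<mu> \<in> ent_dom \<Longrightarrow> pressure \<mu> \<le> max_pressure"
  using pressure_maximum by metis

lemma P_fun_ent_dom: "\<mu> \<in> ent_dom \<Longrightarrow> P_fun m \<theta>p \<theta>m gp gm \<mu> = ereal (pressure \<mu>)"
  by (simp add: P_fun_def entropy_ent_dom pressure_def)

lemma P_fun_not_ent_dom: "\<mu> \<in> inv_functionals \<Longrightarrow> \<mu> \<notin> ent_dom \<Longrightarrow> P_fun m \<theta>p \<theta>m gp gm \<mu> = -\<infinity>"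
  by (simp add: P_fun_def entropy_not_ent_dom)

lemma SUP_P_fun: "(SUP \<mu>\<in>inv_functionals. P_fun m \<theta>p \<theta>m gp gm \<mu>) = ereal max_pressure"
proof -
  obtain \<mu> where \<mu>: "\<mu> \<in> ent_dom" "pressure \<mu> = max_pressure" by (rule max_pressure_attained)
  show ?thesis
    unfolding \<mu>(2)[symmetric] using \<mu> pressure_le_max
    by (intro SUP_inv_eq P_fun_ent_dom P_fun_not_ent_dom) auto
qed

lemma M_set_eq: "M_set (P_fun m \<theta>p \<theta>m gp gm) = {\<mu> \<in> ent_dom. pressure \<mu> = max_pressure}"
  unfolding M_set_def SUP_P_fun using P_fun_ent_dom P_fun_not_ent_dom ent_dom_inv by fastforce

lemma M_set_compact: "compactin weak_star (M_set (P_fun m \<theta>p \<theta>m gp gm))"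
  using compactin_level_set[OF seq_lsc_total, of max_pressure] pressure_le_max unfolding M_set_eq pressure_def by blast

text \<open>An approximating sequence eventually has finite entropy, because its pressures tend to a
  real number; upper semicontinuity makes its limit a maximiser. Conversely a maximiser is the limit
  of a constant sequence.\<close>

lemma E_set_eq: "E_set (P_fun m \<theta>p \<theta>m gp gm) = M_set (P_fun m \<theta>p \<theta>m gp gm)"
proof
  show "M_set (P_fun m \<theta>p \<theta>m gp gm) \<subseteq> E_set (P_fun m \<theta>p \<theta>m gp gm)"
  proof
    fix \<mu> assume \<mu>: "\<mu> \<in> M_set (P_fun m \<theta>p \<theta>m gp gm)"
    then show "\<mu> \<in> E_set (P_fun m \<theta>p \<theta>m gp gm)"
      by (auto simp: E_set_def M_set_def limitin_strong_operator_topology_iff intro!: exI[of _ "\<lambda>_. \<mu>"])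
  qed
  show "E_set (P_fun m \<theta>p \<theta>m gp gm) \<subseteq> M_set (P_fun m \<theta>p \<theta>m gp gm)"
  proof
    fix \<mu> assume "\<mu> \<in> E_set (P_fun m \<theta>p \<theta>m gp gm)"
    then obtain F :: "nat \<Rightarrow> 'a cdual" where F: "\<And>n. F n \<in> inv_functionals" and wl: "wlim F \<mu>"
      and lim: "(\<lambda>n. P_fun m \<theta>p \<theta>m gp gm (F n)) \<longlonglongrightarrow> ereal max_pressure"
      by (auto simp: E_set_def limitin_strong_operator_topology_iff SUP_P_fun image_subset_iff)
    have "\<forall>\<^sub>F n in sequentially. -\<infinity> < P_fun m \<theta>p \<theta>m gp gm (F n)"
      using lim by (rule order_tendstoD) simp
    then obtain N where N: "\<And>n. n \<ge> N \<Longrightarrow> -\<infinity> < P_fun m \<theta>p \<theta>m gp gm (F n)"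
      by (auto simp: eventually_sequentially)
    let ?F = "\<lambda>n. F (n + N)"
    have ent_dom: "?F n \<in> ent_dom" for n using N[of "n + N"] P_fun_not_ent_dom[OF F, of "n + N"] by auto
    have "(\<lambda>n. P_fun m \<theta>p \<theta>m gp gm (?F n)) \<longlonglongrightarrow> ereal max_pressure"
      using lim by (rule LIMSEQ_ignore_initial_segment)
    then have limJ: "(\<lambda>n. pressure (?F n)) \<longlonglongrightarrow> max_pressure" by (simp add: P_fun_ent_dom[OF ent_dom])
    have wl': "wlim ?F \<mu>"
    proof
      fix \<phi>
      have "(\<lambda>n. F n \<phi>) \<longlonglongrightarrow> \<mu> \<phi>" using wl by blast
      then show "(\<lambda>n. ?F n \<phi>) \<longlonglongrightarrow> \<mu> \<phi>" by (rule LIMSEQ_ignore_initial_segment)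
    qed
    have le: "pressure (?F n) \<le> \<eta> (?F n) - (gm (tm (?F n)) - gp (tp (?F n)))" for n by (simp add: pressure_def)
    have "\<mu> \<in> ent_dom" "max_pressure \<le> pressure \<mu>"
      unfolding pressure_def using usc_limit[of _ ?F, OF seq_lsc_total ent_dom wl' le limJ] by auto
    then show "\<mu> \<in> M_set (P_fun m \<theta>p \<theta>m gp gm)"
      using pressure_le_max[of \<mu>] by (simp add: M_set_eq)
  qed
qed

lemma gp_ge: "blinfun_apply y w - conj_gp y \<le> gp w"
  using fenchel_young[of y w gp] by (simp add: conjugate_gp)

lemma subdiff_gp_iff: "y \<in> subdiff gp w \<longleftrightarrow> gp w = blinfun_apply y w - conj_gp y"
  using gp_ge[of y w] by (auto simp: subdiff_iff_conjugate conjugate_gp)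

lemma value_fn_le_max_pressure: "value_fn y - conj_gp y \<le> max_pressure"
proof -
  obtain \<mu> where \<mu>: "\<mu> \<in> ent_dom" "\<eta> \<mu> - (gm (tm \<mu>) - blinfun_apply y (tp \<mu>)) = value_fn y"
    using maximizers_nonempty[of y] by (auto simp: maximizers_def)
  then show ?thesis using gp_ge[of y "tp \<mu>"] pressure_le_max[OF \<mu>(1)] by (simp add: pressure_def)
qed

text \<open>Write \<open>J\<close> for the objective with slope \<open>y\<close> at
  \<open>\<mu>\<close>. Then \<open>J - conj_gp y\<close> is at most \<open>pressure \<mu>\<close>,
  with equality exactly for subgradients, and at most \<open>value_fn y - conj_gp y\<close>, with
  equality exactly for maximisers; both upper bounds are at most \<open>max_pressure\<close>. Either
  side of the equivalence thus says \<open>J - conj_gp y = max_pressure\<close>.\<close>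

lemma maximizers_max_pressure:
  assumes \<mu>: "\<mu> \<in> ent_dom"
  shows "pressure \<mu> = max_pressure \<and> y \<in> subdiff gp (tp \<mu>) \<longleftrightarrow> value_fn y - conj_gp y = max_pressure \<and> \<mu> \<in> maximizers y"
  using value_fn_ge[OF \<mu>, of y] value_fn_le_max_pressure[of y] gp_ge[of y "tp \<mu>"] pressure_le_max[OF \<mu>] \<mu>
  by (auto simp: subdiff_gp_iff maximizers_def pressure_def)

text \<open>The supremum is attained at any subgradient of \<open>gp\<close> at
  \<open>tp \<mu>\<close>, where \<open>\<mu>\<close> maximises the pressure.\<close>

lemma P_flat_sup_eq: "P_flat_sup m \<theta>p \<theta>m gp gm = ereal max_pressure"
proof (rule antisym)
  show "P_flat_sup m \<theta>p \<theta>m gp gm \<le> ereal max_pressure"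
    unfolding P_flat_sup_def P_flat_eq using value_fn_le_max_pressure by (intro SUP_least) simp
  obtain \<mu> where \<mu>: "\<mu> \<in> ent_dom" "pressure \<mu> = max_pressure" by (rule max_pressure_attained)
  obtain y where "y \<in> subdiff gp (tp \<mu>)"
    using convex_bounded_subdiff_nonempty[OF gp_convex gp_bounded] by blast
  then have y: "value_fn y - conj_gp y = max_pressure" using \<mu> maximizers_max_pressure by blast
  have "ereal (value_fn y - conj_gp y) \<le> (SUP y. ereal (value_fn y - conj_gp y))" by (rule SUP_upper) simp
  then show "ereal max_pressure \<le> P_flat_sup m \<theta>p \<theta>m gp gm"
    unfolding P_flat_sup_def P_flat_eq y .
qed

lemma M_flat_sup_iff: "y \<in> M_flat_sup m \<theta>p \<theta>m gp gm \<longleftrightarrow> value_fn y - conj_gp y = max_pressure"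
  by (simp add: M_flat_sup_def P_flat_sup_eq P_flat_eq)

lemma maximizers_ent_dom: "\<mu> \<in> maximizers y \<Longrightarrow> \<mu> \<in> ent_dom"
  by (simp add: maximizers_def)

lemma E_sc_subset:
  assumes "y \<in> M_flat_sup m \<theta>p \<theta>m gp gm"
  shows "E_sc m \<theta>p \<theta>m gp gm y \<subseteq> {\<mu> \<in> inv_functionals. y \<in> subdiff gp (tp \<mu>)}"
  using assms maximizers_max_pressure ent_dom_inv maximizers_ent_dom unfolding E_sc_eq_maximizers M_flat_sup_iff by blast

lemma M_set_eq_Union:
  "M_set (P_fun m \<theta>p \<theta>m gp gm) = (\<Union>y\<in>M_flat_sup m \<theta>p \<theta>m gp gm. E_sc m \<theta>p \<theta>m gp gm y)"
proof -
  have "\<exists>y. y \<in> subdiff gp (tp \<mu>)" for \<mu>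
    using convex_bounded_subdiff_nonempty[OF gp_convex gp_bounded] by blast
  then show ?thesis
    unfolding M_set_eq E_sc_eq_maximizers using maximizers_max_pressure M_flat_sup_iff maximizers_ent_dom by blast
qed

text \<open>A common element \<open>\<mu>\<close> would give \<open>gp\<close> two different
  subgradients at \<open>tp \<mu>\<close>.\<close>

lemma E_sc_disjoint:
  assumes "gateaux_differentiable gp"
  shows "disjoint_family_on (E_sc m \<theta>p \<theta>m gp gm) (M_flat_sup m \<theta>p \<theta>m gp gm)"
  unfolding disjoint_family_on_def
proof (intro ballI impI)
  fix y y' assume y: "y \<in> M_flat_sup m \<theta>p \<theta>m gp gm" and y': "y' \<in> M_flat_sup m \<theta>p \<theta>m gp gm" and ne: "y \<noteq> y'"
  show "E_sc m \<theta>p \<theta>m gp gm y \<inter> E_sc m \<theta>p \<theta>m gp gm y' = {}"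
    using E_sc_subset[OF y] E_sc_subset[OF y'] gateaux_subdiff_unique[OF assms] ne by blast
qed

end

theorem theorem2p17:
  fixes m :: "'a::metric_space measure"
    and \<theta>p :: "'a bmfun \<Rightarrow> 'x::real_normed_vector"
    and \<theta>m :: "'a bmfun \<Rightarrow> 'y::real_normed_vector"
    and gp :: "'x \<Rightarrow> real"
    and gm :: "'y \<Rightarrow> real"
  assumes compact_alphabet: "compact (UNIV :: 'a set)"
    and max_dist: "(\<forall>x y :: 'a. dist x y \<le> 1) \<and> (\<exists>x y :: 'a. dist x y = 1)"
    and prob_m: "prob_space m" "sets m = sets borel" "measure_support m = UNIV"
    and theta_p: "linear \<theta>p" "sigma_normal \<theta>p"
    and theta_m: "linear \<theta>m" "sigma_normal \<theta>m"
    and gm_lsc_convex: "lower_semicont gm" "convex_on UNIV gm"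
    and gm_dom: "\<exists>R0 > 0. \<forall>R \<ge> R0.
           {x. norm x \<le> R \<and> conjugate gm x < \<infinity>} \<noteq> {} \<and>
           closedin weak_star {x. norm x \<le> R \<and> conjugate gm x < \<infinity>}"
    and gm_growth: "minimal_linear_growth (conjugate gm) (onorm \<theta>m)"
    and gp_lsc_convex: "lower_semicont gp" "convex_on UNIV gp"
    and gp_bounded: "bounded_on_bounded_sets gp"
    and gp_conj_real: "range (conjugate gp) \<subseteq> range ereal"
    and gp_growth: "minimal_linear_growth (conjugate gp) (onorm \<theta>p)"
  shows
    \<comment> \<open>(i)\<close>
    "((SUP \<mu> \<in> inv_functionals. P_fun m \<theta>p \<theta>m gp gm \<mu>) = P_flat_sup m \<theta>p \<theta>m gp gm \<and>
      P_flat_sup m \<theta>p \<theta>m gp gm =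
        (SUP yp. INF ym. P_L m \<theta>p \<theta>m yp ym + conjugate gm ym - conjugate gp yp)) \<and>
     \<comment> \<open>(ii)\<close>
     ((\<forall>xp \<in> M_flat_sup m \<theta>p \<theta>m gp gm. \<forall>xm \<in> M_flat m \<theta>p \<theta>m gp gm xp.
         E_sc2 m \<theta>p \<theta>m gm xp xm \<noteq> {} \<and>
         convex (E_sc2 m \<theta>p \<theta>m gm xp xm) \<and>
         compactin weak_star (E_sc2 m \<theta>p \<theta>m gm xp xm) \<and>
         (\<forall>xm' \<in> M_flat m \<theta>p \<theta>m gp gm xp. E_sc2 m \<theta>p \<theta>m gm xp xm' = E_sc2 m \<theta>p \<theta>m gm xp xm)) \<and>
      (\<forall>xp \<in> M_flat_sup m \<theta>p \<theta>m gp gm.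
         E_sc m \<theta>p \<theta>m gp gm xp \<subseteq> {\<mu> \<in> inv_functionals. xp \<in> subdiff gp (\<theta>p (restr_S \<mu>))})) \<and>
     \<comment> \<open>(iii)\<close>
     (E_set (P_fun m \<theta>p \<theta>m gp gm) = M_set (P_fun m \<theta>p \<theta>m gp gm) \<and>
      compactin weak_star (M_set (P_fun m \<theta>p \<theta>m gp gm)) \<and>
      M_set (P_fun m \<theta>p \<theta>m gp gm) =
        (\<Union>xp \<in> M_flat_sup m \<theta>p \<theta>m gp gm. E_sc m \<theta>p \<theta>m gp gm xp) \<and>
      (gateaux_differentiable gp \<longrightarrow>
         disjoint_family_on (E_sc m \<theta>p \<theta>m gp gm) (M_flat_sup m \<theta>p \<theta>m gp gm)))"
proof -
  interpret nonlinear_pressure m \<theta>p \<theta>m gp gm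
    using assms by (intro nonlinear_pressure.intro symbolic.intro nonlinear_pressure_axioms.intro)
  show ?thesis
  proof (intro conjI ballI impI)
    show "(SUP \<mu> \<in> inv_functionals. P_fun m \<theta>p \<theta>m gp gm \<mu>) = P_flat_sup m \<theta>p \<theta>m gp gm"
      unfolding SUP_P_fun P_flat_sup_eq ..
    show "P_flat_sup m \<theta>p \<theta>m gp gm =
        (SUP yp. INF ym. P_L m \<theta>p \<theta>m yp ym + conjugate gm ym - conjugate gp yp)"
      unfolding P_flat_sup_def P_flat_def P_NL_def ..
    fix xp xm assume xm: "xm \<in> M_flat m \<theta>p \<theta>m gp gm xp"
    show "E_sc2 m \<theta>p \<theta>m gm xp xm \<noteq> {}"
      unfolding E_sc2_eq_maximizers[OF xm] by (rule maximizers_nonempty)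
    show "convex (E_sc2 m \<theta>p \<theta>m gm xp xm)"
      unfolding E_sc2_eq_maximizers[OF xm] by (rule maximizers_convex)
    show "compactin weak_star (E_sc2 m \<theta>p \<theta>m gm xp xm)"
      unfolding E_sc2_eq_maximizers[OF xm] by (rule maximizers_compact)
    show "E_sc2 m \<theta>p \<theta>m gm xp xm' = E_sc2 m \<theta>p \<theta>m gm xp xm"
      if "xm' \<in> M_flat m \<theta>p \<theta>m gp gm xp" for xm'
      unfolding E_sc2_eq_maximizers[OF xm] E_sc2_eq_maximizers[OF that] ..
  qed (fact E_sc_subset E_set_eq M_set_compact M_set_eq_Union E_sc_disjoint)+
qed

end
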